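(* Let $n \ge 2$ and let $w_0 = n(n-1)\cdots 321 \in \mathfrak{S}_n$. Then $$\max\{\mathsf{perim}(T) : T \in T(w_0)\} = 2\left\lfloor \frac{n-1}{2}\right\rfloor + 1 = \begin{cases} n & n \text{ odd},\\ n-1 & n \text{ even},\end{cases}$$ and in any $T \in T(w_0)$ at most $n-1$ of the perimeter tiles are side-perimeter tiles.
   Context: For $w \in \mathfrak{S}_n$, Elnitsky's polygon $X(w)$ is the equilateral $2n$-gon constructed as follows: starting at the topmost vertex, label the sides $1,\ldots,n,w(n),\ldots,w(1)$ in counterclockwise order; the first $n$ sides (labeled $1,\ldots,n$, the "leftside boundary", from the top vertex to the bottom vertex) form half of a convex $2n$-gon; the remaining $n$ sides (the "rightside boundary") are drawn so that two sides are parallel (and congruent) iff they have the same label. A rhombic tiling of $X(w)$ is a tiling by rhombi all of whose edges are congruent and parallel to edges of $X(w)$; $T(w)$ is the set of these. A tile is a (strong) perimeter tile if it shares a path of at least two of its edges with the boundary of $X(w)$; $\mathsf{perim}(T)$ is the number of perimeter tiles in $T$. A perimeter tile is a left-perimeter tile if it contains two edges of the leftside boundary, a right-perimeter tile if it contains two edges of the rightside boundary, a top-perimeter tile if it contains the two boundary edges adjacent to the top vertex, and a bottom-perimeter tile if it contains the two boundary edges adjacent to the bottom vertex. Side-perimeter tiles are those that are left- or right-perimeter tiles. *)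

theory Defs
  imports "HOL-Analysis.Analysis"
begin

text \<open>The plane is \<^typ>\<open>complex\<close>. A permutation of \<open>{1..n}\<close> is a function on \<^typ>\<open>nat\<close>.
  The side labelled \<open>i\<close>, directed downwards, is the vector \<open>e i\<close>; \<open>p\<close> is the topmost vertex.\<close>

text \<open>Walking counterclockwise from the topmost vertex, the sides \<open>e 1, \<dots>, e n\<close> of equal length form
  the half of a convex \<open>2n\<close>-gon that runs from its topmost to its bottommost vertex iff they all
  point strictly downwards and their directions turn strictly counterclockwise.\<close>

definition elnitsky_sides :: "nat \<Rightarrow> (nat \<Rightarrow> complex) \<Rightarrow> bool" where
  "elnitsky_sides n e \<longleftrightarrow>
     (\<exists>s \<theta>. s > 0 \<and> strict_mono_on {1..n} \<theta> \<and> \<theta> ` {1..n} \<subseteq> {pi<..<2 * pi} \<and>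
            (\<forall>i\<in>{1..n}. e i = rcis s (\<theta> i)))"

text \<open>Vertices after \<open>k\<close> downward steps along the leftside, resp. rightside, boundary. The labels
  \<open>w n, \<dots>, w 1\<close> that are read counterclockwise from the bottom are \<open>w 1, \<dots>, w n\<close> from the top.\<close>

definition left_vertex :: "complex \<Rightarrow> (nat \<Rightarrow> complex) \<Rightarrow> nat \<Rightarrow> complex" where
  "left_vertex p e k = p + (\<Sum>i=1..k. e i)"

definition right_vertex :: "complex \<Rightarrow> (nat \<Rightarrow> complex) \<Rightarrow> (nat \<Rightarrow> nat) \<Rightarrow> nat \<Rightarrow> complex" where
  "right_vertex p e w k = p + (\<Sum>i=1..k. e (w i))"

definition left_sides :: "nat \<Rightarrow> complex \<Rightarrow> (nat \<Rightarrow> complex) \<Rightarrow> complex set set" where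
  "left_sides n p e =
     (\<lambda>k. closed_segment (left_vertex p e (k - 1)) (left_vertex p e k)) ` {1..n}"

definition right_sides ::
  "nat \<Rightarrow> complex \<Rightarrow> (nat \<Rightarrow> complex) \<Rightarrow> (nat \<Rightarrow> nat) \<Rightarrow> complex set set" where
  "right_sides n p e w =
     (\<lambda>k. closed_segment (right_vertex p e w (k - 1)) (right_vertex p e w k)) ` {1..n}"

definition elnitsky_boundary ::
  "nat \<Rightarrow> complex \<Rightarrow> (nat \<Rightarrow> complex) \<Rightarrow> (nat \<Rightarrow> nat) \<Rightarrow> complex set" where
  "elnitsky_boundary n p e w = \<Union> (left_sides n p e \<union> right_sides n p e w)"

text \<open>The region of the polygon is the closure of what its boundary encloses, so that stretches on
  which the leftside and rightside boundaries coincide (possible for general \<open>w\<close>) need no tiles.\<close>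

definition elnitsky_polygon ::
  "nat \<Rightarrow> complex \<Rightarrow> (nat \<Rightarrow> complex) \<Rightarrow> (nat \<Rightarrow> nat) \<Rightarrow> complex set" where
  "elnitsky_polygon n p e w = closure (inside (elnitsky_boundary n p e w))"

definition rhombic_tile :: "nat \<Rightarrow> (nat \<Rightarrow> complex) \<Rightarrow> complex set \<Rightarrow> bool" where
  "rhombic_tile n e t \<longleftrightarrow>
     (\<exists>q. \<exists>i\<in>{1..n}. \<exists>j\<in>{1..n}. i \<noteq> j \<and> t = convex hull {q, q + e i, q + e i + e j, q + e j})"

definition rhombic_tilings ::
  "nat \<Rightarrow> complex \<Rightarrow> (nat \<Rightarrow> complex) \<Rightarrow> (nat \<Rightarrow> nat) \<Rightarrow> complex set set set" where
  "rhombic_tilings n p e w =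
     {T. finite T \<and> (\<forall>t\<in>T. rhombic_tile n e t) \<and>
         pairwise (\<lambda>t t'. interior t \<inter> interior t' = {}) T \<and>
         \<Union> T = elnitsky_polygon n p e w}"

text \<open>A shared path of at least two edges exists iff two adjacent edges of the tile are shared.\<close>

definition perimeter_tile ::
  "nat \<Rightarrow> complex \<Rightarrow> (nat \<Rightarrow> complex) \<Rightarrow> (nat \<Rightarrow> nat) \<Rightarrow> complex set \<Rightarrow> bool" where
  "perimeter_tile n p e w t \<longleftrightarrow>
     (\<exists>a b. a edge_of t \<and> b edge_of t \<and> a \<noteq> b \<and> a \<inter> b \<noteq> {} \<and>
            a \<union> b \<subseteq> elnitsky_boundary n p e w)"

definition left_perimeter_tile ::
  "nat \<Rightarrow> complex \<Rightarrow> (nat \<Rightarrow> complex) \<Rightarrow> (nat \<Rightarrow> nat) \<Rightarrow> complex set \<Rightarrow> bool" where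
  "left_perimeter_tile n p e w t \<longleftrightarrow> perimeter_tile n p e w t \<and>
     (\<exists>a\<in>left_sides n p e. \<exists>b\<in>left_sides n p e. a \<noteq> b \<and> a \<union> b \<subseteq> t)"

definition right_perimeter_tile ::
  "nat \<Rightarrow> complex \<Rightarrow> (nat \<Rightarrow> complex) \<Rightarrow> (nat \<Rightarrow> nat) \<Rightarrow> complex set \<Rightarrow> bool" where
  "right_perimeter_tile n p e w t \<longleftrightarrow> perimeter_tile n p e w t \<and>
     (\<exists>a\<in>right_sides n p e w. \<exists>b\<in>right_sides n p e w. a \<noteq> b \<and> a \<union> b \<subseteq> t)"

definition side_perimeter_tile ::
  "nat \<Rightarrow> complex \<Rightarrow> (nat \<Rightarrow> complex) \<Rightarrow> (nat \<Rightarrow> nat) \<Rightarrow> complex set \<Rightarrow> bool" where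
  "side_perimeter_tile n p e w t \<longleftrightarrow>
     left_perimeter_tile n p e w t \<or> right_perimeter_tile n p e w t"

definition perim ::
  "nat \<Rightarrow> complex \<Rightarrow> (nat \<Rightarrow> complex) \<Rightarrow> (nat \<Rightarrow> nat) \<Rightarrow> complex set set \<Rightarrow> nat" where
  "perim n p e w T = card {t \<in> T. perimeter_tile n p e w t}"

definition longest_perm :: "nat \<Rightarrow> nat \<Rightarrow> nat" where
  "longest_perm n i = (if i \<in> {1..n} then n + 1 - i else i)"

end

theory Submission
  imports Defs
begin

text \<open>
  All sides point downwards, so every path along sides is a graph over the depth, and for the
  longest permutation the polygon is the region between the paths with labels \<open>1, \<dots>, n\<close> and
  \<open>n, \<dots>, 1\<close>. Sweep a tiling from left to right. Among the remaining tiles whose topmost vertex touches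
  the current path, a lowest one has its whole left boundary on the path: a tile that shielded part
  of it would have to start strictly below its top while touching the path itself. Two path edges
  labelled \<open>i < j\<close> can therefore be exchanged, and the tile with these labels is swept over. Labels only
  ever get inverted, so a tiling has exactly one tile for each pair \<open>i < j\<close>; no edge-to-edge assumption
  is needed.

  A perimeter tile has labels \<open>(k, k + 1)\<close> (at a left or a right vertex) or \<open>(1, n)\<close> (at the top or the
  bottom), which leaves at most \<open>n\<close> perimeter tiles, and the one with labels \<open>(1, n)\<close> is not a side tile
  unless \<open>n = 2\<close>. If all \<open>n\<close> occur, then, since a side belongs to only one tile, the tiles \<open>(k, k + 1)\<close>
  alternate between left and right; for even \<open>n\<close> the tile \<open>(1, n)\<close> then meets an occupied side both at the
  top and at the bottom. Conversely, going up in the weak order through suitable permutations produces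
  a tiling with all the required corners.
\<close>

section \<open>Paths as graphs over the depth\<close>

text \<open>A tiling is given only as a finite set of convex hulls with disjoint interiors, so top
  vertices, labels and shared edges must all be read off from point sets. Measuring points by depth
  and horizontal coordinate makes this one-dimensional: the region between two paths lies between
  two graphs, slopes that grow with the label express the convexity of the left boundary, and
  disjointness of tiles constrains functions of the depth. These functions are piecewise linear, so
  just below any depth two of them either coincide or differ throughout a short interval; this
  dichotomy carries the choice of the tile to be swept.

  The parity comes from the n - 1 consecutive pairs that alternate between the two sides. The tile
  \<open>(1, n)\<close> uses left side 1 and right side n at the top, left side n and right side 1
  at the bottom. If n is even, \<open>(1, 2)\<close> and \<open>(n - 1, n)\<close> lie on the same
  side, so either position meets a taken side. If n \<ge> 3 is odd, they lie on opposite sides, and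
  exactly one of the two positions is free.\<close>

definition depth :: "complex \<Rightarrow> real" where
  "depth z = - Im z"

definition slope :: "(nat \<Rightarrow> complex) \<Rightarrow> nat \<Rightarrow> real" where
  "slope e i = Re (e i) / depth (e i)"

definition disp :: "(nat \<Rightarrow> complex) \<Rightarrow> nat list \<Rightarrow> complex" where
  "disp e l = sum_list (map e l)"

text \<open>Outside the range of the path the values are conventions: above the start the first side
  is prolonged, past the end the path runs on vertically. This keeps the function total and
  continuous.\<close>

primrec path_x :: "(nat \<Rightarrow> complex) \<Rightarrow> nat list \<Rightarrow> real \<Rightarrow> real" where
  "path_x e [] y = 0"
| "path_x e (i # l) y =
     (if y \<le> depth (e i) then slope e i * y else Re (e i) + path_x e l (y - depth (e i)))"

definition path_at :: "(nat \<Rightarrow> complex) \<Rightarrow> complex \<Rightarrow> nat list \<Rightarrow> real \<Rightarrow> real" where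
  "path_at e q l y = Re q + path_x e l (y - depth q)"

definition band :: "real \<Rightarrow> real \<Rightarrow> (real \<Rightarrow> real) \<Rightarrow> (real \<Rightarrow> real) \<Rightarrow> complex set" where
  "band c d L R = {z. c \<le> depth z \<and> depth z \<le> d \<and> L (depth z) \<le> Re z \<and> Re z \<le> R (depth z)}"

lemma depth_simps [simp]:
  "depth (x + y) = depth x + depth y" "depth (x - y) = depth x - depth y" "depth (- x) = - depth x"
  "depth 0 = 0" "depth (of_real c * x) = c * depth x" "depth (Complex a b) = - b"
  "depth (c *\<^sub>R x) = c * depth x"
  by (auto simp: depth_def)

lemma disp_simps [simp]:
  "disp e [] = 0" "disp e (i # l) = e i + disp e l" "disp e (l @ l') = disp e l + disp e l'"
  by (auto simp: disp_def)

lemma disp_rev [simp]: "disp e (rev l) = disp e l"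
  by (induction l) (auto simp: add.commute)

lemma continuous_depth [continuous_intros]:
  "continuous_on S f \<Longrightarrow> continuous_on S (\<lambda>x. depth (f x))"
  unfolding depth_def by (intro continuous_intros)

lemma complex_eqI_depth: "Re z = Re w \<Longrightarrow> depth z = depth w \<Longrightarrow> z = w"
  by (simp add: complex_eq_iff depth_def)

lemma closed_band:
  assumes "continuous_on UNIV L" "continuous_on UNIV R"
  shows "closed (band c d L R)"
proof -
  have L: "continuous_on UNIV (\<lambda>z. L (depth z))" and R: "continuous_on UNIV (\<lambda>z. R (depth z))"
    using assms by (auto intro!: continuous_on_compose2[of UNIV _ UNIV depth] continuous_intros)
  show ?thesis
    unfolding band_def
    by (intro closed_Collect_conj closed_Collect_le continuous_intros L R)
qed

text \<open>Strict inequalities between continuous functions define an open set. Conversely, a point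
  of the interior can be moved by \<open>r/2\<close> in the four axis directions; the vertical moves
  make the depth bounds strict, the horizontal ones the bounds by \<open>L\<close> and
  \<open>R\<close>.\<close>

lemma interior_band:
  assumes "continuous_on UNIV L" "continuous_on UNIV R"
  shows "interior (band c d L R) =
    {z. c < depth z \<and> depth z < d \<and> L (depth z) < Re z \<and> Re z < R (depth z)}" (is "_ = ?I")
proof
  have L: "continuous_on UNIV (\<lambda>z. L (depth z))" and R: "continuous_on UNIV (\<lambda>z. R (depth z))"
    using assms by (auto intro!: continuous_on_compose2[of UNIV _ UNIV depth] continuous_intros)
  have "open ?I"
    by (intro open_Collect_conj open_Collect_less continuous_intros L R)
  then show "?I \<subseteq> interior (band c d L R)"
    by (intro interior_maximal) (auto simp: band_def)
  show "interior (band c d L R) \<subseteq> ?I"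
  proof
    fix z assume "z \<in> interior (band c d L R)"
    then obtain r where r: "r > 0" "ball z r \<subseteq> band c d L R"
      by (auto simp: mem_interior)
    have *: "z + w \<in> band c d L R" if "norm w < r" for w
      using that r(2) by (auto simp: dist_norm subset_iff)
    have "z + Complex (r/2) 0 \<in> band c d L R" "z + Complex (-r/2) 0 \<in> band c d L R"
      "z + Complex 0 (r/2) \<in> band c d L R" "z + Complex 0 (-r/2) \<in> band c d L R"
      using r(1) by (auto intro!: * simp: cmod_def)
    then show "z \<in> ?I"
      using r(1) by (auto simp: band_def)
  qed
qed

text \<open>Since \<open>L\<close> and \<open>R\<close> agree at both end levels, the band is a
  single point there at most, so these levels add nothing to the two graphs.\<close>

lemma frontier_band:
  assumes "continuous_on UNIV L" "continuous_on UNIV R" "L c = R c" "L d = R d"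
  shows "frontier (band c d L R) =
    {z \<in> band c d L R. Re z = L (depth z) \<or> Re z = R (depth z)}"
  unfolding frontier_def closure_closed[OF closed_band[OF assms(1,2)]] interior_band[OF assms(1,2)]
  using assms(3,4) by (force simp: band_def)

lemma Re_eq_slope: "depth (e i) > 0 \<Longrightarrow> Re (e i) = slope e i * depth (e i)"
  by (simp add: slope_def)

lemma depth_disp_nonneg: "\<forall>i\<in>set l. depth (e i) > 0 \<Longrightarrow> depth (disp e l) \<ge> 0"
  by (induction l) (auto intro: add_nonneg_nonneg less_imp_le)

lemma depth_disp_pos: "\<forall>i\<in>set l. depth (e i) > 0 \<Longrightarrow> l \<noteq> [] \<Longrightarrow> depth (disp e l) > 0"
  by (cases l) (auto intro: add_pos_nonneg depth_disp_nonneg)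

lemma path_x_0 [simp]: "\<forall>i\<in>set l. depth (e i) > 0 \<Longrightarrow> path_x e l 0 = 0"
  by (cases l) auto

lemma path_x_append:
  assumes "\<forall>i\<in>set (l @ l'). depth (e i) > 0" "y \<ge> 0"
  shows "path_x e (l @ l') y =
    (if y \<le> depth (disp e l) then path_x e l y else Re (disp e l) + path_x e l' (y - depth (disp e l)))"
  using assms
proof (induction l arbitrary: y)
  case Nil
  then show ?case by (auto simp: order_antisym)
next
  case (Cons i l)
  have "depth (disp e l) \<ge> 0" using Cons.prems by (intro depth_disp_nonneg) auto
  then show ?case using Cons by (auto simp: algebra_simps)
qed

lemma path_x_end:
  assumes "\<forall>i\<in>set l. depth (e i) > 0"
  shows "path_x e l (depth (disp e l)) = Re (disp e l)"
  using assms
proof (induction l)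
  case (Cons i l)
  have "depth (disp e l) \<ge> 0" using Cons.prems by (intro depth_disp_nonneg) auto
  moreover have "depth (disp e l) = 0 \<Longrightarrow> l = []"
    using Cons.prems depth_disp_pos[of l e] by force
  ultimately show ?case using Cons by (auto simp: Re_eq_slope)
qed auto

lemma continuous_path_x:
  assumes "\<forall>i\<in>set l. depth (e i) > 0"
  shows "continuous_on UNIV (path_x e l)"
  using assms
proof (induction l)
  case Nil
  then show ?case by (simp add: fun_eq_iff[of "path_x e []"] cong: continuous_on_cong)
next
  case (Cons i l)
  have "continuous_on UNIV (path_x e l)" using Cons by auto
  then have "continuous_on UNIV (\<lambda>y. path_x e l (y - depth (e i)))"
    by (rule continuous_on_compose2) (auto intro!: continuous_intros)
  then have "continuous_on UNIV (\<lambda>y. if y \<le> depth (e i) then slope e i * y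
     else Re (e i) + path_x e l (y - depth (e i)))"
    using Cons.prems
    by (intro continuous_on_cases_le)
      (auto intro!: continuous_intros intro: continuous_on_subset simp: Re_eq_slope)
  then show ?case by (simp cong: continuous_on_cong)
qed

lemma path_at_simps:
  assumes "\<forall>i\<in>set l. depth (e i) > 0"
  shows "path_at e q l (depth q) = Re q"
    "path_at e q l (depth q + depth (disp e l)) = Re (q + disp e l)"
  using assms by (auto simp: path_at_def path_x_end)

lemma continuous_path_at:
  assumes "\<forall>i\<in>set l. depth (e i) > 0"
  shows "continuous_on UNIV (path_at e q l)"
  unfolding path_at_def
  by (intro continuous_intros continuous_on_compose2[OF continuous_path_x[OF assms]]) auto

text \<open>Piecewise linearity in the form that the sweep uses: the one-sided germ of a path below
  any depth is affine, so two such germs are equal as soon as they meet arbitrarily close to that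
  depth.\<close>

lemma path_x_right_affine:
  assumes "\<forall>i\<in>set l. depth (e i) > 0"
  shows "\<exists>c. \<forall>\<^sub>F y' in at_right y. path_x e l y' = path_x e l y + c * (y' - y)"
  using assms
proof (induction l arbitrary: y)
  case Nil
  then show ?case by (auto intro!: exI[of _ 0])
next
  case (Cons i l)
  show ?case
  proof (cases "y < depth (e i)")
    case True
    then have "\<forall>\<^sub>F y' in at_right y. y' < depth (e i)"
      by (auto simp: eventually_at_right[OF True])
    then show ?thesis
      using True by (intro exI[of _ "slope e i"]) (auto elim!: eventually_mono simp: algebra_simps)
  next
    case False
    obtain c where c: "\<forall>\<^sub>F y' in at_right (y - depth (e i)).
        path_x e l y' = path_x e l (y - depth (e i)) + c * (y' - (y - depth (e i)))"
      using Cons.IH[of "y - depth (e i)"] Cons.prems by auto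
    have "filterlim (\<lambda>y'. y' - depth (e i)) (at_right (y - depth (e i))) (at_right y)"
      unfolding filterlim_at by (auto simp: eventually_at_filter intro!: tendsto_intros)
    from eventually_compose_filterlim[OF c this]
    have 1: "\<forall>\<^sub>F y' in at_right y. path_x e l (y' - depth (e i)) =
       path_x e l (y - depth (e i)) + c * (y' - y)"
      by simp
    have 2: "\<forall>\<^sub>F y' in at_right y. y < y'"
      by (rule eventually_at_right_less)
    have 3: "path_x e (i # l) y = Re (e i) + path_x e l (y - depth (e i))"
      using False Cons.prems by (cases "y = depth (e i)") (auto simp: Re_eq_slope)
    have "\<forall>\<^sub>F y' in at_right y. path_x e (i # l) y' = path_x e (i # l) y + c * (y' - y)"
      using 1 2
    proof eventually_elim
      case (elim y')
      then show ?case unfolding 3 using False by simp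
    qed
    then show ?thesis by blast
  qed
qed

text \<open>Distinct labels have distinct slopes, so a straight piece as long as the side \<open>i\<close> and with its
  slope can only be the side \<open>i\<close> itself. This replaces any edge-to-edge assumption on tilings.\<close>

lemma path_x_segment:
  assumes "\<forall>k\<in>set l. depth (e k) > 0" "depth (e i) > 0" "distinct l"
    and "inj_on (slope e) (insert i (set l))"
    and "0 \<le> u" "u + depth (e i) \<le> depth (disp e l)"
    and "\<And>y. u < y \<Longrightarrow> y < u + depth (e i) \<Longrightarrow> path_x e l y = c + slope e i * (y - u)"
  shows "\<exists>l1 l2. l = l1 @ i # l2 \<and> u = depth (disp e l1) \<and> c = Re (disp e l1)"
  using assms
proof (induction l arbitrary: u c)
  case Nil
  then show ?case by simp
next
  case (Cons k l)
  note eq = Cons.prems(7)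
  have affine_slope: "k' = i"
    if "a < b" "u \<le> a" "b \<le> u + depth (e i)" "k' \<in> set (k # l)"
      "\<And>y. a < y \<Longrightarrow> y < b \<Longrightarrow> path_x e (k # l) y = d + slope e k' * (y - v)" for a b d v k'
  proof -
    \<comment> \<open>If one side governs a subinterval of the straight piece, its points at one
      third and two thirds determine the slope, and distinct labels have distinct slopes.\<close>
    define y1 y2 where "y1 = (2 * a + b) / 3" and "y2 = (a + 2 * b) / 3"
    have y: "a < y1" "y1 < y2" "y2 < b" using that(1) by (auto simp: y1_def y2_def)
    have "d + slope e k' * (y1 - v) = c + slope e i * (y1 - u)"
      "d + slope e k' * (y2 - v) = c + slope e i * (y2 - u)"
      using that(5)[of y1] that(5)[of y2] eq[of y1] eq[of y2] y that by auto
    then have "slope e k' * (y2 - y1) = slope e i * (y2 - y1)"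
      by (simp add: algebra_simps)
    then have "slope e k' = slope e i" using y by simp
    then show ?thesis using inj_onD[OF Cons.prems(4)] that(4) by auto
  qed
  show ?case
  proof (cases "depth (e k) \<le> u")
    case True
    have "\<exists>l1 l2. l = l1 @ i # l2 \<and> u - depth (e k) = depth (disp e l1) \<and> c - Re (e k) = Re (disp e l1)"
    proof (rule Cons.IH)
      fix y assume "u - depth (e k) < y" "y < u - depth (e k) + depth (e i)"
      then show "path_x e l y = (c - Re (e k)) + slope e i * (y - (u - depth (e k)))"
        using eq[of "y + depth (e k)"] True by (auto simp: algebra_simps)
    qed (use Cons.prems True in \<open>auto elim: inj_on_subset\<close>)
    then obtain l1 l2 where "l = l1 @ i # l2" "u - depth (e k) = depth (disp e l1)"
      "c - Re (e k) = Re (disp e l1)" by blast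
    then show ?thesis by (intro exI[of _ "k # l1"] exI[of _ l2]) auto
  next
    case False
    have [simp]: "k = i"
    proof (rule affine_slope[where v = 0 and d = 0])
      show "u < min (u + depth (e i)) (depth (e k))" using False Cons.prems by auto
    qed auto
    \<comment> \<open>A piece that started strictly inside the first side would, having the same
      length, run on into the next side, which would then carry the label \<open>i\<close> a second
      time.\<close>
    have "u = 0"
    proof (rule ccontr)
      assume "u \<noteq> 0"
      then have u: "u > 0" using Cons.prems by auto
      then have "l \<noteq> []" using Cons.prems by auto
      then obtain k' l' where l: "l = k' # l'" by (cases l) auto
      have "k' = i"
      proof (rule affine_slope[where v = "depth (e i)" and d = "Re (e i)"])
        show "depth (e i) < min (u + depth (e i)) (depth (e i) + depth (e k'))"
          using u Cons.prems l by auto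
      qed (use u False l in auto)
      then show False using Cons.prems l by auto
    qed
    moreover from this have "c = 0" using eq[of "depth (e i) / 2"] Cons.prems(2) by auto
    ultimately show ?thesis by (intro exI[of _ "[]"] exI[of _ l]) auto
  qed
qed

section \<open>Convexity of bands, and rhombi as bands between two-step paths\<close>

definition rhomb :: "(nat \<Rightarrow> complex) \<Rightarrow> complex \<Rightarrow> nat \<Rightarrow> nat \<Rightarrow> complex set" where
  "rhomb e q i j = convex hull {q, q + e i, q + e i + e j, q + e j}"

lemma convex_depth_halfspace: "convex {z. a * Re z + b * depth z \<le> c}"
proof -
  have "{z. a * Re z + b * depth z \<le> c} = {z. inner (Complex a (-b)) z \<le> c}"
    by (auto simp: depth_def inner_complex_def)
  then show ?thesis by (simp add: convex_halfspace_le)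
qed

lemma path_x_ge_line:
  assumes "\<forall>i\<in>set l. depth (e i) > 0 \<and> s \<le> slope e i" "0 \<le> y" "y \<le> depth (disp e l)"
  shows "s * y \<le> path_x e l y"
  using assms
proof (induction l arbitrary: y)
  case Nil
  then show ?case by simp
next
  case (Cons i l)
  show ?case
  proof (cases "y \<le> depth (e i)")
    case True
    then show ?thesis using Cons.prems by (auto intro: mult_right_mono)
  next
    case False
    have "s * (y - depth (e i)) \<le> path_x e l (y - depth (e i))"
      using Cons.prems False by (intro Cons.IH) auto
    moreover have "s * depth (e i) \<le> slope e i * depth (e i)"
      using Cons.prems by (auto intro: mult_right_mono)
    ultimately have "s * y \<le> slope e i * depth (e i) + path_x e l (y - depth (e i))"
      by (simp add: algebra_simps)
    then show ?thesis using False Cons.prems by (simp add: Re_eq_slope)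
  qed
qed

text \<open>Increasing slopes make the path a convex function of the depth, and the set is its
  epigraph, with the first side prolonged upwards. It is the half-plane to the right of the first
  side cut with a translate of the epigraph of the remaining path, which gives the induction. The
  cut at the bottom level discards the vertical continuation, which could break convexity.\<close>

lemma convex_right_of_path:
  assumes "\<forall>i\<in>set l. depth (e i) > 0" "sorted_wrt (\<lambda>i j. slope e i < slope e j) l"
  shows "convex {z. depth z \<le> depth (disp e l) \<and> path_x e l (depth z) \<le> Re z}"
  using assms
proof (induction l)
  case Nil
  have "{z. depth z \<le> depth (disp e []) \<and> path_x e [] (depth z) \<le> Re z} =
    {z. 0 * Re z + 1 * depth z \<le> 0} \<inter> {z. (-1) * Re z + 0 * depth z \<le> 0}" by auto
  then show ?case by (simp only:) (intro convex_Int convex_depth_halfspace)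
next
  case (Cons i l)
  have line: "convex {z. slope e i * depth z \<le> Re z}"
    using convex_depth_halfspace[of "-1" "slope e i" 0] by simp
  show ?case
  proof (cases l)
    case Nil
    have "{z. depth z \<le> depth (disp e (i # l)) \<and> path_x e (i # l) (depth z) \<le> Re z} =
      {z. 0 * Re z + 1 * depth z \<le> depth (e i)} \<inter> {z. slope e i * depth z \<le> Re z}"
      using Nil by auto
    then show ?thesis by (simp only:) (intro convex_Int convex_depth_halfspace line)
  next
    case (Cons k l')
    let ?E = "{z. depth z \<le> depth (disp e l) \<and> path_x e l (depth z) \<le> Re z}"
    have ge: "slope e i * y \<le> path_x e l y" if "0 \<le> y" "y \<le> depth (disp e l)" for y
      using Cons.prems that by (intro path_x_ge_line) (auto intro: less_imp_le)
    have le: "path_x e l y \<le> slope e i * y" if "y \<le> 0" for y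
      using Cons.prems that Cons by (auto intro: mult_right_mono_neg)
    have "{z. depth z \<le> depth (disp e (i # l)) \<and> path_x e (i # l) (depth z) \<le> Re z} =
      {z. slope e i * depth z \<le> Re z} \<inter> (+) (e i) ` ?E" (is "?A = ?B")
    proof (rule set_eqI)
      fix z
      have img: "z \<in> (+) (e i) ` ?E \<longleftrightarrow> z - e i \<in> ?E"
        by (force intro: image_eqI[of _ _ "z - e i"])
      show "z \<in> ?A \<longleftrightarrow> z \<in> ?B"
      proof (cases "depth z \<le> depth (e i)")
        case True
        have "depth z - depth (e i) \<le> depth (disp e l)"
          using True Cons.prems depth_disp_nonneg[of l e] by auto
        then show ?thesis
          unfolding Int_iff img mem_Collect_eq
          using True Cons.prems le[of "depth z - depth (e i)"]
          by (auto simp: Re_eq_slope algebra_simps)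
      next
        case False
        then show ?thesis
          unfolding Int_iff img mem_Collect_eq
          using Cons.prems ge[of "depth z - depth (e i)"]
          by (auto simp: Re_eq_slope algebra_simps)
      qed
    qed
    moreover have "convex ?E" using Cons.IH Cons.prems by auto
    ultimately show ?thesis
      using line by (simp only:) (intro convex_Int convex_translation)
  qed
qed

lemma path_x_mirror: "path_x (\<lambda>i. - cnj (e i)) l y = - path_x e l y"
  by (induction l arbitrary: y) (auto simp: depth_def slope_def)

text \<open>The reflection of z to \<open>- cnj z\<close> keeps depths and negates slopes, which
  turns this region into one to the right of a path.\<close>

lemma convex_left_of_path:
  assumes "\<forall>i\<in>set l. depth (e i) > 0" "sorted_wrt (\<lambda>i j. slope e i > slope e j) l"
  shows "convex {z. depth z \<le> depth (disp e l) \<and> Re z \<le> path_x e l (depth z)}"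
proof -
  let ?e = "\<lambda>i. - cnj (e i)"
  have d: "depth (disp ?e l) = depth (disp e l)"
    by (induction l) (auto simp: depth_def)
  have "convex {z. depth z \<le> depth (disp ?e l) \<and> path_x ?e l (depth z) \<le> Re z}"
    using assms by (intro convex_right_of_path)
      (auto simp: depth_def slope_def sorted_wrt_iff_nth_less)
  then have "convex ((\<lambda>z. - cnj z) -` {z. depth z \<le> depth (disp ?e l) \<and> path_x ?e l (depth z) \<le> Re z})"
    by (intro convex_linear_vimage) (auto intro!: linearI simp: scaleR_conv_of_real)
  also have "(\<lambda>z. - cnj z) -` {z. depth z \<le> depth (disp ?e l) \<and> path_x ?e l (depth z) \<le> Re z} =
    {z. depth z \<le> depth (disp e l) \<and> Re z \<le> path_x e l (depth z)}"
    by (auto simp: d path_x_mirror) (auto simp: depth_def)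
  finally show ?thesis .
qed

lemma convex_band:
  assumes "\<forall>i\<in>set l. depth (e i) > 0" "sorted_wrt (\<lambda>i j. slope e i < slope e j) l"
    and "\<forall>i\<in>set r. depth (e i) > 0" "sorted_wrt (\<lambda>i j. slope e i > slope e j) r"
    and "depth (disp e l) = depth (disp e r)"
  shows "convex (band (depth q) (depth q + depth (disp e l)) (path_at e q l) (path_at e q r))"
proof -
  let ?E = "{z. depth z \<le> depth (disp e l) \<and> path_x e l (depth z) \<le> Re z}"
  let ?F = "{z. depth z \<le> depth (disp e r) \<and> Re z \<le> path_x e r (depth z)}"
  let ?H = "{z. 0 * Re z + (-1) * depth z \<le> 0}"
  have img: "z \<in> (+) q ` S \<longleftrightarrow> z - q \<in> S" for z S
    by (force intro: image_eqI[of _ _ "z - q"])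
  have "band (depth q) (depth q + depth (disp e l)) (path_at e q l) (path_at e q r) =
    (+) q ` (?H \<inter> (?E \<inter> ?F))"
    using assms(5) by (auto simp: img band_def path_at_def)
  moreover have "convex (?H \<inter> (?E \<inter> ?F))"
    by (intro convex_Int convex_depth_halfspace convex_right_of_path[OF assms(1,2)]
        convex_left_of_path[OF assms(3,4)])
  ultimately show ?thesis by (simp only: convex_translation)
qed

lemma path_x_swap_less:
  assumes "depth (e i) > 0" "depth (e j) > 0" "slope e i < slope e j"
    and "0 < y" "y < depth (e i) + depth (e j)"
  shows "path_x e [i, j] y < path_x e [j, i] y"
proof -
  have *: "slope e i * u < slope e j * u" if "0 < u" for u
    using that assms by simp
  show ?thesis
    using assms *[of y] *[of "depth (e i)"] *[of "depth (e j)"]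
      *[of "depth (e i) + depth (e j) - y"] by (auto simp: Re_eq_slope algebra_simps)
qed

lemma path_x_swap_le:
  assumes "depth (e i) > 0" "depth (e j) > 0" "slope e i < slope e j"
    and "0 \<le> y"
  shows "path_x e [i, j] y \<le> path_x e [j, i] y"
proof -
  consider "y = 0" | "0 < y" "y < depth (e i) + depth (e j)" | "y \<ge> depth (e i) + depth (e j)"
    using assms by linarith
  then show ?thesis
  proof cases
    case 2
    then show ?thesis using path_x_swap_less[OF assms(1-3)] by force
  qed (use assms in \<open>auto simp: Re_eq_slope algebra_simps\<close>)
qed

text \<open>The band is convex and contains the four vertices, so it contains the rhomb. For the
  converse, the coordinates of a point of the band with respect to \<open>e i\<close> and
  \<open>e j\<close> are computed and found to lie between 0 and 1.\<close>

lemma rhomb_eq_band: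
  assumes "depth (e i) > 0" "depth (e j) > 0" "slope e i < slope e j"
  shows "rhomb e q i j = band (depth q) (depth q + (depth (e i) + depth (e j)))
    (path_at e q [i, j]) (path_at e q [j, i])" (is "_ = ?B")
proof
  have "convex ?B"
    using convex_band[of "[i, j]" e "[j, i]" q] assms by auto
  moreover have "{q, q + e i, q + e i + e j, q + e j} \<subseteq> ?B"
    using assms path_x_swap_le[OF assms, of "depth (e i)"] path_x_swap_le[OF assms, of "depth (e j)"]
    by (auto simp: band_def path_at_def Re_eq_slope algebra_simps)
  ultimately show "rhomb e q i j \<subseteq> ?B"
    unfolding rhomb_def by (intro hull_minimal)
  show "?B \<subseteq> rhomb e q i j"
  proof
    fix z assume z: "z \<in> ?B"
    define x y where "x = Re z - Re q" and "y = depth z - depth q"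
    define s t where "s = slope e i" and "t = slope e j"
    define h k where "h = depth (e i)" and "k = depth (e j)"
    have pos: "h > 0" "k > 0" "t > s" "t - s > 0" using assms by (auto simp: h_def k_def s_def t_def)
    have y: "0 \<le> y" "y \<le> h + k" using z by (auto simp: band_def y_def h_def k_def)
    have x: "(if y \<le> h then s * y else s * h + t * (y - h)) \<le> x"
        "x \<le> (if y \<le> k then t * y else t * k + s * (y - k))"
      using z y assms by (auto simp: band_def path_at_def x_def y_def h_def k_def s_def t_def Re_eq_slope
          split: if_splits)
    have mono: "u \<ge> 0 \<Longrightarrow> s * u \<le> t * u" for u using pos by (simp add: mult_right_mono)
    \<comment> \<open>The left path is the larger and the right path the smaller of its two lines.
      The case splits thus become four linear inequalities, one for each bound on the two
      coordinates.\<close>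
    have ineq: "s * y \<le> x" "s * h + t * (y - h) \<le> x" "x \<le> t * y" "x \<le> t * k + s * (y - k)"
      using x mono[of "h - y"] mono[of "y - h"] mono[of "k - y"] mono[of "y - k"]
      by (auto simp: algebra_simps split: if_splits)
    \<comment> \<open>Cramer's rule for the depth equation \<alpha> h + \<beta> k = y and the
      horizontal equation s \<alpha> h + t \<beta> k = x.\<close>
    define \<alpha> \<beta> where "\<alpha> = (t * y - x) / (h * (t - s))" and "\<beta> = (x - s * y) / (k * (t - s))"
    have ab: "0 \<le> \<alpha>" "\<alpha> \<le> 1" "0 \<le> \<beta>" "\<beta> \<le> 1"
      using pos ineq by (auto simp: \<alpha>_def \<beta>_def divide_le_eq algebra_simps)
    have \<alpha>h: "\<alpha> * h = (t * y - x) / (t - s)" and \<beta>k: "\<beta> * k = (x - s * y) / (t - s)"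
      using pos by (auto simp: \<alpha>_def \<beta>_def)
    have "\<alpha> * h + \<beta> * k = (t * y - s * y) / (t - s)"
      unfolding \<alpha>h \<beta>k by (simp flip: add_divide_distrib)
    then have dy: "\<alpha> * h + \<beta> * k = y"
      using pos by (simp add: left_diff_distrib[symmetric])
    have "s * (\<alpha> * h) + t * (\<beta> * k) = (s * (t * y - x) + t * (x - s * y)) / (t - s)"
      unfolding \<alpha>h \<beta>k by (simp flip: add_divide_distrib)
    also have "s * (t * y - x) + t * (x - s * y) = (t - s) * x" by (simp add: algebra_simps)
    finally have dx: "s * (\<alpha> * h) + t * (\<beta> * k) = x" using pos by simp
    have zeq: "z = q + \<alpha> *\<^sub>R e i + \<beta> *\<^sub>R e j"
      using dx dy assms
      by (intro complex_eqI_depth) (auto simp: x_def y_def h_def k_def s_def t_def Re_eq_slope algebra_simps)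
    let ?H = "convex hull {q, q + e i, q + e i + e j, q + e j}"
    have c: "q \<in> ?H" "q + e i \<in> ?H" "q + e i + e j \<in> ?H" "q + e j \<in> ?H"
      by (auto intro: hull_inc)
    have 1: "(1 - \<alpha>) *\<^sub>R q + \<alpha> *\<^sub>R (q + e i) \<in> ?H"
      using ab c by (intro convexD_alt) auto
    have 2: "(1 - \<alpha>) *\<^sub>R (q + e j) + \<alpha> *\<^sub>R (q + e i + e j) \<in> ?H"
      using ab c by (intro convexD_alt) auto
    have "(1 - \<beta>) *\<^sub>R ((1 - \<alpha>) *\<^sub>R q + \<alpha> *\<^sub>R (q + e i)) +
        \<beta> *\<^sub>R ((1 - \<alpha>) *\<^sub>R (q + e j) + \<alpha> *\<^sub>R (q + e i + e j)) \<in> ?H"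
      by (rule convexD_alt[OF convex_convex_hull 1 2]) (use ab in auto)
    also have "(1 - \<beta>) *\<^sub>R ((1 - \<alpha>) *\<^sub>R q + \<alpha> *\<^sub>R (q + e i)) +
        \<beta> *\<^sub>R ((1 - \<alpha>) *\<^sub>R (q + e j) + \<alpha> *\<^sub>R (q + e i + e j)) = z"
      unfolding zeq by (simp add: algebra_simps)
    finally show "z \<in> rhomb e q i j" by (simp add: rhomb_def)
  qed
qed

section \<open>Permutations and the weak order\<close>

primrec before :: "'a list \<Rightarrow> 'a \<Rightarrow> 'a \<Rightarrow> bool" where
  "before [] x y \<longleftrightarrow> False"
| "before (a # l) x y \<longleftrightarrow> x = a \<and> y \<in> set l \<or> before l x y"

lemma before_append [simp]:
  "before (l @ l') x y \<longleftrightarrow> before l x y \<or> before l' x y \<or> x \<in> set l \<and> y \<in> set l'"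
  by (induction l) auto

lemma before_in_set: "before l x y \<Longrightarrow> x \<in> set l \<and> y \<in> set l"
  by (induction l) auto

lemma before_total: "x \<in> set l \<Longrightarrow> y \<in> set l \<Longrightarrow> x \<noteq> y \<Longrightarrow> before l x y \<or> before l y x"
  by (induction l) auto

lemma before_asym: "distinct l \<Longrightarrow> before l x y \<Longrightarrow> \<not> before l y x"
  by (induction l) (auto dest: before_in_set)

lemma before_trans: "distinct l \<Longrightarrow> before l x y \<Longrightarrow> before l y z \<Longrightarrow> before l x z"
  by (induction l) (auto dest: before_in_set)

lemma before_rev [simp]: "before (rev l) x y \<longleftrightarrow> before l y x"
  by (induction l) auto

lemma before_filter: "P x \<Longrightarrow> P y \<Longrightarrow> before l x y \<Longrightarrow> before (filter P l) x y"
  by (induction l) auto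

lemma before_filterD: "before (filter P l) x y \<Longrightarrow> before l x y"
  by (induction l) (auto split: if_splits)

lemma sorted_wrt_before: "sorted_wrt (before l) l"
proof (induction l)
  case (Cons a l)
  then show ?case by (auto elim!: sorted_wrt_mono_rel[rotated])
qed auto

lemma sorted_wrt_beforeD: "sorted_wrt R l \<Longrightarrow> before l x y \<Longrightarrow> R x y"
  by (induction l) auto

lemma sorted_wrt_unique:
  assumes "sorted_wrt R u" "sorted_wrt R v" "set u = set v" "distinct u" "distinct v"
    and "\<And>x y. R x y \<Longrightarrow> \<not> R y x"
  shows "u = v"
  using assms
proof (induction u arbitrary: v)
  case (Cons a u)
  then obtain b v' where v: "v = b # v'" by (cases v) auto
  have "a = b"
  proof (rule ccontr)
    assume "a \<noteq> b"
    then have "a \<in> set v'" "b \<in> set u" using Cons.prems(3) v by auto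
    then show False using Cons.prems v by auto
  qed
  moreover from this have "set u = set v'" using Cons.prems v by (auto simp: insert_eq_iff)
  ultimately show ?case using Cons v by auto
qed auto

text \<open>On arrangements of a fixed set of labels this is the complement of the inversion set,
  and its reverse inclusion is the weak order. The complement is recorded because its pairs index
  the tiles that are still to be swept.\<close>

definition noninv :: "nat list \<Rightarrow> (nat \<times> nat) set" where
  "noninv l = {(i, j). i < j \<and> before l i j}"

lemma noninv_swap:
  assumes "distinct (l1 @ i # j # l2)" "i < j"
  shows "noninv (l1 @ i # j # l2) = insert (i, j) (noninv (l1 @ j # i # l2))"
    "(i, j) \<notin> noninv (l1 @ j # i # l2)"
  using assms by (auto simp: noninv_def dest: before_in_set)

lemma finite_noninv: "finite (noninv l)"
  by (rule finite_subset[of _ "set l \<times> set l"]) (auto simp: noninv_def dest: before_in_set)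

text \<open>Every descent of \<open>u\<close> is ordered by \<open>v\<close> as in \<open>u\<close>,
  because \<open>noninv v\<close> is contained in \<open>noninv u\<close>. If all adjacent ascents
  were also ordered as in \<open>v\<close>, then \<open>u\<close> would be sorted with respect to
  the order of \<open>v\<close> and hence equal to it.\<close>

lemma exists_ascent:
  assumes "distinct u" "distinct v" "set u = set v" "noninv v \<subseteq> noninv u" "u \<noteq> v"
  shows "\<exists>l1 i j l2. u = l1 @ i # j # l2 \<and> i < j \<and> (i, j) \<notin> noninv v"
proof (rule ccontr)
  assume none: "\<not> ?thesis"
  have "before v i j" if "u = l1 @ i # j # l2" for l1 i j l2
  proof (rule ccontr)
    assume nb: "\<not> before v i j"
    have ij: "i \<noteq> j" "i \<in> set v" "j \<in> set v" using that assms(1,3) by auto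
    then have b: "before v j i" using before_total nb by metis
    consider "i < j" | "j < i" using ij by linarith
    then show False
    proof cases
      case 1
      then show False using none that nb by (auto simp: noninv_def)
    next
      case 2
      then have "(j, i) \<in> noninv u" using b assms(4) by (auto simp: noninv_def)
      then have "before u j i" by (simp add: noninv_def)
      moreover have "before u i j" using that by auto
      ultimately show False using before_asym assms(1) by metis
    qed
  qed
  then have "successively (before v) u"
    by (auto simp: successively_conv_nth) (metis Cons_nth_drop_Suc Suc_lessD append_take_drop_id)
  then have "sorted_wrt (before v) u"
    using before_trans[OF assms(2)] by (subst (asm) successively_conv_sorted_wrt) (auto intro!: transpI)
  then have "u = v"
    using sorted_wrt_before assms(1-3) before_asym[OF assms(2)]
    by (intro sorted_wrt_unique[of "before v"]) auto
  with assms(5) show False by simp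
qed

text \<open>Exchanging ascents supplied by \<open>exists_ascent\<close> leads from \<open>u\<close>
  to \<open>v\<close>, removing one non-inversion at a time. The property travels along this chain
  backwards, so the step undoes an exchange.\<close>

lemma weak_order_induct:
  assumes "distinct u" "distinct v" "set u = set v" "noninv v \<subseteq> noninv u"
    and base: "P v"
    and step: "\<And>l1 i j l2. \<lbrakk>distinct (l1 @ i # j # l2); set (l1 @ i # j # l2) = set v; i < j;
       noninv v \<subseteq> noninv (l1 @ j # i # l2); P (l1 @ j # i # l2)\<rbrakk> \<Longrightarrow> P (l1 @ i # j # l2)"
  shows "P u"
  using assms(1,3,4)
proof (induction "card (noninv u)" arbitrary: u rule: less_induct)
  case less
  show ?case
  proof (cases "u = v")
    case True
    then show ?thesis using base by simp
  next
    case False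
    then obtain l1 i j l2 where u: "u = l1 @ i # j # l2" "i < j" "(i, j) \<notin> noninv v"
      using exists_ascent[of u v] less.prems assms(2) by auto
    let ?u = "l1 @ j # i # l2"
    have N: "noninv u = insert (i, j) (noninv ?u)" "(i, j) \<notin> noninv ?u"
      using noninv_swap less.prems u by auto
    have sub: "noninv v \<subseteq> noninv ?u" using N less.prems u by auto
    have "P ?u"
    proof (rule less.hyps)
      show "card (noninv ?u) < card (noninv u)" using N finite_noninv[of ?u] by simp
    qed (use less.prems u sub in auto)
    then show ?thesis using step[of l1 i j l2] less.prems u sub by auto
  qed
qed

section \<open>Sweeping a tiling\<close>

text \<open>The polygon in the coordinates used here: positive depth says that all sides point
  downwards, and slopes increasing with the label say that the left boundary is convex.\<close>

locale downward_sides =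
  fixes n :: nat and e :: "nat \<Rightarrow> complex" and p :: complex
  assumes depth_pos: "i \<in> {1..n} \<Longrightarrow> 0 < depth (e i)"
    and slope_less: "i \<in> {1..n} \<Longrightarrow> j \<in> {1..n} \<Longrightarrow> i < j \<Longrightarrow> slope e i < slope e j"
begin

definition perm :: "nat list \<Rightarrow> bool" where
  "perm l \<longleftrightarrow> distinct l \<and> set l = {1..n}"

definition ids :: "nat list" where
  "ids = [1..<Suc n]"

definition total :: real where
  "total = depth (\<Sum>i=1..n. e i)"

definition reg :: "nat list \<Rightarrow> complex set" where
  "reg l = band (depth p) (depth p + total) (path_at e p l) (path_at e p (rev ids))"

text \<open>The covering condition is stated for the interior only, because the region degenerates to a curve
  wherever the path \<open>l\<close> already runs along the rightside boundary.\<close>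

definition partial_tiling :: "nat list \<Rightarrow> complex set set \<Rightarrow> bool" where
  "partial_tiling l S \<longleftrightarrow> finite S \<and> (\<forall>t\<in>S. \<exists>q i j. 1 \<le> i \<and> i < j \<and> j \<le> n \<and> t = rhomb e q i j) \<and>
     pairwise (\<lambda>t t'. interior t \<inter> interior t' = {}) S \<and>
     interior (reg l) \<subseteq> \<Union> S \<and> \<Union> S \<subseteq> reg l"

lemma perm_depth_pos: "perm l \<Longrightarrow> \<forall>i\<in>set l. 0 < depth (e i)"
  by (auto simp: perm_def depth_pos)

lemma perm_ids [simp]: "perm ids" "perm (rev ids)"
  by (auto simp: perm_def ids_def)

lemma disp_perm: "perm l \<Longrightarrow> disp e l = (\<Sum>i=1..n. e i)"
  by (simp add: perm_def disp_def sum_list_distinct_conv_sum_set)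

lemma depth_disp_perm: "perm l \<Longrightarrow> depth (disp e l) = total"
  by (simp add: total_def disp_perm)

lemma sorted_ids: "sorted_wrt (<) ids"
  by (simp add: ids_def del: upt_Suc)

lemma before_ids: "before ids i j \<Longrightarrow> i < j"
  using sorted_wrt_beforeD[OF sorted_ids] .

lemma noninv_rev_ids [simp]: "noninv (rev ids) = {}"
  using before_ids by (force simp: noninv_def)

lemma noninv_ids: "noninv ids = {(i, j). 1 \<le> i \<and> i < j \<and> j \<le> n}"
proof -
  have "before ids i j" if "1 \<le> i" "i < j" "j \<le> n" for i j
    using before_ids[of j i] before_total[of i ids j] perm_ids(1) that by (auto simp: perm_def)
  then show ?thesis by (auto simp: noninv_def dest!: before_in_set) (auto simp: ids_def less_Suc_eq)
qed

lemma perm_swap: "perm (l1 @ i # j # l2) \<longleftrightarrow> perm (l1 @ j # i # l2)"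
  by (auto simp: perm_def)

lemma perm_swap_facts:
  assumes "perm (l1 @ i # j # l2)" "i < j"
  shows "0 < depth (e i)" "0 < depth (e j)" "slope e i < slope e j"
    "1 \<le> i" "j \<le> n" "0 \<le> depth (disp e l1)" "0 \<le> depth (disp e l2)"
    "depth (disp e l1) + (depth (e i) + depth (e j)) + depth (disp e l2) = total"
proof -
  have "i \<in> {1..n}" "j \<in> {1..n}" "set l1 \<subseteq> {1..n}" "set l2 \<subseteq> {1..n}"
    using assms by (auto simp: perm_def)
  then show "0 < depth (e i)" "0 < depth (e j)" "slope e i < slope e j"
    "1 \<le> i" "j \<le> n" "0 \<le> depth (disp e l1)" "0 \<le> depth (disp e l2)"
    using assms(2) by (auto intro!: depth_pos slope_less depth_disp_nonneg)
  show "depth (disp e l1) + (depth (e i) + depth (e j)) + depth (disp e l2) = total"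
    using depth_disp_perm[OF assms(1)] by simp
qed

text \<open>With \<open>path_at_outside\<close> this localises an exchange: between the top and the
  bottom of the two exchanged sides only these two matter, and elsewhere the path is
  unchanged.\<close>

lemma path_at_middle:
  assumes "perm (l1 @ i # j # l2)"
    and "depth (p + disp e l1) \<le> y" "y \<le> depth (p + disp e l1) + (depth (e i) + depth (e j))"
  shows "path_at e p (l1 @ i # j # l2) y = path_at e (p + disp e l1) [i, j] y"
proof -
  have d: "\<forall>k\<in>set (l1 @ i # j # l2). 0 < depth (e k)" using perm_depth_pos[OF assms(1)] .
  have d1: "depth (disp e l1) \<ge> 0" using d by (intro depth_disp_nonneg) auto
  have "path_x e (l1 @ i # j # l2) (y - depth p) = Re (disp e l1) + path_x e [i, j] (y - depth p - depth (disp e l1))"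
    using path_x_append[of "l1" "i # j # l2" e "y - depth p"] path_x_end[of l1 e]
      path_x_append[of "[i, j]" l2 e "y - depth p - depth (disp e l1)"] d d1 assms(2,3)
    by (cases "y - depth p = depth (disp e l1)") auto
  then show ?thesis by (simp add: path_at_def algebra_simps)
qed

lemma path_at_outside:
  assumes "perm (l1 @ i # j # l2)" "depth p \<le> y"
    and "y \<le> depth (p + disp e l1) \<or> depth (p + disp e l1) + (depth (e i) + depth (e j)) \<le> y"
  shows "path_at e p (l1 @ i # j # l2) y = path_at e p (l1 @ j # i # l2) y"
proof -
  have d: "\<forall>k\<in>set (l1 @ i # j # l2). 0 < depth (e k)" using perm_depth_pos[OF assms(1)] .
  have d1: "depth (disp e l1) \<ge> 0" using d by (intro depth_disp_nonneg) auto
  have "path_x e (l1 @ i # j # l2) (y - depth p) = path_x e (l1 @ j # i # l2) (y - depth p)"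
    using path_x_append[of "l1" "i # j # l2" e "y - depth p"]
      path_x_append[of "l1" "j # i # l2" e "y - depth p"]
      path_x_append[of "[i, j]" l2 e "y - depth p - depth (disp e l1)"]
      path_x_append[of "[j, i]" l2 e "y - depth p - depth (disp e l1)"] d d1 assms(2,3)
      path_x_end[of "[i, j]" e]  path_x_end[of "[j, i]" e]
    by (cases "y - depth p = depth (disp e l1) + (depth (e i) + depth (e j))") (auto simp: add_ac)
  then show ?thesis by (simp add: path_at_def)
qed

lemma path_at_swap_le:
  assumes "perm (l1 @ i # j # l2)" "i < j" "depth p \<le> y"
  shows "path_at e p (l1 @ i # j # l2) y \<le> path_at e p (l1 @ j # i # l2) y"
proof (cases "depth (p + disp e l1) \<le> y \<and> y \<le> depth (p + disp e l1) + (depth (e i) + depth (e j))")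
  case True
  then show ?thesis
    using path_at_middle[OF assms(1), of y] path_at_middle[of l1 j i l2 y] assms(1)
      path_x_swap_le[OF perm_swap_facts(1-3)[OF assms(1,2)], of "y - depth (p + disp e l1)"]
    by (auto simp: perm_swap path_at_def add_ac)
next
  case False
  then show ?thesis using path_at_outside[OF assms(1,3)] by auto
qed

text \<open>Each exchange of an ascent moves the path weakly to the right, so the weak order implies
  the pointwise order of paths. In particular \<open>rev ids\<close> is the rightmost path.\<close>

lemma path_at_mono:
  assumes "perm u" "perm v" "noninv v \<subseteq> noninv u" "depth p \<le> y"
  shows "path_at e p u y \<le> path_at e p v y"
proof (rule weak_order_induct[where P = "\<lambda>u. path_at e p u y \<le> path_at e p v y"])
  fix l1 i j l2
  assume "distinct (l1 @ i # j # l2)" "set (l1 @ i # j # l2) = set v" "i < j"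
    and "path_at e p (l1 @ j # i # l2) y \<le> path_at e p v y"
  then show "path_at e p (l1 @ i # j # l2) y \<le> path_at e p v y"
    using path_at_swap_le[of l1 i j l2 y] assms by (auto simp: perm_def)
qed (use assms in \<open>auto simp: perm_def\<close>)

lemma path_at_le_rev_ids: "perm l \<Longrightarrow> depth p \<le> y \<Longrightarrow> path_at e p l y \<le> path_at e p (rev ids) y"
  by (rule path_at_mono) auto

lemma rhomb_band:
  assumes "1 \<le> i" "i < j" "j \<le> n"
  shows "rhomb e q i j = band (depth q) (depth q + (depth (e i) + depth (e j)))
    (path_at e q [i, j]) (path_at e q [j, i])"
  using assms by (intro rhomb_eq_band depth_pos slope_less) auto

lemma continuous_path_at_pair:
  assumes "1 \<le> i" "i \<le> n" "1 \<le> j" "j \<le> n"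
  shows "continuous_on UNIV (path_at e q [i, j])"
  using assms by (intro continuous_path_at) (auto intro!: depth_pos)

lemma continuous_path_at_perm: "perm l \<Longrightarrow> continuous_on UNIV (path_at e p l)"
  by (intro continuous_path_at perm_depth_pos)

lemma interior_rhomb:
  assumes "1 \<le> i" "i < j" "j \<le> n"
  shows "interior (rhomb e q i j) = {z. depth q < depth z \<and>
    depth z < depth q + (depth (e i) + depth (e j)) \<and>
    path_at e q [i, j] (depth z) < Re z \<and> Re z < path_at e q [j, i] (depth z)}"
  using assms by (simp add: rhomb_band interior_band continuous_path_at_pair)

lemma path_at_pair_less:
  assumes "1 \<le> i" "i < j" "j \<le> n" "depth q < y" "y < depth q + (depth (e i) + depth (e j))"
  shows "path_at e q [i, j] y < path_at e q [j, i] y"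
  using path_x_swap_less[of e i j "y - depth q"] assms depth_pos slope_less by (auto simp: path_at_def)

lemma path_at_pair_le:
  assumes "1 \<le> i" "i < j" "j \<le> n" "depth q \<le> y"
  shows "path_at e q [i, j] y \<le> path_at e q [j, i] y"
  using path_x_swap_le[of e i j "y - depth q"] assms depth_pos slope_less by (auto simp: path_at_def)

text \<open>Used to pass from interiors to whole tiles: what holds for the interior of a tile and is
  a closed condition holds for the tile.\<close>

lemma rhomb_closure_interior:
  assumes "1 \<le> i" "i < j" "j \<le> n"
  shows "closure (interior (rhomb e q i j)) = rhomb e q i j"
proof -
  have d: "0 < depth (e i)" "0 < depth (e j)" using assms by (auto intro!: depth_pos)
  have "compact (rhomb e q i j)"
    unfolding rhomb_def by (intro finite_imp_compact_convex_hull) auto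
  \<comment> \<open>A point in the interior: halfway between the two boundaries at the depth of the
    left vertex.\<close>
  have "Complex ((path_at e q [i, j] (depth q + depth (e i)) + path_at e q [j, i] (depth q + depth (e i))) / 2)
     (- (depth q + depth (e i))) \<in> interior (rhomb e q i j)"
    using d path_at_pair_less[OF assms, of q "depth q + depth (e i)"]
    by (simp add: interior_rhomb[OF assms] add.commute[of "depth (e i)" "depth q"])
  moreover have "convex (rhomb e q i j)" by (simp add: rhomb_def)
  ultimately show ?thesis
    using \<open>compact (rhomb e q i j)\<close> compact_imp_closed
    by (metis convex_closure_interior closure_closed empty_iff)
qed

lemma interior_reg:
  assumes "perm l"
  shows "interior (reg l) = {z. depth p < depth z \<and> depth z < depth p + total \<and>
    path_at e p l (depth z) < Re z \<and> Re z < path_at e p (rev ids) (depth z)}"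
  unfolding reg_def using assms by (simp add: interior_band continuous_path_at_perm)

lemma closed_reg: "perm l \<Longrightarrow> closed (reg l)"
  unfolding reg_def by (simp add: closed_band continuous_path_at_perm)

text \<open>The new rhomb is exactly the gap between the two paths: they differ only at its levels,
  and there they are its left and right boundaries.\<close>

lemma partial_tiling_insert:
  assumes "partial_tiling (l1 @ j # i # l2) S" "perm (l1 @ i # j # l2)" "i < j"
  shows "partial_tiling (l1 @ i # j # l2) (insert (rhomb e (p + disp e l1) i j) S)"
proof -
  let ?l = "l1 @ i # j # l2" and ?l' = "l1 @ j # i # l2" and ?q = "p + disp e l1"
  let ?t = "rhomb e ?q i j"
  note F = perm_swap_facts[OF assms(2,3)]
  have p': "perm ?l'" using assms(2) by (simp add: perm_swap)
  have S: "finite S" "\<forall>t\<in>S. \<exists>q i j. 1 \<le> i \<and> i < j \<and> j \<le> n \<and> t = rhomb e q i j"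
    "pairwise (\<lambda>t t'. interior t \<inter> interior t' = {}) S" "interior (reg ?l') \<subseteq> \<Union> S" "\<Union> S \<subseteq> reg ?l'"
    using assms(1) by (auto simp: partial_tiling_def)
  note mid = path_at_middle[OF assms(2)] path_at_middle[OF p', unfolded add.commute[of "depth (e j)"]]
  have disj: "interior ?t \<inter> interior t' = {}" if "t' \<in> S" for t'
  proof -
    have "interior t' \<subseteq> interior (reg ?l')" using S(5) that by (intro interior_mono) auto
    then show ?thesis using mid by (force simp: interior_reg[OF p'] interior_rhomb[OF F(4) assms(3) F(5)])
  qed
  have cover: "interior (reg ?l) \<subseteq> ?t \<union> \<Union> S"
  proof
    fix z assume "z \<in> interior (reg ?l)"
    then have z: "depth p < depth z" "depth z < depth p + total"
      "path_at e p ?l (depth z) < Re z" "Re z < path_at e p (rev ids) (depth z)"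
      by (auto simp: interior_reg[OF assms(2)])
    show "z \<in> ?t \<union> \<Union> S"
    proof (cases "path_at e p ?l' (depth z) < Re z")
      case True
      then show ?thesis using z S(4) by (auto simp: interior_reg[OF p'])
    next
      case False
      then have lev: "depth ?q \<le> depth z" "depth z \<le> depth ?q + (depth (e i) + depth (e j))"
        using path_at_outside[OF assms(2), of "depth z"] z by force+
      then have "z \<in> ?t"
        using z False mid[OF lev] by (auto simp: rhomb_band[OF F(4) assms(3) F(5)] band_def)
      then show ?thesis by simp
    qed
  qed
  have "reg ?l' \<subseteq> reg ?l"
    using path_at_swap_le[OF assms(2,3)] by (force simp: reg_def band_def)
  moreover have "?t \<subseteq> reg ?l"
  proof
    fix z assume "z \<in> ?t"
    then have z: "depth ?q \<le> depth z" "depth z \<le> depth ?q + (depth (e i) + depth (e j))"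
      "path_at e ?q [i, j] (depth z) \<le> Re z" "Re z \<le> path_at e ?q [j, i] (depth z)"
      by (auto simp: rhomb_band[OF F(4) assms(3) F(5)] band_def)
    have "path_at e p ?l' (depth z) \<le> path_at e p (rev ids) (depth z)"
      using z F(6) by (intro path_at_le_rev_ids p') auto
    then show "z \<in> reg ?l" using z mid[OF z(1,2)] F(6-8) by (auto simp: reg_def band_def)
  qed
  ultimately have "\<Union> (insert ?t S) \<subseteq> reg ?l" using S(5) by auto
  moreover have "pairwise (\<lambda>t t'. interior t \<inter> interior t' = {}) (insert ?t S)"
    using S(3) disj by (auto simp: pairwise_insert Int_commute)
  ultimately show ?thesis
    unfolding partial_tiling_def using S cover F(4,5) assms(3) by auto
qed

text \<open>An interior point of another tile lies to the right of the old path and outside the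
  interior of the removed rhomb, hence not to the left of the new path. Taking closures moves the
  entire tile into the smaller region.\<close>

lemma partial_tiling_remove:
  assumes "partial_tiling (l1 @ i # j # l2) S" "perm (l1 @ i # j # l2)" "i < j"
    and "rhomb e (p + disp e l1) i j \<in> S"
  shows "partial_tiling (l1 @ j # i # l2) (S - {rhomb e (p + disp e l1) i j})"
proof -
  let ?l = "l1 @ i # j # l2" and ?l' = "l1 @ j # i # l2" and ?q = "p + disp e l1"
  let ?t = "rhomb e ?q i j"
  note F = perm_swap_facts[OF assms(2,3)]
  have p': "perm ?l'" using assms(2) by (simp add: perm_swap)
  have S: "finite S" "\<forall>t\<in>S. \<exists>q i j. 1 \<le> i \<and> i < j \<and> j \<le> n \<and> t = rhomb e q i j"
    "pairwise (\<lambda>t t'. interior t \<inter> interior t' = {}) S" "interior (reg ?l) \<subseteq> \<Union> S" "\<Union> S \<subseteq> reg ?l"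
    using assms(1) by (auto simp: partial_tiling_def)
  note mid = path_at_middle[OF assms(2)] path_at_middle[OF p', unfolded add.commute[of "depth (e j)"]]
  have cover: "interior (reg ?l') \<subseteq> \<Union> (S - {?t})"
  proof
    fix z assume "z \<in> interior (reg ?l')"
    then have z: "depth p < depth z" "depth z < depth p + total"
      "path_at e p ?l' (depth z) < Re z" "Re z < path_at e p (rev ids) (depth z)"
      by (auto simp: interior_reg[OF p'])
    then have "z \<in> interior (reg ?l)"
      using path_at_swap_le[OF assms(2,3), of "depth z"] by (auto simp: interior_reg[OF assms(2)])
    moreover have "z \<notin> ?t"
      using z mid by (auto simp: rhomb_band[OF F(4) assms(3) F(5)] band_def)
    ultimately show "z \<in> \<Union> (S - {?t})" using S(4) by auto
  qed
  have "t' \<subseteq> reg ?l'" if t': "t' \<in> S" "t' \<noteq> ?t" for t'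
  proof -
    have "interior t' \<subseteq> reg ?l'"
    proof
      fix z assume zt: "z \<in> interior t'"
      have "interior t' \<subseteq> interior (reg ?l)" using S(5) that by (intro interior_mono) auto
      then have z: "depth p < depth z" "depth z < depth p + total"
        "path_at e p ?l (depth z) < Re z" "Re z < path_at e p (rev ids) (depth z)"
        using zt by (auto simp: interior_reg[OF assms(2)])
      have "z \<notin> interior ?t" using S(3) t' assms(4) zt by (auto simp: pairwise_def)
      then have "path_at e p ?l' (depth z) \<le> Re z"
        using z mid[of "depth z"] path_at_outside[OF assms(2), of "depth z"]
        by (force simp: interior_rhomb[OF F(4) assms(3) F(5)])
      then show "z \<in> reg ?l'" using z by (auto simp: reg_def band_def)
    qed
    then have "closure (interior t') \<subseteq> reg ?l'" by (intro closure_minimal closed_reg p')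
    moreover obtain q i' j' where "1 \<le> i'" "i' < j'" "j' \<le> n" "t' = rhomb e q i' j'"
      using S(2) t' by blast
    ultimately show ?thesis using rhomb_closure_interior by simp
  qed
  then show ?thesis
    unfolding partial_tiling_def using S cover by (auto intro: pairwise_subset)
qed

end

section \<open>Germs of piecewise linear functions and first points of difference\<close>

lemma path_at_right_affine:
  assumes "\<forall>i\<in>set l. depth (e i) > 0"
  shows "\<exists>c. \<forall>\<^sub>F y' in at_right y. path_at e q l y' = path_at e q l y + c * (y' - y)"
proof -
  obtain c where c: "\<forall>\<^sub>F y' in at_right (y - depth q).
      path_x e l y' = path_x e l (y - depth q) + c * (y' - (y - depth q))"
    using path_x_right_affine[OF assms] by blast
  have "filterlim (\<lambda>y'. y' - depth q) (at_right (y - depth q)) (at_right y)"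
    unfolding filterlim_at by (auto simp: eventually_at_filter intro!: tendsto_intros)
  from eventually_compose_filterlim[OF c this] show ?thesis
    by (auto simp: path_at_def)
qed

text \<open>Two distinct lines meet at most once, at \<open>y - (f y - g y) / (c - d)\<close>, and a
  single point can be avoided close to \<open>y\<close>. For parallel lines the quotient is 0 and
  the point excluded is \<open>y\<close> itself.\<close>

lemma right_affine_eq:
  fixes f g :: "real \<Rightarrow> real"
  assumes f: "\<exists>c. \<forall>\<^sub>F y' in at_right y. f y' = f y + c * (y' - y)"
    and g: "\<exists>c. \<forall>\<^sub>F y' in at_right y. g y' = g y + c * (y' - y)"
    and freq: "\<exists>\<^sub>F y' in at_right y. f y' = g y'"
  shows "f y = g y" "\<forall>\<^sub>F y' in at_right y. f y' = g y'"
proof -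
  obtain c d where c: "\<forall>\<^sub>F y' in at_right y. f y' = f y + c * (y' - y)"
    and d: "\<forall>\<^sub>F y' in at_right y. g y' = g y + d * (y' - y)"
    using f g by blast
  have "f y = g y \<and> c = d"
  proof (rule ccontr)
    assume neq: "\<not> (f y = g y \<and> c = d)"
    have "\<forall>\<^sub>F y' in at_right y. y' \<noteq> y - (f y - g y) / (c - d)" "\<forall>\<^sub>F y' in at_right y. y' \<noteq> y"
      by (rule eventually_neq_at_within)+
    with c d have "\<forall>\<^sub>F y' in at_right y. f y' \<noteq> g y'"
    proof eventually_elim
      case (elim y')
      show ?case
      proof
        assume "f y' = g y'"
        then have *: "f y - g y + (c - d) * (y' - y) = 0" using elim by (simp add: algebra_simps)
        then have "c \<noteq> d" using neq by auto
        then have "y' = y - (f y - g y) / (c - d)" using * by (simp add: field_simps)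
        then show False using elim by simp
      qed
    qed
    then show False using freq by (simp add: frequently_def)
  qed
  then show "f y = g y" "\<forall>\<^sub>F y' in at_right y. f y' = g y'"
    using eventually_elim2[OF c d, of "\<lambda>y'. f y' = g y'"] by auto
qed

text \<open>The pigeonhole principle for filters. With the finitely many tiles as \<open>A\<close>,
  one tile touches the path at depths accumulating at the given one.\<close>

lemma frequently_bex_finite:
  assumes "finite A" "F \<noteq> bot" "\<forall>\<^sub>F x in F. \<exists>a\<in>A. P a x"
  shows "\<exists>a\<in>A. \<exists>\<^sub>F x in F. P a x"
proof (rule ccontr)
  assume "\<not> ?thesis"
  then have "\<forall>a\<in>A. \<forall>\<^sub>F x in F. \<not> P a x" by (auto simp: frequently_def)
  then have "\<forall>\<^sub>F x in F. \<forall>a\<in>A. \<not> P a x" using assms(1) by (simp add: eventually_ball_finite)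
  with assms(3) have "\<forall>\<^sub>F x in F. False" by eventually_elim auto
  then show False using assms(2) by (simp add: eventually_False)
qed

text \<open>The depth \<open>c\<close> is the infimum of the depths in the interval at which the
  functions differ; continuity carries the agreement up to \<open>c\<close> itself.\<close>

lemma first_difference:
  fixes f g :: "real \<Rightarrow> real"
  assumes "continuous_on UNIV f" "continuous_on UNIV g" "f a = g a" "f b \<noteq> g b" "a \<le> b"
  shows "\<exists>c. a \<le> c \<and> c < b \<and> (\<forall>y. a \<le> y \<and> y \<le> c \<longrightarrow> f y = g y) \<and>
    (\<exists>\<^sub>F y in at_right c. f y \<noteq> g y)"
proof -
  define C where "C = {y. a \<le> y \<and> y \<le> b \<and> f y \<noteq> g y}"
  define c where "c = Inf C"
  have bC: "b \<in> C" using assms by (simp add: C_def)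
  have bdd: "bdd_below C" by (auto simp: C_def bdd_below_def)
  have ac: "a \<le> c" unfolding c_def using bC by (intro cInf_greatest) (auto simp: C_def)
  have cb: "c \<le> b" unfolding c_def by (rule cInf_lower[OF bC bdd])
  have lt: "f y = g y" if "a \<le> y" "y < c" for y
  proof (rule ccontr)
    assume "f y \<noteq> g y"
    then have "y \<in> C" using that cb by (auto simp: C_def)
    then have "c \<le> y" unfolding c_def using bdd by (rule cInf_lower)
    then show False using that by simp
  qed
  have eqc: "f c = g c"
  proof (cases "a = c")
    case True
    then show ?thesis using assms by simp
  next
    case False
    have "closed {y. f y = g y}" using assms(1,2) by (rule closed_Collect_eq)
    moreover have "c \<in> closure {a..<c}" using False ac by (simp add: closure_atLeastLessThan)
    moreover have "{a..<c} \<subseteq> {y. f y = g y}" using lt by auto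
    ultimately show ?thesis using closure_minimal by blast
  qed
  have "c \<noteq> b" using eqc assms by auto
  with cb have "c < b" by simp
  moreover have "\<exists>\<^sub>F y in at_right c. f y \<noteq> g y"
  proof (rule ccontr)
    assume "\<not> ?thesis"
    then have "\<forall>\<^sub>F y in at_right c. f y = g y" by (simp add: frequently_def)
    then obtain d where d: "d > c" "\<And>y. c < y \<Longrightarrow> y < d \<Longrightarrow> f y = g y"
      using eventually_at_right[OF \<open>c < b\<close>] by auto
    have "d \<le> c" unfolding c_def
    proof (rule cInf_greatest)
      fix y assume "y \<in> C"
      then show "d \<le> y" using d(2)[of y] lt[of y] eqc by (force simp: C_def)
    qed (use bC in auto)
    then show False using d by simp
  qed
  moreover have "f y = g y" if "a \<le> y" "y \<le> c" for y
    using lt[of y] eqc that by (cases "y = c") auto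
  ultimately show ?thesis using ac by blast
qed

context downward_sides
begin

section \<open>Fitting a tile to the path and choosing the tile to sweep\<close>

lemma inj_on_slope: "inj_on (slope e) {1..n}"
  by (rule inj_onI) (metis less_irrefl linorder_neqE_nat slope_less)

lemma path_contains_segment:
  assumes "distinct l" "set l \<subseteq> {1..n}" "i \<in> {1..n}"
    and "depth q \<le> a" "a + depth (e i) \<le> depth q + depth (disp e l)"
    and "\<And>y. a < y \<Longrightarrow> y < a + depth (e i) \<Longrightarrow> path_at e q l y = c + slope e i * (y - a)"
  shows "\<exists>l1 l2. l = l1 @ i # l2 \<and> a = depth (q + disp e l1) \<and> c = Re (q + disp e l1)"
proof -
  have "\<exists>l1 l2. l = l1 @ i # l2 \<and> a - depth q = depth (disp e l1) \<and> c - Re q = Re (disp e l1)"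
  proof (rule path_x_segment)
    show "inj_on (slope e) (insert i (set l))"
      using assms by (intro inj_on_subset[OF inj_on_slope]) auto
    fix y assume "a - depth q < y" "y < a - depth q + depth (e i)"
    then show "path_x e l y = (c - Re q) + slope e i * (y - (a - depth q))"
      using assms(6)[of "y + depth q"] by (auto simp: path_at_def algebra_simps)
  qed (use assms depth_pos in auto)
  then show ?thesis by (auto simp: algebra_simps)
qed

lemma path_at_pair_first:
  assumes "y \<le> depth q + depth (e i)"
  shows "path_at e q [i, j] y = Re q + slope e i * (y - depth q)"
  using assms by (auto simp: path_at_def)

lemma path_at_pair_second:
  assumes "i \<in> {1..n}" "depth q + depth (e i) \<le> y" "y \<le> depth q + depth (e i) + depth (e j)"
  shows "path_at e q [i, j] y = Re (q + e i) + slope e j * (y - (depth q + depth (e i)))"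
  using assms depth_pos[OF assms(1)] by (auto simp: path_at_def Re_eq_slope algebra_simps)

text \<open>Both halves of the left boundary of the tile are straight pieces of the path, hence
  whole sides of it. Their starting depths differ by the depth of side \<open>i\<close>, and since
  all sides have positive depth nothing fits between them.\<close>

lemma tile_on_path:
  assumes "perm l" "1 \<le> i" "i \<le> n" "1 \<le> j" "j \<le> n" "depth p \<le> depth q"
    and "depth q + (depth (e i) + depth (e j)) \<le> depth p + total"
    and contact: "\<And>y. depth q \<le> y \<Longrightarrow> y \<le> depth q + (depth (e i) + depth (e j)) \<Longrightarrow>
      path_at e q [i, j] y = path_at e p l y"
  shows "\<exists>l1 l2. l = l1 @ i # j # l2 \<and> q = p + disp e l1"
proof -
  have d: "0 < depth (e i)" "0 < depth (e j)" using assms by (auto intro!: depth_pos)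
  have l: "distinct l" "set l = {1..n}" "depth (disp e l) = total"
    using assms(1) by (auto simp: perm_def depth_disp_perm)
  have "\<exists>l1 l2. l = l1 @ i # l2 \<and> depth q = depth (p + disp e l1) \<and> Re q = Re (p + disp e l1)"
  proof (rule path_contains_segment)
    fix y assume "depth q < y" "y < depth q + depth (e i)"
    then show "path_at e p l y = Re q + slope e i * (y - depth q)"
      using contact[of y] d by (simp add: path_at_pair_first)
  qed (use assms l d in auto)
  then obtain l1 l2 where 1: "l = l1 @ i # l2" "depth q = depth (p + disp e l1)" "Re q = Re (p + disp e l1)"
    by blast
  have "\<exists>l1 l2. l = l1 @ j # l2 \<and> depth q + depth (e i) = depth (p + disp e l1) \<and>
    Re (q + e i) = Re (p + disp e l1)"
  proof (rule path_contains_segment)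
    fix y assume "depth q + depth (e i) < y" "y < depth q + depth (e i) + depth (e j)"
    then show "path_at e p l y = Re (q + e i) + slope e j * (y - (depth q + depth (e i)))"
      using contact[of y] path_at_pair_second[of i q y j] assms d by simp
  qed (use assms l d in auto)
  then obtain l1' l2' where 2: "l = l1' @ j # l2'" "depth q + depth (e i) = depth (p + disp e l1')" by blast
  have pos: "\<forall>k\<in>set l. 0 < depth (e k)" using perm_depth_pos[OF assms(1)] .
  have "l1 @ i # l2 = l1' @ j # l2'" using 1 2 by simp
  then consider us where "l1 = l1' @ us" | us where "l1' = l1 @ us" "i # l2 = us @ j # l2'"
    by (auto simp: append_eq_append_conv2)
  then have "l1' = l1 @ [i]"
  proof cases
    case 1
    moreover have "0 \<le> depth (disp e us)"
      using pos 1 \<open>l = l1 @ i # l2\<close> by (intro depth_disp_nonneg) auto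
    ultimately show ?thesis using d \<open>depth q = depth (p + disp e l1)\<close> 2(2) by auto
  next
    case c: 2
    then have "us \<noteq> []" using d 1(2) 2(2) by auto
    then obtain us' where us: "us = i # us'" using c by (cases us) auto
    have "us' = []"
    proof (rule ccontr)
      assume "us' \<noteq> []"
      then have "0 < depth (disp e us')" using pos 2(1) c us by (intro depth_disp_pos) auto
      then show False using c us 1(2) 2(2) by auto
    qed
    then show ?thesis using c us by simp
  qed
  then have l': "l = l1 @ i # j # l2'" using 2 by simp
  have "q = p + disp e l1" using 1 by (intro complex_eqI_depth) auto
  then show ?thesis using l' by blast
qed

lemma sweep_step:
  assumes "partial_tiling l S" "perm l" "S \<noteq> {}"
  shows "\<exists>l1 i j l2. l = l1 @ i # j # l2 \<and> i < j \<and> rhomb e (p + disp e l1) i j \<in> S"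
proof -
  have S: "finite S" "\<forall>t\<in>S. \<exists>q i j. 1 \<le> i \<and> i < j \<and> j \<le> n \<and> t = rhomb e q i j"
    "pairwise (\<lambda>t t'. interior t \<inter> interior t' = {}) S" "interior (reg l) \<subseteq> \<Union> S" "\<Union> S \<subseteq> reg l"
    using assms(1) by (auto simp: partial_tiling_def)
  from S(2) obtain Q I J where IJ:
    "\<And>t. t \<in> S \<Longrightarrow> 1 \<le> I t \<and> I t < J t \<and> J t \<le> n \<and> t = rhomb e (Q t) (I t) (J t)"
    by metis
  define top where "top t = depth (Q t)" for t
  define bot where "bot t = depth (Q t) + (depth (e (I t)) + depth (e (J t)))" for t
  define L where "L t = path_at e (Q t) [I t, J t]" for t
  define R where "R t = path_at e (Q t) [J t, I t]" for t
  define X where "X = path_at e p l"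
  define W where "W = path_at e p (rev ids)"
  define a b where "a = depth p" and "b = depth p + total"
  have tb: "top t < bot t" if "t \<in> S" for t
    using IJ[OF that] depth_pos[of "I t"] depth_pos[of "J t"] by (auto simp: top_def bot_def)
  have pos: "\<forall>k\<in>set [I t, J t]. 0 < depth (e k)" if "t \<in> S" for t
    using IJ[OF that] by (auto intro!: depth_pos)
  have contL: "continuous_on UNIV (L t)" if "t \<in> S" for t
    unfolding L_def using pos[OF that] by (rule continuous_path_at)
  have contX: "continuous_on UNIV X" and contW: "continuous_on UNIV W"
    using assms(2) by (auto simp: X_def W_def continuous_path_at_perm)
  have affL: "\<exists>c. \<forall>\<^sub>F y' in at_right y. L t y' = L t y + c * (y' - y)" if "t \<in> S" for t y
    unfolding L_def using pos[OF that] by (rule path_at_right_affine)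
  have affX: "\<exists>c. \<forall>\<^sub>F y' in at_right y. X y' = X y + c * (y' - y)" for y
    unfolding X_def using perm_depth_pos[OF assms(2)] by (rule path_at_right_affine)
  have affW: "\<exists>c. \<forall>\<^sub>F y' in at_right y. W y' = W y + c * (y' - y)" for y
    unfolding W_def using perm_depth_pos[OF perm_ids(2)] by (rule path_at_right_affine)
  have LR: "L t y < R t y" if "t \<in> S" "top t < y" "y < bot t" for t y
    unfolding L_def R_def using that IJ[OF that(1)]
    by (intro path_at_pair_less) (auto simp: top_def bot_def)
  have LRle: "L t y \<le> R t y" if "t \<in> S" "top t \<le> y" for t y
    unfolding L_def R_def using that IJ[OF that(1)]
    by (intro path_at_pair_le) (auto simp: top_def)
  have mem: "z \<in> t \<longleftrightarrow> top t \<le> depth z \<and> depth z \<le> bot t \<and> L t (depth z) \<le> Re z \<and> Re z \<le> R t (depth z)"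
    if "t \<in> S" for t z
  proof -
    have "t = rhomb e (Q t) (I t) (J t)" using IJ[OF that] by blast
    also have "\<dots> = band (top t) (bot t) (L t) (R t)"
      unfolding top_def bot_def L_def R_def using IJ[OF that] by (intro rhomb_band) auto
    finally show ?thesis by (auto simp: band_def)
  qed
  have int: "z \<in> interior t \<longleftrightarrow> top t < depth z \<and> depth z < bot t \<and> L t (depth z) < Re z \<and> Re z < R t (depth z)"
    if "t \<in> S" for t z
  proof -
    have "t = rhomb e (Q t) (I t) (J t)" using IJ[OF that] by blast
    then have "interior t = interior (rhomb e (Q t) (I t) (J t))" by simp
    also have "\<dots> = {z. top t < depth z \<and> depth z < bot t \<and> L t (depth z) < Re z \<and> Re z < R t (depth z)}"
      unfolding top_def bot_def L_def R_def using IJ[OF that] by (intro interior_rhomb) auto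
    finally show ?thesis by auto
  qed
  have inreg: "a \<le> y \<and> y \<le> b \<and> X y \<le> L t y \<and> R t y \<le> W y" if "t \<in> S" "top t \<le> y" "y \<le> bot t" for t y
  proof -
    have "Complex (L t y) (- y) \<in> t" "Complex (R t y) (- y) \<in> t"
      using LRle[OF that(1,2)] that by (auto simp: mem)
    then have "Complex (L t y) (- y) \<in> reg l" "Complex (R t y) (- y) \<in> reg l" using S(5) that by blast+
    then show ?thesis by (simp add: reg_def band_def X_def W_def a_def b_def)
  qed
  have XW: "X y \<le> W y" if "a \<le> y" for y
    unfolding X_def W_def using that assms(2) by (intro path_at_le_rev_ids) (auto simp: a_def)
  \<comment> \<open>At a depth strictly inside both tiles a common left boundary point would have
    common interior points to its right, for instance halfway to the nearer right boundary.\<close>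
  have Lneq: "L t y \<noteq> L t' y"
    if "t \<in> S" "t' \<in> S" "t \<noteq> t'" "top t < y" "y < bot t" "top t' < y" "y < bot t'" for t t' y
  proof
    assume eq: "L t y = L t' y"
    let ?z = "Complex ((L t y + min (R t y) (R t' y)) / 2) (- y)"
    have "?z \<in> interior t" "?z \<in> interior t'"
      using that LR[of t y] LR[of t' y] eq by (auto simp: int min_def)
    then show False using S(3) that by (auto simp: pairwise_def)
  qed
  have "closed (\<Union> S)"
    using S(1,2) by (intro closed_Union)
      (auto simp: rhomb_def intro!: compact_imp_closed finite_imp_compact_convex_hull)
  \<comment> \<open>Where the region has positive width, a point of the path is a limit of interior
    points of the region and so lies in the closed union of the tiles. A tile containing it cannot
    reach to the left of the path, so the point is on its left boundary.\<close>
  have contact: "\<exists>t\<in>S. top t \<le> y \<and> y \<le> bot t \<and> L t y = X y" if "a < y" "y < b" "X y < W y" for y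
  proof -
    have "Complex (X y) (- y) \<in> closure (interior (reg l))"
      unfolding closure_approachable
    proof (intro allI impI)
      fix r :: real assume "r > 0"
      define x where "x = X y + min (r / 2) ((W y - X y) / 2)"
      have "Complex x (- y) \<in> interior (reg l)"
        using that \<open>r > 0\<close>
        by (auto simp: interior_reg[OF assms(2)] a_def b_def x_def X_def W_def min_def field_simps)
      moreover have "dist (Complex x (- y)) (Complex (X y) (- y)) < r"
        using that \<open>r > 0\<close> by (auto simp: dist_norm cmod_def x_def min_def field_simps)
      ultimately show "\<exists>z\<in>interior (reg l). dist z (Complex (X y) (- y)) < r" by blast
    qed
    also have "closure (interior (reg l)) \<subseteq> \<Union> S"
      using S(4) \<open>closed (\<Union> S)\<close> by (intro closure_minimal)
    finally obtain t where "t \<in> S" "Complex (X y) (- y) \<in> t" by blast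
    then show ?thesis using mem[of t] inreg[of t y] by force
  qed
  \<comment> \<open>One tile touches the path at depths arbitrarily close below \<open>y\<close>; as
    both germs are affine, it follows the path on a whole interval starting at
    \<open>y\<close>.\<close>
  have contact_right: "\<exists>t\<in>S. top t \<le> y \<and> y < bot t \<and> L t y = X y \<and> (\<forall>\<^sub>F y' in at_right y. L t y' = X y')"
    if "a \<le> y" "y < b" "\<exists>\<^sub>F y' in at_right y. X y' \<noteq> W y'" for y
  proof -
    have "\<forall>\<^sub>F y' in at_right y. X y' \<noteq> W y'"
      using right_affine_eq(2)[OF affX affW, of y] that(3) by (auto simp: frequently_def)
    moreover have "\<forall>\<^sub>F y' in at_right y. y < y' \<and> y' < b"
      using that(2) by (auto simp: eventually_at_right[OF that(2)])
    ultimately have "\<forall>\<^sub>F y' in at_right y. \<exists>t\<in>S. top t \<le> y' \<and> y' \<le> bot t \<and> L t y' = X y'"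
    proof eventually_elim
      case (elim y')
      then show ?case using contact[of y'] XW[of y'] that(1) by force
    qed
    from frequently_bex_finite[OF S(1) _ this] obtain t where t: "t \<in> S"
      "\<exists>\<^sub>F y' in at_right y. top t \<le> y' \<and> y' \<le> bot t \<and> L t y' = X y'"
      by (auto simp: trivial_limit_at_right_real)
    have "top t \<le> y"
    proof (rule ccontr)
      assume "\<not> top t \<le> y"
      then have "y < top t" by simp
      then have "\<forall>\<^sub>F y' in at_right y. y' < top t" by (auto simp: eventually_at_right[of y "top t"])
      then have "\<forall>\<^sub>F y' in at_right y. \<not> (top t \<le> y' \<and> y' \<le> bot t \<and> L t y' = X y')"
        by eventually_elim simp
      then show False using t(2) by (simp add: frequently_def)
    qed
    moreover have "y < bot t"
    proof (rule ccontr)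
      assume "\<not> y < bot t"
      moreover have "\<forall>\<^sub>F y' in at_right y. y < y'" by (rule eventually_at_right_less)
      ultimately have "\<forall>\<^sub>F y' in at_right y. \<not> (top t \<le> y' \<and> y' \<le> bot t \<and> L t y' = X y')"
        by (auto elim: eventually_mono)
      then show False using t(2) by (simp add: frequently_def)
    qed
    moreover have "\<exists>\<^sub>F y' in at_right y. L t y' = X y'" using t(2) by (auto elim: frequently_elim1)
    ultimately show ?thesis using right_affine_eq[OF affL affX, of t y] t(1) by auto
  qed
  \<comment> \<open>Contact at the top vertex alone is not enough: the left boundary must follow the
    path for a while below it.\<close>
  define V where "V = {t \<in> S. L t (top t) = X (top t) \<and> (\<forall>\<^sub>F y in at_right (top t). L t y = X y)}"
  have "V \<noteq> {}"
  proof -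
    obtain t0 where t0: "t0 \<in> S" using assms(3) by blast
    define y0 where "y0 = (top t0 + bot t0) / 2"
    have y0: "top t0 < y0" "y0 < bot t0" using tb[OF t0] by (auto simp: y0_def)
    then have "X y0 \<noteq> W y0" "a \<le> y0" "y0 \<le> b" using inreg[OF t0, of y0] LR[OF t0, of y0] by auto
    moreover have "X a = W a"
      using path_at_simps(1)[OF perm_depth_pos[OF assms(2)]] path_at_simps(1)[OF perm_depth_pos[OF perm_ids(2)]]
      by (simp add: X_def W_def a_def)
    ultimately obtain c where c: "a \<le> c" "c < y0" "\<And>y. a \<le> y \<Longrightarrow> y \<le> c \<Longrightarrow> X y = W y"
      "\<exists>\<^sub>F y in at_right c. X y \<noteq> W y"
      using first_difference[OF contX contW, of a y0] by blast
    then obtain t where t: "t \<in> S" "top t \<le> c" "c < bot t" "L t c = X c" "\<forall>\<^sub>F y' in at_right c. L t y' = X y'"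
      using contact_right[of c] \<open>y0 \<le> b\<close> by auto
    \<comment> \<open>Down to \<open>c\<close> the region has width zero, which leaves no room for a
      tile that starts earlier.\<close>
    have "top t = c"
    proof (rule ccontr)
      assume "top t \<noteq> c"
      then have y: "top t < (top t + c) / 2" "(top t + c) / 2 < bot t" "(top t + c) / 2 \<le> c" using t by auto
      then show False
        using inreg[OF t(1), of "(top t + c) / 2"] LR[OF t(1), of "(top t + c) / 2"] c(3)[of "(top t + c) / 2"]
        by auto
    qed
    then show ?thesis using t by (auto simp: V_def)
  qed
  have "finite V" using S(1) by (simp add: V_def)
  then have "Max (top ` V) \<in> top ` V" using \<open>V \<noteq> {}\<close> by (intro Max_in) auto
  then obtain t where t: "t \<in> V" "top t = Max (top ` V)" by auto
  have t_max: "top t' \<le> top t" if "t' \<in> V" for t'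
    unfolding t(2) using that \<open>finite V\<close> by (intro Max_ge) auto
  have tS: "t \<in> S" "L t (top t) = X (top t)" "\<forall>\<^sub>F y in at_right (top t). L t y = X y"
    using t(1) by (auto simp: V_def)
  have full: "L t y = X y" if y: "top t \<le> y" "y \<le> bot t" for y
  proof (rule ccontr)
    assume neq: "L t y \<noteq> X y"
    obtain c where c: "top t \<le> c" "c < y" "\<And>y. top t \<le> y \<Longrightarrow> y \<le> c \<Longrightarrow> L t y = X y"
      "\<exists>\<^sub>F y in at_right c. L t y \<noteq> X y"
      using first_difference[OF contL[OF tS(1)] contX tS(2) neq y(1)] by blast
    have "c \<noteq> top t" using c(4) tS(3) by (auto simp: frequently_def)
    then have topc: "top t < c" using c by simp
    have cbot: "c < bot t" using c y by simp
    have "\<forall>\<^sub>F y' in at_right c. L t y' \<noteq> X y'"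
      using right_affine_eq(2)[OF affL[OF tS(1)] affX, of c] c(4) by (auto simp: frequently_def)
    moreover have "\<forall>\<^sub>F y' in at_right c. c < y' \<and> y' < bot t"
      using cbot by (auto simp: eventually_at_right[OF cbot])
    ultimately have less: "\<forall>\<^sub>F y' in at_right c. c < y' \<and> y' < bot t \<and> X y' < L t y'"
    proof eventually_elim
      case (elim y')
      then show ?case using inreg[OF tS(1), of y'] topc by force
    qed
    then have "\<forall>\<^sub>F y' in at_right c. X y' \<noteq> W y'"
    proof eventually_elim
      case (elim y')
      then show ?case using inreg[OF tS(1), of y'] LRle[OF tS(1), of y'] topc by force
    qed
    then have "\<exists>\<^sub>F y' in at_right c. X y' \<noteq> W y'"
      by (simp add: eventually_frequently trivial_limit_at_right_real)
    moreover have "a \<le> c" "c < b"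
      using inreg[OF tS(1), of "top t"] inreg[OF tS(1), of "bot t"] tb[OF tS(1)] topc cbot by auto
    ultimately obtain t' where t': "t' \<in> S" "top t' \<le> c" "c < bot t'" "L t' c = X c"
      "\<forall>\<^sub>F y' in at_right c. L t' y' = X y'"
      using contact_right[of c] by auto
    show False
    \<comment> \<open>The tile \<open>t'\<close> follows the path below \<open>c\<close>, where
      \<open>t\<close> leaves it. If \<open>t'\<close> starts at \<open>c\<close>, it is a lower
      member of \<open>V\<close>. Otherwise both tiles extend above \<open>c\<close>: there
      \<open>L t\<close> is the path and not to the right of \<open>L t'\<close>, below
      \<open>c\<close> the order is strictly reversed, so the left boundaries cross, contradicting
      \<open>Lneq\<close>.\<close>
    proof (cases "top t' = c")
      case True
      then have "t' \<in> V" using t' by (auto simp: V_def)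
      then show False using t_max topc True by force
    next
      case False
      define y0 where "y0 = (max (top t) (top t') + c) / 2"
      have y0: "top t < y0" "top t' < y0" "y0 < c" using False topc t' by (auto simp: y0_def max_def)
      have "\<forall>\<^sub>F y' in at_right c. y' < bot t'" using t'(3) by (auto simp: eventually_at_right[OF t'(3)])
      with less t'(5) have "\<forall>\<^sub>F y' in at_right c. c < y' \<and> y' < bot t \<and> y' < bot t' \<and> L t' y' < L t y'"
        by eventually_elim auto
      then obtain y1 where y1: "c < y1" "y1 < bot t" "y1 < bot t'" "L t' y1 < L t y1"
        using eventually_happens[of _ "at_right c"] by (force simp: trivial_limit_at_right_real)
      have "L t y0 \<le> L t' y0" using c(3)[of y0] y0 inreg[OF t'(1), of y0] t' by auto
      moreover have "continuous_on {y0..y1} (\<lambda>y. L t y - L t' y)"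
        using contL tS(1) t'(1) by (intro continuous_intros) (auto intro: continuous_on_subset)
      ultimately obtain y2 where "y0 \<le> y2" "y2 \<le> y1" "L t y2 - L t' y2 = 0"
        using IVT'[of "\<lambda>y. L t y - L t' y" y0 0 y1] y0 y1 by auto
      moreover have "t \<noteq> t'" using y1 by auto
      ultimately show False using Lneq[OF tS(1) t'(1), of y2] y0 y1 by auto
    qed
  qed
  have "\<exists>l1 l2. l = l1 @ I t # J t # l2 \<and> Q t = p + disp e l1"
  proof (rule tile_on_path[OF assms(2)])
    show "depth p \<le> depth (Q t)" "depth (Q t) + (depth (e (I t)) + depth (e (J t))) \<le> depth p + total"
      using inreg[OF tS(1), of "top t"] inreg[OF tS(1), of "bot t"] tb[OF tS(1)]
      by (auto simp: top_def bot_def a_def b_def)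
    show "path_at e (Q t) [I t, J t] y = path_at e p l y"
      if "depth (Q t) \<le> y" "y \<le> depth (Q t) + (depth (e (I t)) + depth (e (J t)))" for y
      using full[of y] that by (auto simp: top_def bot_def L_def X_def)
  qed (use IJ[OF tS(1)] in auto)
  then show ?thesis using IJ[OF tS(1)] tS(1) by metis
qed

text \<open>As long as a pair is not inverted the region has interior points, so some tile is left.
  The witness is the depth of the middle vertex of an adjacent ascent, where the exchange moves the
  path strictly.\<close>

lemma exists_gap:
  assumes "perm l" "noninv l \<noteq> {}"
  shows "\<exists>y. depth p < y \<and> y < depth p + total \<and> path_at e p l y < path_at e p (rev ids) y"
proof -
  have "l \<noteq> rev ids" using assms(2) by auto
  then obtain l1 i j l2 where l: "l = l1 @ i # j # l2" "i < j"
    using exists_ascent[of l "rev ids"] assms(1) perm_ids by (auto simp: perm_def)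
  note F = perm_swap_facts[OF assms(1)[unfolded l] l(2)]
  let ?q = "p + disp e l1"
  define y where "y = depth ?q + depth (e i)"
  have p': "perm (l1 @ j # i # l2)" using assms(1) l by (simp add: perm_swap)
  have y: "depth ?q \<le> y" "y \<le> depth ?q + (depth (e i) + depth (e j))" "depth p < y" "y < depth p + total"
    using F by (auto simp: y_def)
  have "path_at e p l y < path_at e p (l1 @ j # i # l2) y"
    using path_at_middle[of l1 i j l2 y] path_at_middle[of l1 j i l2 y] path_at_pair_less[of i j ?q y]
      assms(1) p' l F y by (auto simp: y_def)
  also have "\<dots> \<le> path_at e p (rev ids) y" using y by (intro path_at_le_rev_ids p') auto
  finally show ?thesis using y by blast
qed

text \<open>Every sweep step removes one tile and the one non-inversion with its labels, so tiles
  and pairs run out together. The function \<open>Q\<close> collects the top vertices.\<close>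

lemma partial_tiling_unique_labels:
  assumes "partial_tiling l S" "perm l"
  shows "\<exists>Q. S = (\<lambda>(i, j). rhomb e (Q i j) i j) ` noninv l"
  using assms
proof (induction "card S" arbitrary: l S)
  case 0
  then have [simp]: "S = {}" by (auto simp: partial_tiling_def)
  have "noninv l = {}"
  proof (rule ccontr)
    assume "noninv l \<noteq> {}"
    then obtain y where y: "depth p < y" "y < depth p + total" "path_at e p l y < path_at e p (rev ids) y"
      using exists_gap "0.prems"(2) by blast
    then have "Complex ((path_at e p l y + path_at e p (rev ids) y) / 2) (- y) \<in> interior (reg l)"
      by (simp add: interior_reg[OF "0.prems"(2)])
    then show False using "0.prems"(1) by (auto simp: partial_tiling_def)
  qed
  then show ?case by auto
next
  case (Suc k)
  then have "S \<noteq> {}" by auto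
  then obtain l1 i j l2 where l: "l = l1 @ i # j # l2" "i < j" "rhomb e (p + disp e l1) i j \<in> S"
    using sweep_step Suc.prems by blast
  let ?t = "rhomb e (p + disp e l1) i j" and ?l' = "l1 @ j # i # l2"
  have 1: "partial_tiling ?l' (S - {?t})" using partial_tiling_remove Suc.prems l by blast
  have 2: "k = card (S - {?t})" using Suc.hyps(2) l by simp
  have 3: "perm ?l'" using Suc.prems l by (simp add: perm_swap)
  obtain Q where Q: "S - {?t} = (\<lambda>(i, j). rhomb e (Q i j) i j) ` noninv ?l'"
    using Suc.hyps(1)[OF 2 1 3] by blast
  have N: "noninv l = insert (i, j) (noninv ?l')" "(i, j) \<notin> noninv ?l'"
    using noninv_swap Suc.prems l by (auto simp: perm_def)
  let ?Q = "\<lambda>i' j'. if i' = i \<and> j' = j then p + disp e l1 else Q i' j'"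
  have "(\<lambda>(i, j). rhomb e (?Q i j) i j) ` noninv ?l' = (\<lambda>(i, j). rhomb e (Q i j) i j) ` noninv ?l'"
    using N(2) by (intro image_cong) (auto split: if_splits)
  then have "S = (\<lambda>(i, j). rhomb e (?Q i j) i j) ` noninv l"
    unfolding N(1) image_insert using insert_Diff[OF l(3)] by (simp flip: Q)
  then show ?case by (rule exI[of _ ?Q])
qed

text \<open>Adds one rhomb per exchange along a chain from \<open>v\<close> to \<open>u\<close>.
  Each new tile is remembered with a path it was attached to, which lies between \<open>v\<close>
  and \<open>u\<close> in the weak order; this is what later determines its top vertex.\<close>

lemma partial_tiling_extend:
  assumes "perm u" "perm v" "noninv v \<subseteq> noninv u" "partial_tiling v S'"
  shows "\<exists>S. S' \<subseteq> S \<and> partial_tiling u S \<and> (\<forall>i j. (i, j) \<in> noninv u - noninv v \<longrightarrow>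
    (\<exists>l1 l2. perm (l1 @ i # j # l2) \<and> noninv v \<subseteq> noninv (l1 @ i # j # l2) \<and>
      noninv (l1 @ i # j # l2) \<subseteq> noninv u \<and> rhomb e (p + disp e l1) i j \<in> S))" (is "?P u")
proof (rule weak_order_induct[where P = ?P])
  fix l1 i j l2
  assume l: "distinct (l1 @ i # j # l2)" "set (l1 @ i # j # l2) = set v" "i < j"
    "noninv v \<subseteq> noninv (l1 @ j # i # l2)" and P: "?P (l1 @ j # i # l2)"
  have pl: "perm (l1 @ i # j # l2)" using l assms by (auto simp: perm_def)
  obtain S where S: "S' \<subseteq> S" "partial_tiling (l1 @ j # i # l2) S"
    "\<And>i' j'. (i', j') \<in> noninv (l1 @ j # i # l2) - noninv v \<Longrightarrow>
    (\<exists>m1 m2. perm (m1 @ i' # j' # m2) \<and> noninv v \<subseteq> noninv (m1 @ i' # j' # m2) \<and>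
      noninv (m1 @ i' # j' # m2) \<subseteq> noninv (l1 @ j # i # l2) \<and> rhomb e (p + disp e m1) i' j' \<in> S)"
    using P by blast
  note N = noninv_swap[OF l(1,3)]
  have T: "partial_tiling (l1 @ i # j # l2) (insert (rhomb e (p + disp e l1) i j) S)"
    using partial_tiling_insert[OF S(2) pl l(3)] .
  show "?P (l1 @ i # j # l2)"
  proof (intro exI[of _ "insert (rhomb e (p + disp e l1) i j) S"] conjI allI impI T)
    fix i' j' assume ij: "(i', j') \<in> noninv (l1 @ i # j # l2) - noninv v"
    show "\<exists>m1 m2. perm (m1 @ i' # j' # m2) \<and> noninv v \<subseteq> noninv (m1 @ i' # j' # m2) \<and>
      noninv (m1 @ i' # j' # m2) \<subseteq> noninv (l1 @ i # j # l2) \<and>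
      rhomb e (p + disp e m1) i' j' \<in> insert (rhomb e (p + disp e l1) i j) S"
    proof (cases "(i', j') = (i, j)")
      case True
      then show ?thesis using pl l(4) N by (intro exI[of _ l1] exI[of _ l2]) auto
    next
      case False
      then have "(i', j') \<in> noninv (l1 @ j # i # l2) - noninv v" using ij N by auto
      from S(3)[OF this] show ?thesis using N by blast
    qed
  qed (use S in auto)
qed (use assms in \<open>auto simp: perm_def\<close>)

end

section \<open>The polygon and its boundary\<close>

lemma closed_segment_graph:
  assumes "depth v > 0"
  shows "closed_segment q (q + v) = {z. depth q \<le> depth z \<and> depth z \<le> depth q + depth v \<and>
    Re z = Re q + Re v / depth v * (depth z - depth q)}"
proof (rule set_eqI)
  fix z
  show "z \<in> closed_segment q (q + v) \<longleftrightarrow> z \<in> {z. depth q \<le> depth z \<and> depth z \<le> depth q + depth v \<and>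
    Re z = Re q + Re v / depth v * (depth z - depth q)}"
  proof
    assume "z \<in> closed_segment q (q + v)"
    then obtain u where u: "0 \<le> u" "u \<le> 1" "z = (1 - u) *\<^sub>R q + u *\<^sub>R (q + v)"
      by (auto simp: in_segment)
    have z: "z = q + u *\<^sub>R v" using u(3) by (simp add: algebra_simps)
    have "u * depth v \<le> 1 * depth v" using u assms by (intro mult_right_mono) auto
    then show "z \<in> {z. depth q \<le> depth z \<and> depth z \<le> depth q + depth v \<and>
      Re z = Re q + Re v / depth v * (depth z - depth q)}"
      unfolding z using assms u(1,2) by auto
  next
    assume z: "z \<in> {z. depth q \<le> depth z \<and> depth z \<le> depth q + depth v \<and>
      Re z = Re q + Re v / depth v * (depth z - depth q)}"
    define u where "u = (depth z - depth q) / depth v"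
    have "0 \<le> u" "u \<le> 1" using z assms by (auto simp: u_def)
    moreover have "z = q + u *\<^sub>R v"
      using z assms by (intro complex_eqI_depth) (auto simp: u_def)
    ultimately show "z \<in> closed_segment q (q + v)"
      unfolding in_segment by (intro exI[of _ u]) (auto simp: algebra_simps)
  qed
qed

lemma path_graph_eq_segments:
  assumes "\<forall>i\<in>set l. depth (e i) > 0" "l \<noteq> []"
  shows "{z. depth q \<le> depth z \<and> depth z \<le> depth q + depth (disp e l) \<and> Re z = path_at e q l (depth z)} =
    {z. \<exists>l1 k l2. l = l1 @ k # l2 \<and> z \<in> closed_segment (q + disp e l1) (q + disp e l1 + e k)}"
    (is "?G q l = ?S q l")
  using assms
proof (induction l arbitrary: q)
  case (Cons i l)
  have d: "depth (e i) > 0" using Cons.prems by auto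
  have dl: "depth (disp e l) \<ge> 0" using Cons.prems by (intro depth_disp_nonneg) auto
  have "?G q (i # l) = closed_segment q (q + e i) \<union> ?G (q + e i) l"
  proof (rule set_eqI)
    fix z
    have "path_x e l 0 = 0" using Cons.prems by (intro path_x_0) auto
    then show "z \<in> ?G q (i # l) \<longleftrightarrow> z \<in> closed_segment q (q + e i) \<union> ?G (q + e i) l"
      using d dl
      by (cases "depth z \<le> depth q + depth (e i)"; cases "depth z = depth q + depth (e i)")
        (auto simp: closed_segment_graph path_at_def slope_def algebra_simps)
  qed
  \<comment> \<open>For empty \<open>l\<close> the graph is the single point \<open>q + e i\<close>
    while the union of segments is empty. Adjoining this point to both sides covers that case, and
    the first segment contains it anyway.\<close>
  also have "?G (q + e i) l \<union> {q + e i} = ?S (q + e i) l \<union> {q + e i}"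
  proof (cases "l = []")
    case True
    then show ?thesis by (auto simp: path_at_def intro!: complex_eqI_depth)
  next
    case False
    have "?G (q + e i) l = ?S (q + e i) l"
      by (rule Cons.IH) (use Cons.prems False in auto)
    then show ?thesis by (simp only:)
  qed
  then have "closed_segment q (q + e i) \<union> ?G (q + e i) l = closed_segment q (q + e i) \<union> ?S (q + e i) l"
    using ends_in_segment(2)[of q "q + e i"] by blast
  also have "\<dots> = ?S q (i # l)"
  proof (intro set_eqI iffI)
    fix z assume "z \<in> closed_segment q (q + e i) \<union> ?S (q + e i) l"
    then consider "z \<in> closed_segment q (q + e i)"
      | l1 k l2 where "l = l1 @ k # l2" "z \<in> closed_segment (q + e i + disp e l1) (q + e i + disp e l1 + e k)"
      by blast
    then show "z \<in> ?S q (i # l)"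
    proof cases
      case 1
      then show ?thesis by (intro CollectI exI[of _ "[]"] exI[of _ i] exI[of _ l]) simp
    next
      case 2
      then show ?thesis by (intro CollectI exI[of _ "i # l1"] exI[of _ k] exI[of _ l2]) (simp add: add.assoc)
    qed
  next
    fix z assume "z \<in> ?S q (i # l)"
    then obtain l1 k l2 where z: "i # l = l1 @ k # l2" "z \<in> closed_segment (q + disp e l1) (q + disp e l1 + e k)"
      by blast
    show "z \<in> closed_segment q (q + e i) \<union> ?S (q + e i) l"
    proof (cases l1)
      case Nil
      then show ?thesis using z by simp
    next
      case (Cons i' l1')
      then have "l = l1' @ k # l2" "z \<in> closed_segment (q + e i + disp e l1') (q + e i + disp e l1' + e k)"
        using z by (simp_all add: add.assoc)
      then show ?thesis by blast
    qed
  qed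
  finally show ?case .
qed simp

text \<open>The line through one side misses the opposite side because the spanning vectors are not
  parallel; this makes the side a face.\<close>

lemma edge_of_parallelogram:
  fixes q a b :: complex
  assumes "Re a * Im b \<noteq> Im a * Re b"
  shows "closed_segment q (q + a) edge_of convex hull {q, q + a, q + a + b, q + b}"
proof -
  let ?S = "{q, q + a, q + a + b, q + b}" and ?T = "{q, q + a}"
  have "affine hull ?T \<inter> convex hull (?S - ?T) = {}"
  proof (rule ccontr)
    assume "\<not> ?thesis"
    then obtain z where z: "z \<in> affine hull ?T" "z \<in> convex hull (?S - ?T)" by blast
    have "convex hull (?S - ?T) \<subseteq> closed_segment (q + b) (q + a + b)"
      unfolding segment_convex_hull by (intro hull_mono) auto
    with z(2) have "z \<in> closed_segment (q + b) (q + a + b)" by blast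
    then obtain u where u: "z = (1 - u) *\<^sub>R (q + b) + u *\<^sub>R (q + a + b)"
      by (auto simp: in_segment)
    obtain s t where st: "z = s *\<^sub>R q + t *\<^sub>R (q + a)" "s + t = 1"
      using z(1) by (auto simp: affine_hull_2)
    have s: "s = 1 - t" using st(2) by simp
    have "z = q + t *\<^sub>R a" unfolding st(1) s by (simp add: algebra_simps)
    moreover have "z = q + b + u *\<^sub>R a" unfolding u by (simp add: algebra_simps)
    ultimately have b: "b = (t - u) *\<^sub>R a" by (simp add: algebra_simps)
    have "Re a * Im b = Im a * Re b" unfolding b by simp
    then show False using assms by simp
  qed
  then have "convex hull ?T face_of convex hull ?S"
    by (intro face_of_convex_hulls) auto
  moreover have "a \<noteq> 0" using assms by auto
  ultimately show ?thesis
    by (simp add: edge_of_def segment_convex_hull aff_dim_convex_hull aff_dim_2)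
qed

text \<open>An edge is the hull of some of the four vertices. It cannot use two opposite ones, as
  their midpoint is the centre. In the application the centre is interior to the region while the
  edge lies on the boundary.\<close>

lemma edge_of_parallelogram_cases:
  fixes q a b :: complex
  assumes "d edge_of convex hull {q, q + a, q + a + b, q + b}" "q + (1 / 2) *\<^sub>R (a + b) \<notin> d"
  shows "d \<in> {closed_segment q (q + a), closed_segment (q + a) (q + a + b),
    closed_segment q (q + b), closed_segment (q + b) (q + a + b)}"
proof -
  have d: "d face_of convex hull {q, q + a, q + a + b, q + b}" "aff_dim d = 1"
    using assms(1) by (auto simp: edge_of_def)
  then obtain s where s: "s \<subseteq> {q, q + a, q + a + b, q + b}" "d = convex hull s"
    using face_of_convex_hull_subset[of "{q, q + a, q + a + b, q + b}" d] by (auto simp: finite_imp_compact)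
  have mid: "False" if "x \<in> s" "y \<in> s" "(1 / 2) *\<^sub>R x + (1 / 2) *\<^sub>R y = q + (1 / 2) *\<^sub>R (a + b)" for x y
  proof -
    have "(1 / 2) *\<^sub>R x + (1 / 2) *\<^sub>R y \<in> convex hull s"
      using that by (intro convexD[OF convex_convex_hull]) (auto intro: hull_inc)
    then show False using that(3) s(2) assms(2) by simp
  qed
  have h: "q + (1 / 2) *\<^sub>R (a + b) = (1 / 2) *\<^sub>R q + (1 / 2) *\<^sub>R (q + a + b)"
    "q + (1 / 2) *\<^sub>R (a + b) = (1 / 2) *\<^sub>R (q + a) + (1 / 2) *\<^sub>R (q + b)"
    by (simp_all add: complex_eq_iff field_simps)
  have "\<not> (q \<in> s \<and> q + a + b \<in> s)" "\<not> (q + a \<in> s \<and> q + b \<in> s)"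
    using mid h by metis+
  then obtain x y where xy: "x \<in> {q, q + a + b}" "y \<in> {q + a, q + b}" "s \<subseteq> {x, y}"
    using s(1) by (cases "q \<in> s"; cases "q + a \<in> s") blast+
  have "s = {x, y}"
  proof (rule ccontr)
    assume "s \<noteq> {x, y}"
    then obtain w where "s \<subseteq> {w}" using xy(3) by blast
    then have "aff_dim s \<le> aff_dim {w}" by (rule aff_dim_subset)
    then show False using d(2) s(2) by (simp add: aff_dim_convex_hull)
  qed
  then have "d = closed_segment x y" using s(2) by (simp add: segment_convex_hull)
  then show ?thesis using xy(1,2) by (auto simp: closed_segment_commute)
qed

context downward_sides
begin

lemma prefix_ids:
  assumes "ids = l1 @ k # l2"
  shows "disp e l1 = (\<Sum>i\<in>{1..<k}. e i)" "k \<in> {1..n}"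
proof -
  have d: "distinct ids" "set ids = {1..n}" using perm_ids by (auto simp: perm_def)
  have "i \<in> set l1 \<longleftrightarrow> i \<in> {1..<k}" for i
  proof
    assume "i \<in> set l1"
    then have "before ids i k" "i \<in> {1..n}" using assms d by auto
    then show "i \<in> {1..<k}" using before_ids by auto
  next
    assume i: "i \<in> {1..<k}"
    have "k \<in> {1..n}" using assms d by auto
    then have "i \<in> set ids" using i d by auto
    moreover have "i \<notin> set l2" using before_ids[of k i] i assms by auto
    ultimately show "i \<in> set l1" using assms i by auto
  qed
  then have "set l1 = {1..<k}" by blast
  then show "disp e l1 = (\<Sum>i\<in>{1..<k}. e i)"
    using d assms by (simp add: disp_def sum_list_distinct_conv_sum_set)
  show "k \<in> {1..n}" using assms d by auto
qed

lemma prefix_rev_ids: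
  assumes "rev ids = l1 @ k # l2"
  shows "disp e l1 = (\<Sum>i\<in>{k<..n}. e i)" "k \<in> {1..n}"
proof -
  have d: "distinct (rev ids)" "set (rev ids) = {1..n}" using perm_ids by (auto simp: perm_def)
  have bef: "before (rev ids) i j \<Longrightarrow> j < i" for i j using before_ids by simp
  have "i \<in> set l1 \<longleftrightarrow> i \<in> {k<..n}" for i
  proof
    assume "i \<in> set l1"
    then have "before (rev ids) i k" "i \<in> {1..n}" using assms d unfolding assms by auto
    then show "i \<in> {k<..n}" using bef by auto
  next
    assume i: "i \<in> {k<..n}"
    have "k \<in> {1..n}" using assms d by auto
    then have "i \<in> set (rev ids)" using i d by auto
    moreover have "i \<notin> set l2" using bef[of k i] i unfolding assms by auto
    ultimately show "i \<in> set l1" using i unfolding assms by auto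
  qed
  then have "set l1 = {k<..n}" by blast
  moreover have "distinct l1" using d(1) unfolding assms by auto
  ultimately show "disp e l1 = (\<Sum>i\<in>{k<..n}. e i)"
    by (simp add: disp_def sum_list_distinct_conv_sum_set)
  show "k \<in> {1..n}" using assms d by auto
qed

lemma split_ids:
  assumes "k \<in> {1..n}"
  shows "\<exists>l1 l2. ids = l1 @ k # l2" "\<exists>l1 l2. rev ids = l1 @ k # l2"
proof -
  have "k \<in> set ids" "k \<in> set (rev ids)" using perm_ids assms by (auto simp: perm_def)
  then show "\<exists>l1 l2. ids = l1 @ k # l2" "\<exists>l1 l2. rev ids = l1 @ k # l2"
    by (blast dest: split_list)+
qed

text \<open>Upper end of the left side with label \<open>k\<close>. Sides are addressed by label
  rather than by position: on the left the labels below \<open>k\<close> come first, on the right,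
  in \<open>right_start\<close>, those above \<open>k\<close>.\<close>

definition left_start :: "nat \<Rightarrow> complex" where
  "left_start k = p + (\<Sum>i\<in>{1..<k}. e i)"

definition right_start :: "nat \<Rightarrow> complex" where
  "right_start k = p + (\<Sum>i\<in>{k<..n}. e i)"

lemma left_sides_eq:
  "left_sides n p e = (\<lambda>k. closed_segment (left_start k) (left_start k + e k)) ` {1..n}"
proof -
  have "left_vertex p e (k - 1) = left_start k" "left_vertex p e k = left_start k + e k" if "k \<in> {1..n}" for k
  proof -
    have "{1..k - 1} = {1..<k}" "{1..k} = insert k {1..<k}" using that by auto
    then show "left_vertex p e (k - 1) = left_start k" "left_vertex p e k = left_start k + e k"
      by (auto simp: left_vertex_def left_start_def add_ac)
  qed
  then show ?thesis unfolding left_sides_def by (intro image_cong) auto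
qed

lemma right_sides_eq:
  "right_sides n p e (longest_perm n) = (\<lambda>k. closed_segment (right_start k) (right_start k + e k)) ` {1..n}"
proof -
  have rv: "right_vertex p e (longest_perm n) m = p + (\<Sum>i\<in>{n - m<..n}. e i)" if "m \<le> n" for m
  proof -
    have "(\<Sum>i=1..m. e (longest_perm n i)) = (\<Sum>i\<in>{n - m<..n}. e i)"
      by (rule sum.reindex_bij_witness[where i = "\<lambda>i. n + 1 - i" and j = "\<lambda>i. n + 1 - i"])
        (use that in \<open>auto simp: longest_perm_def\<close>)
    then show ?thesis by (simp add: right_vertex_def)
  qed
  have seg: "closed_segment (right_vertex p e (longest_perm n) (m - 1)) (right_vertex p e (longest_perm n) m) =
    closed_segment (right_start (n + 1 - m)) (right_start (n + 1 - m) + e (n + 1 - m))" if "m \<in> {1..n}" for m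
  proof -
    have "{n - m<..n} = insert (n + 1 - m) {n + 1 - m<..n}" "n - (m - 1) = n + 1 - m" using that by auto
    moreover have "m - 1 \<le> n" "m \<le> n" using that by auto
    ultimately have "right_vertex p e (longest_perm n) (m - 1) = right_start (n + 1 - m)"
      "right_vertex p e (longest_perm n) m = right_start (n + 1 - m) + e (n + 1 - m)"
      using rv[of "m - 1"] rv[of m] by (auto simp: right_start_def add_ac)
    then show ?thesis by simp
  qed
  have "right_sides n p e (longest_perm n) =
    (\<lambda>m. closed_segment (right_start (n + 1 - m)) (right_start (n + 1 - m) + e (n + 1 - m))) ` {1..n}"
    unfolding right_sides_def by (intro image_cong seg) auto
  also have "\<dots> = (\<lambda>k. closed_segment (right_start k) (right_start k + e k)) ` ((\<lambda>m. n + 1 - m) ` {1..n})"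
    by (simp only: image_image)
  also have "(\<lambda>m. n + 1 - m) ` {1..n} = {1..n}"
  proof
    show "{1..n} \<subseteq> (\<lambda>m. n + 1 - m) ` {1..n}"
    proof
      fix k assume "k \<in> {1..n}"
      then show "k \<in> (\<lambda>m. n + 1 - m) ` {1..n}" by (intro image_eqI[of _ _ "n + 1 - k"]) auto
    qed
  qed auto
  finally show ?thesis .
qed

lemma left_graph:
  assumes "n \<ge> 1"
  shows "\<Union> (left_sides n p e) = {z. depth p \<le> depth z \<and> depth z \<le> depth p + total \<and>
    Re z = path_at e p ids (depth z)}"
proof -
  have "ids \<noteq> []" using assms by (simp add: ids_def)
  from path_graph_eq_segments[OF perm_depth_pos[OF perm_ids(1)] this, of p]
  have "{z. depth p \<le> depth z \<and> depth z \<le> depth p + total \<and> Re z = path_at e p ids (depth z)} =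
    {z. \<exists>l1 k l2. ids = l1 @ k # l2 \<and> z \<in> closed_segment (p + disp e l1) (p + disp e l1 + e k)}"
    by (simp only: depth_disp_perm[OF perm_ids(1)])
  also have "\<dots> = \<Union> (left_sides n p e)"
  proof (intro set_eqI iffI)
    fix z assume "z \<in> {z. \<exists>l1 k l2. ids = l1 @ k # l2 \<and> z \<in> closed_segment (p + disp e l1) (p + disp e l1 + e k)}"
    then obtain l1 k l2 where "ids = l1 @ k # l2" "z \<in> closed_segment (p + disp e l1) (p + disp e l1 + e k)"
      by blast
    then show "z \<in> \<Union> (left_sides n p e)"
      unfolding left_sides_eq left_start_def using prefix_ids[of l1 k l2] by auto
  next
    fix z assume "z \<in> \<Union> (left_sides n p e)"
    then obtain k where k: "k \<in> {1..n}" "z \<in> closed_segment (left_start k) (left_start k + e k)"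
      unfolding left_sides_eq by blast
    obtain l1 l2 where l: "ids = l1 @ k # l2" using split_ids(1)[OF k(1)] by blast
    then have "z \<in> closed_segment (p + disp e l1) (p + disp e l1 + e k)"
      using k(2) prefix_ids(1)[OF l] by (simp add: left_start_def)
    then show "z \<in> {z. \<exists>l1 k l2. ids = l1 @ k # l2 \<and> z \<in> closed_segment (p + disp e l1) (p + disp e l1 + e k)}"
      using l by blast
  qed
  finally show ?thesis by simp
qed

lemma right_graph:
  assumes "n \<ge> 1"
  shows "\<Union> (right_sides n p e (longest_perm n)) = {z. depth p \<le> depth z \<and> depth z \<le> depth p + total \<and>
    Re z = path_at e p (rev ids) (depth z)}"
proof -
  have "rev ids \<noteq> []" using assms by (simp add: ids_def)
  from path_graph_eq_segments[OF perm_depth_pos[OF perm_ids(2)] this, of p]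
  have "{z. depth p \<le> depth z \<and> depth z \<le> depth p + total \<and> Re z = path_at e p (rev ids) (depth z)} =
    {z. \<exists>l1 k l2. rev ids = l1 @ k # l2 \<and> z \<in> closed_segment (p + disp e l1) (p + disp e l1 + e k)}"
    by (simp only: depth_disp_perm[OF perm_ids(2)])
  also have "\<dots> = \<Union> (right_sides n p e (longest_perm n))"
  proof (intro set_eqI iffI)
    fix z assume "z \<in> {z. \<exists>l1 k l2. rev ids = l1 @ k # l2 \<and> z \<in> closed_segment (p + disp e l1) (p + disp e l1 + e k)}"
    then obtain l1 k l2 where "rev ids = l1 @ k # l2" "z \<in> closed_segment (p + disp e l1) (p + disp e l1 + e k)"
      by blast
    then show "z \<in> \<Union> (right_sides n p e (longest_perm n))"
      unfolding right_sides_eq right_start_def using prefix_rev_ids[of l1 k l2] by auto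
  next
    fix z assume "z \<in> \<Union> (right_sides n p e (longest_perm n))"
    then obtain k where k: "k \<in> {1..n}" "z \<in> closed_segment (right_start k) (right_start k + e k)"
      unfolding right_sides_eq by blast
    obtain l1 l2 where l: "rev ids = l1 @ k # l2" using split_ids(2)[OF k(1)] by blast
    then have "z \<in> closed_segment (p + disp e l1) (p + disp e l1 + e k)"
      using k(2) prefix_rev_ids(1)[OF l] by (simp add: right_start_def)
    then show "z \<in> {z. \<exists>l1 k l2. rev ids = l1 @ k # l2 \<and> z \<in> closed_segment (p + disp e l1) (p + disp e l1 + e k)}"
      using l by blast
  qed
  finally show ?thesis by simp
qed

lemma total_nonneg: "total \<ge> 0"
  using depth_disp_nonneg[OF perm_depth_pos[OF perm_ids(1)]] depth_disp_perm[OF perm_ids(1)] by simp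

lemma path_at_total: "perm l \<Longrightarrow> path_at e p l (depth p + total) = Re (p + (\<Sum>i=1..n. e i))"
  using path_at_simps(2)[OF perm_depth_pos, of l p] by (simp add: disp_perm total_def)

lemma path_at_start: "perm l \<Longrightarrow> path_at e p l (depth p) = Re p"
  using path_at_simps(1)[OF perm_depth_pos] by blast

lemma boundary_eq:
  assumes "n \<ge> 1"
  shows "elnitsky_boundary n p e (longest_perm n) =
    {z \<in> reg ids. Re z = path_at e p ids (depth z) \<or> Re z = path_at e p (rev ids) (depth z)}"
  unfolding elnitsky_boundary_def Union_Un_distrib left_graph[OF assms] right_graph[OF assms]
  using path_at_le_rev_ids[OF perm_ids(1)] by (auto simp: reg_def band_def)

lemma frontier_reg_ids:
  assumes "n \<ge> 1"
  shows "frontier (reg ids) = elnitsky_boundary n p e (longest_perm n)"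
  unfolding boundary_eq[OF assms] unfolding reg_def using perm_ids
  by (intro frontier_band) (simp_all add: continuous_path_at_perm path_at_start path_at_total)

lemma convex_reg_ids: "convex (reg ids)"
proof -
  have "sorted_wrt (\<lambda>i j. slope e i < slope e j) ids"
  proof (rule sorted_wrt_mono_rel[OF _ sorted_ids])
    show "slope e x < slope e y" if "x \<in> set ids" "y \<in> set ids" "x < y" for x y
      using that perm_ids(1) slope_less by (auto simp: perm_def)
  qed
  then have "convex (band (depth p) (depth p + depth (disp e ids)) (path_at e p ids) (path_at e p (rev ids)))"
    using perm_depth_pos[OF perm_ids(1)] by (intro convex_band) (auto simp: sorted_wrt_rev)
  then show ?thesis by (simp add: reg_def depth_disp_perm)
qed

lemma bounded_reg_ids: "bounded (reg ids)"
proof -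
  let ?I = "{depth p..depth p + total}"
  have b: "bounded (path_at e p l ` ?I)" if "perm l" for l
    using continuous_path_at_perm[OF that]
    by (intro compact_imp_bounded compact_continuous_image) (auto intro: continuous_on_subset)
  obtain A B where A: "\<And>y. y \<in> ?I \<Longrightarrow> \<bar>path_at e p ids y\<bar> \<le> A"
    and B: "\<And>y. y \<in> ?I \<Longrightarrow> \<bar>path_at e p (rev ids) y\<bar> \<le> B"
    using b[OF perm_ids(1)] b[OF perm_ids(2)] by (force simp: bounded_iff)
  have "norm z \<le> A + B + (\<bar>depth p\<bar> + total)" if "z \<in> reg ids" for z
  proof -
    have z: "depth z \<in> ?I" "path_at e p ids (depth z) \<le> Re z" "Re z \<le> path_at e p (rev ids) (depth z)"
      using that by (auto simp: reg_def band_def)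
    have "norm z \<le> \<bar>Re z\<bar> + \<bar>Im z\<bar>" by (rule cmod_le)
    moreover have "\<bar>Re z\<bar> \<le> A + B" using A[OF z(1)] B[OF z(1)] z by linarith
    moreover have "\<bar>Im z\<bar> \<le> \<bar>depth p\<bar> + total" using z(1) total_nonneg by (auto simp: depth_def)
    ultimately show ?thesis by linarith
  qed
  then show ?thesis by (auto simp: bounded_iff)
qed

lemma closure_interior_reg_ids:
  assumes "n \<ge> 2"
  shows "closure (interior (reg ids)) = reg ids"
proof -
  have "(1, 2) \<in> noninv ids" using assms by (simp add: noninv_ids)
  then obtain y where y: "depth p < y" "y < depth p + total" "path_at e p ids y < path_at e p (rev ids) y"
    using exists_gap[OF perm_ids(1)] by blast
  have "Complex ((path_at e p ids y + path_at e p (rev ids) y) / 2) (- y) \<in> interior (reg ids)"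
    using y by (simp add: interior_reg)
  then have "closure (interior (reg ids)) = closure (reg ids)"
    by (intro convex_closure_interior convex_reg_ids) auto
  then show ?thesis using closed_reg[OF perm_ids(1)] by simp
qed

text \<open>The region is bounded and convex, so what its frontier encloses is its interior, without
  any appeal to the Jordan curve theorem. As the interior is not empty, its closure is the region
  again.\<close>

lemma elnitsky_polygon_eq:
  assumes "n \<ge> 2"
  shows "elnitsky_polygon n p e (longest_perm n) = reg ids"
proof -
  have "inside (frontier (reg ids)) = interior (reg ids)"
    by (rule inside_frontier_eq_interior[OF bounded_reg_ids convex_reg_ids])
  then show ?thesis
    using closure_interior_reg_ids[OF assms] frontier_reg_ids assms by (simp add: elnitsky_polygon_def)
qed

lemma rhombic_tile_iff:
  "rhombic_tile n e t \<longleftrightarrow> (\<exists>q i j. 1 \<le> i \<and> i < j \<and> j \<le> n \<and> t = rhomb e q i j)"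
proof
  assume "rhombic_tile n e t"
  then obtain q i j where t: "i \<in> {1..n}" "j \<in> {1..n}" "i \<noteq> j"
    "t = convex hull {q, q + e i, q + e i + e j, q + e j}"
    by (auto simp: rhombic_tile_def)
  have "{q, q + e i, q + e i + e j, q + e j} = {q, q + e j, q + e j + e i, q + e i}"
    by (auto simp: add_ac)
  then have "t = rhomb e q i j" "t = rhomb e q j i" using t(4) by (simp_all add: rhomb_def)
  then show "\<exists>q i j. 1 \<le> i \<and> i < j \<and> j \<le> n \<and> t = rhomb e q i j"
    using t(1-3) by (cases "i < j") (auto, metis linorder_neqE_nat One_nat_def)
next
  assume "\<exists>q i j. 1 \<le> i \<and> i < j \<and> j \<le> n \<and> t = rhomb e q i j"
  then obtain q i j where "1 \<le> i" "i < j" "j \<le> n" "t = rhomb e q i j" by blast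
  then have "i \<in> {1..n}" "j \<in> {1..n}" "i \<noteq> j" "t = convex hull {q, q + e i, q + e i + e j, q + e j}"
    by (auto simp: rhomb_def)
  then show "rhombic_tile n e t" unfolding rhombic_tile_def by blast
qed

text \<open>At the start of the sweep the region is the closure of its interior, so a finite family
  of closed tiles that covers the interior covers everything.\<close>

lemma rhombic_tilings_iff:
  assumes "n \<ge> 2"
  shows "T \<in> rhombic_tilings n p e (longest_perm n) \<longleftrightarrow> partial_tiling ids T"
proof
  assume T: "T \<in> rhombic_tilings n p e (longest_perm n)"
  then have U: "\<Union> T = reg ids"
    unfolding rhombic_tilings_def elnitsky_polygon_eq[OF assms] by blast
  show "partial_tiling ids T"
    unfolding partial_tiling_def U
  proof (intro conjI interior_subset order_refl)
    show "\<forall>t\<in>T. \<exists>q i j. 1 \<le> i \<and> i < j \<and> j \<le> n \<and> t = rhomb e q i j"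
      using T unfolding rhombic_tilings_def rhombic_tile_iff by blast
  qed (use T in \<open>unfold rhombic_tilings_def, blast+\<close>)
next
  assume "partial_tiling ids T"
  then have T: "finite T" "\<forall>t\<in>T. \<exists>q i j. 1 \<le> i \<and> i < j \<and> j \<le> n \<and> t = rhomb e q i j"
    "pairwise (\<lambda>t t'. interior t \<inter> interior t' = {}) T" "interior (reg ids) \<subseteq> \<Union> T" "\<Union> T \<subseteq> reg ids"
    unfolding partial_tiling_def by blast+
  have "closed t" if t: "t \<in> T" for t
  proof -
    obtain q i j where "t = rhomb e q i j" using T(2) t by blast
    then show ?thesis
      by (simp add: rhomb_def compact_imp_closed finite_imp_compact_convex_hull)
  qed
  then have "closed (\<Union> T)" using T(1) by (intro closed_Union) blast+
  then have "closure (interior (reg ids)) \<subseteq> \<Union> T" using T(4) by (rule closure_minimal[rotated])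
  then have U: "\<Union> T = reg ids"
    using T(5) unfolding closure_interior_reg_ids[OF assms] by (rule equalityI[rotated])
  show "T \<in> rhombic_tilings n p e (longest_perm n)"
    unfolding rhombic_tilings_def rhombic_tile_iff elnitsky_polygon_eq[OF assms]
    by (intro CollectI conjI T(1,2,3) U)
qed

end

section \<open>Perimeter tiles\<close>

context downward_sides
begin

section \<open>Recovering top vertex and labels from a tile as a point set\<close>

lemma rhomb_mem:
  assumes "1 \<le> i" "i < j" "j \<le> n"
  shows "z \<in> rhomb e q i j \<longleftrightarrow> depth q \<le> depth z \<and> depth z \<le> depth q + (depth (e i) + depth (e j)) \<and>
    path_at e q [i, j] (depth z) \<le> Re z \<and> Re z \<le> path_at e q [j, i] (depth z)"
  unfolding rhomb_band[OF assms] band_def by simp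

lemma rhomb_mem_ends:
  assumes "1 \<le> i" "i < j" "j \<le> n" "depth q \<le> y" "y \<le> depth q + (depth (e i) + depth (e j))"
  shows "Complex (path_at e q [i, j] y) (- y) \<in> rhomb e q i j"
    "Complex (path_at e q [j, i] y) (- y) \<in> rhomb e q i j"
  using assms path_at_pair_le[OF assms(1-4)] by (auto simp: rhomb_mem)

lemma rhomb_top_unique:
  assumes "1 \<le> i" "i < j" "j \<le> n" "1 \<le> i'" "i' < j'" "j' \<le> n" "rhomb e q i j = rhomb e q' i' j'"
  shows "q = q'"
proof -
  have pos: "0 < depth (e i)" "0 < depth (e j)" "0 < depth (e i')" "0 < depth (e j')"
    using assms by (auto intro!: depth_pos)
  have "q \<in> rhomb e q i j" "q' \<in> rhomb e q' i' j'" by (auto simp: rhomb_def intro: hull_inc)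
  then have *: "q \<in> rhomb e q' i' j'" "q' \<in> rhomb e q i j" using assms(7) by auto
  then have "depth q = depth q'"
    using rhomb_mem[OF assms(1-3)] rhomb_mem[OF assms(4-6)] by (meson order_antisym)
  moreover have "Re q = Re q'"
    using * rhomb_mem[OF assms(4-6), of q q'] pos calculation by (auto simp: path_at_def)
  ultimately show ?thesis by (intro complex_eqI_depth) auto
qed

text \<open>Just below the common top vertex a rhomb is the wedge between its two slopes, so
  inclusion of rhombs forces inclusion of wedges. The level \<open>u\<close> stays within all four
  sides at the top.\<close>

lemma rhomb_subset_slopes:
  assumes "1 \<le> i" "i < j" "j \<le> n" "1 \<le> i'" "i' < j'" "j' \<le> n" "rhomb e q i j \<subseteq> rhomb e q i' j'"
  shows "slope e i' \<le> slope e i" "slope e j \<le> slope e j'"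
proof -
  have pos: "0 < depth (e i)" "0 < depth (e j)" "0 < depth (e i')" "0 < depth (e j')"
    using assms by (auto intro!: depth_pos)
  define u where "u = min (min (depth (e i)) (depth (e j))) (min (depth (e i')) (depth (e j')))"
  have u: "u > 0" "u \<le> depth (e i)" "u \<le> depth (e j)" "u \<le> depth (e i')" "u \<le> depth (e j')"
    using pos by (auto simp: u_def)
  have "Complex (path_at e q [i, j] (depth q + u)) (- (depth q + u)) \<in> rhomb e q i' j'"
    "Complex (path_at e q [j, i] (depth q + u)) (- (depth q + u)) \<in> rhomb e q i' j'"
    using rhomb_mem_ends[OF assms(1-3), of q "depth q + u"] u pos assms(7) by auto
  then show "slope e i' \<le> slope e i" "slope e j \<le> slope e j'"
    using u by (auto simp: rhomb_mem[OF assms(4-6)] path_at_def)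
qed

lemma rhomb_label_unique:
  assumes "1 \<le> i" "i < j" "j \<le> n" "1 \<le> i'" "i' < j'" "j' \<le> n" "rhomb e q i j = rhomb e q' i' j'"
  shows "i = i' \<and> j = j'"
proof -
  have [simp]: "q' = q" using rhomb_top_unique[OF assms] by simp
  have "slope e i = slope e i'" "slope e j = slope e j'"
    using rhomb_subset_slopes[of i j i' j' q] rhomb_subset_slopes[of i' j' i j q] assms by auto
  then show ?thesis using inj_onD[OF inj_on_slope] assms by auto
qed

lemma left_start_Suc: "1 \<le> k \<Longrightarrow> left_start (Suc k) = left_start k + e k"
  by (simp add: left_start_def atLeastLessThanSuc add_ac)

lemma right_start_pred: "k \<in> {1..n} \<Longrightarrow> right_start (k - 1) = right_start k + e k"
proof -
  assume "k \<in> {1..n}"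
  then have "{k - 1<..n} = insert k {k<..n}" by auto
  then show ?thesis by (simp add: right_start_def add_ac)
qed

lemma depth_sum: "depth (sum f A) = (\<Sum>i\<in>A. depth (f i))"
  by (simp add: depth_def sum_negf)

lemma depth_left_start_less:
  assumes "1 \<le> k" "k < k'" "k' \<le> Suc n"
  shows "depth (left_start k) < depth (left_start k')"
proof -
  have "(\<Sum>i\<in>{1..<k}. depth (e i)) < (\<Sum>i\<in>{1..<k'}. depth (e i))"
    using assms by (intro sum_strict_mono2[of _ _ k]) (auto intro!: depth_pos less_imp_le[OF depth_pos])
  then show ?thesis by (simp add: left_start_def depth_sum)
qed

lemma depth_right_start_less:
  assumes "k < k'" "k' \<le> n"
  shows "depth (right_start k') < depth (right_start k)"
proof -
  have "(\<Sum>i\<in>{k'<..n}. depth (e i)) < (\<Sum>i\<in>{k<..n}. depth (e i))"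
    using assms by (intro sum_strict_mono2[of _ _ k']) (auto intro!: depth_pos less_imp_le[OF depth_pos])
  then show ?thesis by (simp add: right_start_def depth_sum)
qed

text \<open>The labels before \<open>i\<close> and those after \<open>j\<close> would have equal
  total displacement. All slopes of the former lie below \<open>slope e i\<close>, all of the latter
  above \<open>slope e j\<close>, so for equal positive depth the horizontal displacements differ;
  hence both sets of labels are empty.\<close>

lemma left_start_eq_right_start:
  assumes "1 \<le> i" "i < j" "j \<le> n" "left_start i = right_start j"
  shows "i = 1 \<and> j = n"
proof (rule ccontr)
  assume neg: "\<not> (i = 1 \<and> j = n)"
  let ?A = "{1..<i}" and ?B = "{j<..n}"
  have "(\<Sum>k\<in>?A. e k) = (\<Sum>k\<in>?B. e k)" using assms(4) by (simp add: left_start_def right_start_def)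
  then have dep: "(\<Sum>k\<in>?A. depth (e k)) = (\<Sum>k\<in>?B. depth (e k))"
    and re: "(\<Sum>k\<in>?A. Re (e k)) = (\<Sum>k\<in>?B. Re (e k))"
    by (metis depth_sum, metis Re_sum)
  have pos: "(\<Sum>k\<in>C. depth (e k)) > 0" if "C \<subseteq> {1..n}" "C \<noteq> {}" for C
  proof (rule sum_pos)
    show "finite C" using that(1) by (rule finite_subset) simp
    show "0 < depth (e k)" if "k \<in> C" for k using that \<open>C \<subseteq> {1..n}\<close> by (intro depth_pos) blast
  qed (rule that(2))
  have ne: "?A \<noteq> {}" "?B \<noteq> {}"
    using neg assms dep pos[of ?A] pos[of ?B] by force+
  have "(\<Sum>k\<in>?A. Re (e k)) < (\<Sum>k\<in>?A. slope e i * depth (e k))"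
  proof (rule sum_strict_mono)
    fix k assume "k \<in> ?A"
    then have "0 < depth (e k)" "slope e k < slope e i" using assms by (auto intro!: depth_pos slope_less)
    then show "Re (e k) < slope e i * depth (e k)" by (simp add: Re_eq_slope)
  qed (use ne in auto)
  also have "\<dots> = slope e i * (\<Sum>k\<in>?A. depth (e k))" by (simp add: sum_distrib_left)
  also have "\<dots> \<le> slope e j * (\<Sum>k\<in>?A. depth (e k))"
    using ne assms by (intro mult_right_mono less_imp_le[OF slope_less] less_imp_le[OF pos]) auto
  also have "\<dots> = (\<Sum>k\<in>?B. slope e j * depth (e k))" unfolding dep by (rule sum_distrib_left)
  also have "\<dots> < (\<Sum>k\<in>?B. Re (e k))"
  proof (rule sum_strict_mono)
    fix k assume "k \<in> ?B"
    then have "0 < depth (e k)" "slope e j < slope e k" using assms by (auto intro!: depth_pos slope_less)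
    then show "slope e j * depth (e k) < Re (e k)" by (simp add: Re_eq_slope)
  qed (use ne in auto)
  finally show False using re by simp
qed

text \<open>The side labelled \<open>k\<close> of the leftside, resp. rightside, boundary is an edge of the tile with
  top vertex \<open>q\<close> and labels \<open>i < j\<close>.\<close>

definition covers_left :: "complex \<Rightarrow> nat \<Rightarrow> nat \<Rightarrow> nat \<Rightarrow> bool" where
  "covers_left q i j k \<longleftrightarrow> k = i \<and> q = left_start i \<or> k = j \<and> q + e i = left_start j"

definition covers_right :: "complex \<Rightarrow> nat \<Rightarrow> nat \<Rightarrow> nat \<Rightarrow> bool" where
  "covers_right q i j k \<longleftrightarrow> k = j \<and> q = right_start j \<or> k = i \<and> q + e j = right_start i"

text \<open>The midpoint of an edge has a depth strictly inside the tile, whichever of the two edges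
  it is. For right boundaries the lemma is used with \<open>i\<close> and \<open>j\<close>
  exchanged.\<close>

lemma path_at_edge_midpoint:
  assumes "i \<in> {1..n}" "j \<in> {1..n}" "k = i \<and> q = v \<or> k = j \<and> q + e i = v"
  shows "depth q < depth v + depth (e k) / 2" "depth v + depth (e k) / 2 < depth q + (depth (e i) + depth (e j))"
    "path_at e q [i, j] (depth v + depth (e k) / 2) = Re v + slope e k * (depth (e k) / 2)"
proof -
  have pos: "0 < depth (e i)" "0 < depth (e j)" using assms by (auto intro!: depth_pos)
  from assms(3) show "depth q < depth v + depth (e k) / 2"
    "depth v + depth (e k) / 2 < depth q + (depth (e i) + depth (e j))"
    using pos by auto
  from assms(3) show "path_at e q [i, j] (depth v + depth (e k) / 2) = Re v + slope e k * (depth (e k) / 2)"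
  proof
    assume "k = i \<and> q = v"
    then show ?thesis using pos by (simp add: path_at_pair_first)
  next
    assume *: "k = j \<and> q + e i = v"
    then have "depth v = depth q + depth (e i)" by auto
    then show ?thesis
      using path_at_pair_second[OF assms(1), of q "depth v + depth (e j) / 2" j] pos * by simp
  qed
qed

text \<open>Two tiles with the same left side share its midpoint as a left boundary point and
  therefore overlap to the right of it. This is the incompatibility behind the alternation.\<close>

lemma covers_left_unique:
  assumes T: "pairwise (\<lambda>t t'. interior t \<inter> interior t' = {}) T"
    and t: "1 \<le> i" "i < j" "j \<le> n" "rhomb e q i j \<in> T" "covers_left q i j k"
    and t': "1 \<le> i'" "i' < j'" "j' \<le> n" "rhomb e q' i' j' \<in> T" "covers_left q' i' j' k"
  shows "i = i' \<and> j = j'"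
proof -
  define y where "y = depth (left_start k) + depth (e k) / 2"
  have y: "depth q < y" "y < depth q + (depth (e i) + depth (e j))"
    "depth q' < y" "y < depth q' + (depth (e i') + depth (e j'))"
    "path_at e q [i, j] y = path_at e q' [i', j'] y"
    using path_at_edge_midpoint[of i j k q "left_start k"] path_at_edge_midpoint[of i' j' k q' "left_start k"] t t'
    unfolding y_def covers_left_def by auto
  let ?z = "Complex ((path_at e q [i, j] y + min (path_at e q [j, i] y) (path_at e q' [j', i'] y)) / 2) (- y)"
  have "?z \<in> interior (rhomb e q i j)" "?z \<in> interior (rhomb e q' i' j')"
    using y path_at_pair_less[OF t(1-3) y(1,2)] path_at_pair_less[OF t'(1-3) y(3,4)]
    by (auto simp: interior_rhomb[OF t(1-3)] interior_rhomb[OF t'(1-3)] min_def)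
  then have "rhomb e q i j = rhomb e q' i' j'"
    using T t(4) t'(4) unfolding pairwise_def by blast
  then show ?thesis using rhomb_label_unique t t' by blast
qed

lemma covers_right_unique:
  assumes T: "pairwise (\<lambda>t t'. interior t \<inter> interior t' = {}) T"
    and t: "1 \<le> i" "i < j" "j \<le> n" "rhomb e q i j \<in> T" "covers_right q i j k"
    and t': "1 \<le> i'" "i' < j'" "j' \<le> n" "rhomb e q' i' j' \<in> T" "covers_right q' i' j' k"
  shows "i = i' \<and> j = j'"
proof -
  define y where "y = depth (right_start k) + depth (e k) / 2"
  have y: "depth q < y" "y < depth q + (depth (e i) + depth (e j))"
    "depth q' < y" "y < depth q' + (depth (e i') + depth (e j'))"
    "path_at e q [j, i] y = path_at e q' [j', i'] y"
    using path_at_edge_midpoint[of j i k q "right_start k"] path_at_edge_midpoint[of j' i' k q' "right_start k"] t t'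
    unfolding y_def covers_right_def by auto
  let ?z = "Complex ((path_at e q [j, i] y + max (path_at e q [i, j] y) (path_at e q' [i', j'] y)) / 2) (- y)"
  have "?z \<in> interior (rhomb e q i j)" "?z \<in> interior (rhomb e q' i' j')"
    using y path_at_pair_less[OF t(1-3) y(1,2)] path_at_pair_less[OF t'(1-3) y(3,4)]
    by (auto simp: interior_rhomb[OF t(1-3)] interior_rhomb[OF t'(1-3)] max_def)
  then have "rhomb e q i j = rhomb e q' i' j'"
    using T t(4) t'(4) unfolding pairwise_def by blast
  then show ?thesis using rhomb_label_unique t t' by blast
qed

lemma rhomb_in_reg:
  assumes "rhomb e q i j \<subseteq> reg ids" "1 \<le> i" "i < j" "j \<le> n"
    and "depth q \<le> y" "y \<le> depth q + (depth (e i) + depth (e j))"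
  shows "depth p \<le> y" "y \<le> depth p + total" "path_at e p ids y \<le> path_at e q [i, j] y"
    "path_at e q [j, i] y \<le> path_at e p (rev ids) y"
  using subsetD[OF assms(1) rhomb_mem_ends(1)[OF assms(2-6)]]
    subsetD[OF assms(1) rhomb_mem_ends(2)[OF assms(2-6)]]
  by (simp_all add: reg_def band_def)

text \<open>At a depth strictly inside the tile its left boundary has points of the region to its
  right, so if it is on the boundary of the polygon, it is on the leftside path. A straight piece of
  that path with the length and slope of a side is the side with this label. The right edges are
  symmetric.\<close>

lemma rhomb_boundary_edges:
  fixes q i j
  defines "B \<equiv> elnitsky_boundary n p e (longest_perm n)"
  assumes t: "rhomb e q i j \<subseteq> reg ids" "1 \<le> i" "i < j" "j \<le> n"
  shows "closed_segment q (q + e i) \<subseteq> B \<Longrightarrow> q = left_start i"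
    "closed_segment (q + e i) (q + e i + e j) \<subseteq> B \<Longrightarrow> q + e i = left_start j"
    "closed_segment q (q + e j) \<subseteq> B \<Longrightarrow> q = right_start j"
    "closed_segment (q + e j) (q + e j + e i) \<subseteq> B \<Longrightarrow> q + e j = right_start i"
proof -
  have ij: "i \<in> {1..n}" "j \<in> {1..n}" "n \<ge> 1" using t by auto
  have pos: "0 < depth (e i)" "0 < depth (e j)" using ij by (auto intro!: depth_pos)
  note reg = rhomb_in_reg[OF t] and less = path_at_pair_less[OF t(2-4)]
  have L: "path_at e p ids y = path_at e q [i, j] y"
    if "depth q < y" "y < depth q + (depth (e i) + depth (e j))" "Complex (path_at e q [i, j] y) (- y) \<in> B" for y
    using that reg[of y] less[of q y] unfolding B_def boundary_eq[OF ij(3)] by auto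
  have R: "path_at e p (rev ids) y = path_at e q [j, i] y"
    if "depth q < y" "y < depth q + (depth (e i) + depth (e j))" "Complex (path_at e q [j, i] y) (- y) \<in> B" for y
    using that reg[of y] less[of q y] unfolding B_def boundary_eq[OF ij(3)] by auto
  have lev: "depth p \<le> depth q" "depth q + (depth (e i) + depth (e j)) \<le> depth p + total"
    using reg(1)[of "depth q"] reg(2)[of "depth q + (depth (e i) + depth (e j))"] pos by auto
  have seg: "Complex (Re v + slope e k * (y - depth v)) (- y) \<in> closed_segment v (v + e k)"
    if "k \<in> {1..n}" "depth v \<le> y" "y \<le> depth v + depth (e k)" for v k y
    using that depth_pos[OF that(1)] by (simp add: closed_segment_graph slope_def)
  have start_left: "v = left_start k"
    if k: "k \<in> {1..n}" and v: "depth p \<le> depth v" "depth v + depth (e k) \<le> depth p + total"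
      and eq: "\<And>y. depth v < y \<Longrightarrow> y < depth v + depth (e k) \<Longrightarrow>
        path_at e p ids y = Re v + slope e k * (y - depth v)" for k v
  proof -
    have "\<exists>l1 l2. ids = l1 @ k # l2 \<and> depth v = depth (p + disp e l1) \<and> Re v = Re (p + disp e l1)"
      using perm_ids(1) k v eq
      by (intro path_contains_segment) (auto simp: perm_def depth_disp_perm[OF perm_ids(1)])
    then obtain l1 l2 where l: "ids = l1 @ k # l2" "v = p + disp e l1" by (blast intro: complex_eqI_depth)
    then show ?thesis using prefix_ids(1)[OF l(1)] by (simp add: left_start_def)
  qed
  have start_right: "v = right_start k"
    if k: "k \<in> {1..n}" and v: "depth p \<le> depth v" "depth v + depth (e k) \<le> depth p + total"
      and eq: "\<And>y. depth v < y \<Longrightarrow> y < depth v + depth (e k) \<Longrightarrow>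
        path_at e p (rev ids) y = Re v + slope e k * (y - depth v)" for k v
  proof -
    have "\<exists>l1 l2. rev ids = l1 @ k # l2 \<and> depth v = depth (p + disp e l1) \<and> Re v = Re (p + disp e l1)"
    proof (rule path_contains_segment)
      show "depth v + depth (e k) \<le> depth p + depth (disp e (rev ids))"
        using v depth_disp_perm[OF perm_ids(2)] by simp
    qed (use perm_ids(2) k v eq in \<open>auto simp: perm_def\<close>)
    then obtain l1 l2 where l: "rev ids = l1 @ k # l2" "v = p + disp e l1" by (blast intro: complex_eqI_depth)
    then show ?thesis using prefix_rev_ids(1)[OF l(1)] by (simp add: right_start_def)
  qed
  show "q = left_start i" if B: "closed_segment q (q + e i) \<subseteq> B"
  proof (rule start_left)
    fix y assume y: "depth q < y" "y < depth q + depth (e i)"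
    have P: "path_at e q [i, j] y = Re q + slope e i * (y - depth q)"
      using y by (intro path_at_pair_first) auto
    have "Complex (path_at e q [i, j] y) (- y) \<in> B"
      unfolding P using B seg[OF ij(1), of q y] y by auto
    then show "path_at e p ids y = Re q + slope e i * (y - depth q)" using L[of y] y pos P by simp
  qed (use lev pos ij in auto)
  show "q + e i = left_start j" if B: "closed_segment (q + e i) (q + e i + e j) \<subseteq> B"
  proof (rule start_left)
    fix y assume y: "depth (q + e i) < y" "y < depth (q + e i) + depth (e j)"
    have P: "path_at e q [i, j] y = Re (q + e i) + slope e j * (y - depth (q + e i))"
      using y path_at_pair_second[OF ij(1), of q y j] by simp
    have "Complex (path_at e q [i, j] y) (- y) \<in> B"
      unfolding P using B seg[OF ij(2), of "q + e i" y] y by auto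
    then show "path_at e p ids y = Re (q + e i) + slope e j * (y - depth (q + e i))" using L[of y] y pos P by simp
  qed (use lev pos ij in auto)
  show "q = right_start j" if B: "closed_segment q (q + e j) \<subseteq> B"
  proof (rule start_right)
    fix y assume y: "depth q < y" "y < depth q + depth (e j)"
    have P: "path_at e q [j, i] y = Re q + slope e j * (y - depth q)"
      using y by (intro path_at_pair_first) auto
    have "Complex (path_at e q [j, i] y) (- y) \<in> B"
      unfolding P using B seg[OF ij(2), of q y] y by auto
    then show "path_at e p (rev ids) y = Re q + slope e j * (y - depth q)" using R[of y] y pos P by simp
  qed (use lev pos ij in auto)
  show "q + e j = right_start i" if B: "closed_segment (q + e j) (q + e j + e i) \<subseteq> B"
  proof (rule start_right)
    fix y assume y: "depth (q + e j) < y" "y < depth (q + e j) + depth (e i)"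
    have P: "path_at e q [j, i] y = Re (q + e j) + slope e i * (y - depth (q + e j))"
      using y path_at_pair_second[OF ij(2), of q y i] by simp
    have "Complex (path_at e q [j, i] y) (- y) \<in> B"
      unfolding P using B seg[OF ij(1), of "q + e j" y] y by auto
    then show "path_at e p (rev ids) y = Re (q + e j) + slope e i * (y - depth (q + e j))" using R[of y] y pos P by simp
  qed (use lev pos ij in auto)
qed

lemma rhomb_nonparallel:
  assumes "i \<in> {1..n}" "j \<in> {1..n}" "i \<noteq> j"
  shows "Re (e i) * Im (e j) \<noteq> Im (e i) * Re (e j)"
proof
  assume eq: "Re (e i) * Im (e j) = Im (e i) * Re (e j)"
  have pos: "0 < depth (e i)" "0 < depth (e j)" using assms by (auto intro!: depth_pos)
  have "slope e i = slope e j"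
    using eq pos by (simp add: slope_def depth_def field_simps)
  then show False using inj_onD[OF inj_on_slope] assms by auto
qed

lemma rhomb_center:
  assumes "1 \<le> i" "i < j" "j \<le> n"
  shows "q + (1 / 2) *\<^sub>R (e i + e j) \<in> interior (rhomb e q i j)"
proof -
  have pos: "0 < depth (e i)" "0 < depth (e j)" using assms by (auto intro!: depth_pos)
  have "slope e i < slope e j" using assms by (intro slope_less) auto
  then have "slope e i * depth (e i) < slope e j * depth (e i)" "slope e i * depth (e j) < slope e j * depth (e j)"
    using pos by auto
  then show ?thesis
    using pos by (auto simp: interior_rhomb[OF assms] path_at_def Re_eq_slope field_simps)
qed

lemma parallel_segments_disjoint:
  fixes q a b :: complex
  assumes "Re a * Im b \<noteq> Im a * Re b"
  shows "closed_segment q (q + a) \<inter> closed_segment (q + b) (q + b + a) = {}"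
proof (rule ccontr)
  assume "\<not> ?thesis"
  then obtain z where "z \<in> closed_segment q (q + a)" "z \<in> closed_segment (q + b) (q + b + a)" by blast
  then obtain t u where t: "z = (1 - t) *\<^sub>R q + t *\<^sub>R (q + a)"
    and u: "z = (1 - u) *\<^sub>R (q + b) + u *\<^sub>R (q + b + a)"
    unfolding in_segment by blast
  have "z = q + t *\<^sub>R a" unfolding t by (simp add: algebra_simps)
  moreover have "z = q + b + u *\<^sub>R a" unfolding u by (simp add: algebra_simps)
  ultimately have b: "b = (t - u) *\<^sub>R a" by (simp add: algebra_simps)
  have "Re a * Im b = Im a * Re b" unfolding b by simp
  then show False using assms by simp
qed

text \<open>The four cases are a corner at a left vertex, at a right vertex, at the top and at the
  bottom. Two consecutive sides of one boundary have consecutive labels; at the top or bottom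
  \<open>left_start_eq_right_start\<close> forces the labels 1 and n.\<close>

lemma perimeter_tile_cases:
  assumes t: "rhomb e q i j \<subseteq> reg ids" "1 \<le> i" "i < j" "j \<le> n"
    and perim: "perimeter_tile n p e (longest_perm n) (rhomb e q i j)"
  shows "j = Suc i \<and> covers_left q i j i \<and> covers_left q i j j \<or>
    j = Suc i \<and> covers_right q i j i \<and> covers_right q i j j \<or>
    i = 1 \<and> j = n \<and> covers_left q i j i \<and> covers_right q i j j \<or>
    i = 1 \<and> j = n \<and> covers_left q i j j \<and> covers_right q i j i"
proof -
  let ?B = "elnitsky_boundary n p e (longest_perm n)"
  define UL where "UL = closed_segment q (q + e i)"
  define LL where "LL = closed_segment (q + e i) (q + e i + e j)"
  define UR where "UR = closed_segment q (q + e j)"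
  define LR where "LR = closed_segment (q + e j) (q + e j + e i)"
  have ij: "i \<in> {1..n}" "j \<in> {1..n}" "i \<noteq> j" "n \<ge> 1" using t by auto
  obtain a b where ab: "a edge_of rhomb e q i j" "b edge_of rhomb e q i j" "a \<noteq> b" "a \<inter> b \<noteq> {}"
    "a \<union> b \<subseteq> ?B"
    using perim unfolding perimeter_tile_def by blast
  have "q + (1 / 2) *\<^sub>R (e i + e j) \<in> interior (reg ids)"
    using rhomb_center[OF t(2-4)] interior_mono[OF t(1)] by blast
  then have "q + (1 / 2) *\<^sub>R (e i + e j) \<notin> ?B"
    unfolding frontier_reg_ids[OF ij(4), symmetric] frontier_def by blast
  then have "c \<in> {UL, LL, UR, LR}" if "c edge_of rhomb e q i j" "c \<subseteq> ?B" for c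
    using edge_of_parallelogram_cases[of c q "e i" "e j"] that
    unfolding rhomb_def UL_def LL_def UR_def LR_def by (auto simp: add_ac)
  then have abc: "a \<in> {UL, LL, UR, LR}" "b \<in> {UL, LL, UR, LR}" using ab by blast+
  have "UL \<inter> LR = {}" "UR \<inter> LL = {}"
    unfolding UL_def LL_def UR_def LR_def
    by (intro parallel_segments_disjoint rhomb_nonparallel ij(1-3) ij(3)[symmetric])+
  then have dis: "UL \<inter> LR = {}" "UR \<inter> LL = {}" "LR \<inter> UL = {}" "LL \<inter> UR = {}" by blast+
  \<comment> \<open>Opposite edges are disjoint, so two distinct edges that meet are one of the four
    adjacent pairs.\<close>
  have "UL \<subseteq> ?B \<and> LL \<subseteq> ?B \<or> UR \<subseteq> ?B \<and> LR \<subseteq> ?B \<or> UL \<subseteq> ?B \<and> UR \<subseteq> ?B \<or> LL \<subseteq> ?B \<and> LR \<subseteq> ?B"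
    using abc ab(3-5) by (elim insertE emptyE) (simp_all add: dis)
  then consider "q = left_start i" "q + e i = left_start j" | "q = right_start j" "q + e j = right_start i"
    | "q = left_start i" "q = right_start j" | "q + e i = left_start j" "q + e j = right_start i"
    using rhomb_boundary_edges[OF t] unfolding UL_def LL_def UR_def LR_def by blast
  then show ?thesis
  proof cases
    case 1
    then have "left_start (Suc i) = left_start j" using left_start_Suc[OF t(2)] by simp
    then have "j = Suc i" using depth_left_start_less[of "Suc i" j] t by (cases "Suc i < j") auto
    then show ?thesis using 1 by (simp add: covers_left_def)
  next
    case 2
    then have "right_start (j - 1) = right_start i" using right_start_pred[OF ij(2)] by simp
    moreover have "j - 1 \<le> n" using t by simp
    ultimately have "j = Suc i" using depth_right_start_less[of i "j - 1"] t by (cases "i < j - 1") auto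
    then show ?thesis using 2 by (simp add: covers_right_def)
  next
    case 3
    then have "i = 1 \<and> j = n" using left_start_eq_right_start t by metis
    then show ?thesis using 3 by (simp add: covers_left_def covers_right_def)
  next
    case 4
    \<comment> \<open>Both sides describe the lower end of the tile. Cancelling the labels from
      \<open>i\<close> to \<open>j\<close> reduces this to the situation at the top.\<close>
    then have "left_start j + e j = right_start i + e i" by (metis add.assoc add.commute)
    then have "(\<Sum>k\<in>{1..<j}. e k) + e j = (\<Sum>k\<in>{i<..n}. e k) + e i"
      by (simp add: left_start_def right_start_def add_ac)
    moreover have "{1..<j} = insert i ({1..<i} \<union> {i<..<j})" "{i<..n} = insert j ({i<..<j} \<union> {j<..n})"
      "{1..<i} \<inter> {i<..<j} = {}" "{i<..<j} \<inter> {j<..n} = {}" using t by auto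
    then have "(\<Sum>k\<in>{1..<j}. e k) = (\<Sum>k\<in>{1..<i}. e k) + (e i + (\<Sum>k\<in>{i<..<j}. e k))"
      "(\<Sum>k\<in>{i<..n}. e k) = (\<Sum>k\<in>{i<..<j}. e k) + (e j + (\<Sum>k\<in>{j<..n}. e k))"
      by (simp_all add: sum.union_disjoint)
    ultimately have "(\<Sum>k\<in>{1..<i}. e k) = (\<Sum>k\<in>{j<..n}. e k)" by (simp add: add_ac)
    then have "left_start i = right_start j" by (simp add: left_start_def right_start_def)
    then have "i = 1 \<and> j = n" using left_start_eq_right_start t by metis
    then show ?thesis using 4 by (simp add: covers_left_def covers_right_def)
  qed
qed

text \<open>A squeeze: the left boundary of the tile is not to the left of the leftside path and not
  to the right of a contained side of that path, so the side lies on it and is one of its two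
  edges.\<close>

lemma left_side_in_rhomb:
  assumes t: "rhomb e q i j \<subseteq> reg ids" "1 \<le> i" "i < j" "j \<le> n" and k: "k \<in> {1..n}"
    and sub: "closed_segment (left_start k) (left_start k + e k) \<subseteq> rhomb e q i j"
  shows "k = i \<and> depth (left_start k) = depth q \<or> k = j \<and> depth (left_start k) = depth q + depth (e i)"
proof -
  let ?v = "left_start k"
  have ends: "depth q \<le> depth ?v" "depth ?v + depth (e k) \<le> depth q + (depth (e i) + depth (e j))"
    using sub ends_in_segment[of ?v "?v + e k"] rhomb_mem[OF t(2-4), of ?v q] rhomb_mem[OF t(2-4), of "?v + e k" q]
    by auto
  have "\<exists>l1 l2. [i, j] = l1 @ k # l2 \<and> depth ?v = depth (q + disp e l1) \<and> Re ?v = Re (q + disp e l1)"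
  proof (rule path_contains_segment)
    fix y assume y: "depth ?v < y" "y < depth ?v + depth (e k)"
    let ?z = "Complex (Re ?v + slope e k * (y - depth ?v)) (- y)"
    have z: "?z \<in> closed_segment ?v (?v + e k)"
      using y depth_pos[OF k] by (simp add: closed_segment_graph slope_def)
    then have "?z \<in> \<Union> (left_sides n p e)" unfolding left_sides_eq using k by blast
    then have "Re ?v + slope e k * (y - depth ?v) = path_at e p ids y"
      using k by (subst (asm) left_graph) auto
    moreover have "path_at e p ids y \<le> path_at e q [i, j] y"
      using y ends by (intro rhomb_in_reg[OF t]) auto
    moreover have "path_at e q [i, j] y \<le> Re ?v + slope e k * (y - depth ?v)"
      using z sub rhomb_mem[OF t(2-4), of ?z q] by auto
    ultimately show "path_at e q [i, j] y = Re ?v + slope e k * (y - depth ?v)" by simp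
  qed (use t k ends in auto)
  then show ?thesis by (auto simp: Cons_eq_append_conv)
qed

lemma right_side_in_rhomb:
  assumes t: "rhomb e q i j \<subseteq> reg ids" "1 \<le> i" "i < j" "j \<le> n" and k: "k \<in> {1..n}"
    and sub: "closed_segment (right_start k) (right_start k + e k) \<subseteq> rhomb e q i j"
  shows "k = j \<and> depth (right_start k) = depth q \<or> k = i \<and> depth (right_start k) = depth q + depth (e j)"
proof -
  let ?v = "right_start k"
  have ends: "depth q \<le> depth ?v" "depth ?v + depth (e k) \<le> depth q + (depth (e i) + depth (e j))"
    using sub ends_in_segment[of ?v "?v + e k"] rhomb_mem[OF t(2-4), of ?v q] rhomb_mem[OF t(2-4), of "?v + e k" q]
    by auto
  have "\<exists>l1 l2. [j, i] = l1 @ k # l2 \<and> depth ?v = depth (q + disp e l1) \<and> Re ?v = Re (q + disp e l1)"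
  proof (rule path_contains_segment)
    fix y assume y: "depth ?v < y" "y < depth ?v + depth (e k)"
    let ?z = "Complex (Re ?v + slope e k * (y - depth ?v)) (- y)"
    have z: "?z \<in> closed_segment ?v (?v + e k)"
      using y depth_pos[OF k] by (simp add: closed_segment_graph slope_def)
    then have "?z \<in> \<Union> (right_sides n p e (longest_perm n))" unfolding right_sides_eq using k by blast
    then have "Re ?v + slope e k * (y - depth ?v) = path_at e p (rev ids) y"
      using k by (subst (asm) right_graph) auto
    moreover have "path_at e q [j, i] y \<le> path_at e p (rev ids) y"
      using y ends by (intro rhomb_in_reg[OF t]) auto
    moreover have "Re ?v + slope e k * (y - depth ?v) \<le> path_at e q [j, i] y"
      using z sub rhomb_mem[OF t(2-4), of ?z q] by auto
    ultimately show "path_at e q [j, i] y = Re ?v + slope e k * (y - depth ?v)" by simp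
  qed (use t k ends in auto)
  then show ?thesis by (auto simp: Cons_eq_append_conv)
qed

text \<open>Two sides of the same boundary inside this tile would be the sides 1 and n placed end to
  end, but for n \<ge> 3 the side 2 or n - 1 separates them in depth.\<close>

lemma extreme_labels_not_side_perimeter:
  assumes "n \<ge> 3" "rhomb e q 1 n \<subseteq> reg ids"
  shows "\<not> side_perimeter_tile n p e (longest_perm n) (rhomb e q 1 n)"
proof
  assume "side_perimeter_tile n p e (longest_perm n) (rhomb e q 1 n)"
  then have "(\<exists>a\<in>left_sides n p e. \<exists>b\<in>left_sides n p e. a \<noteq> b \<and> a \<union> b \<subseteq> rhomb e q 1 n) \<or>
    (\<exists>a\<in>right_sides n p e (longest_perm n). \<exists>b\<in>right_sides n p e (longest_perm n).
      a \<noteq> b \<and> a \<union> b \<subseteq> rhomb e q 1 n)"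
    unfolding side_perimeter_tile_def left_perimeter_tile_def right_perimeter_tile_def
    by (elim disjE conjE) (rule disjI1, assumption, rule disjI2, assumption)
  then show False
  proof (elim disjE bexE conjE)
    fix a b assume ab: "a \<in> left_sides n p e" "b \<in> left_sides n p e" "a \<noteq> b" "a \<union> b \<subseteq> rhomb e q 1 n"
    obtain k where k1: "k \<in> {1..n}" "a = closed_segment (left_start k) (left_start k + e k)"
      using ab(1) unfolding left_sides_eq by (rule imageE)
    obtain k' where k2: "k' \<in> {1..n}" "b = closed_segment (left_start k') (left_start k' + e k')"
      using ab(2) unfolding left_sides_eq by (rule imageE)
    have k: "k \<in> {1..n}" "k' \<in> {1..n}" "k \<noteq> k'"
      "closed_segment (left_start k) (left_start k + e k) \<subseteq> rhomb e q 1 n"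
      "closed_segment (left_start k') (left_start k' + e k') \<subseteq> rhomb e q 1 n"
      using ab k1 k2 by auto
    have "depth (left_start 1) = depth q" "depth (left_start n) = depth q + depth (e 1)"
      using left_side_in_rhomb[OF assms(2) _ _ _ k(1,4)] left_side_in_rhomb[OF assms(2) _ _ _ k(2,5)] k(3) assms(1)
      by auto
    moreover have "depth (left_start 2) < depth (left_start n)"
      using assms(1) by (intro depth_left_start_less) auto
    moreover have "left_start 2 = left_start 1 + e 1" using left_start_Suc[of 1] by (simp add: numeral_2_eq_2)
    ultimately show False by simp
  next
    fix a b assume ab: "a \<in> right_sides n p e (longest_perm n)" "b \<in> right_sides n p e (longest_perm n)"
      "a \<noteq> b" "a \<union> b \<subseteq> rhomb e q 1 n"
    obtain k where k1: "k \<in> {1..n}" "a = closed_segment (right_start k) (right_start k + e k)"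
      using ab(1) unfolding right_sides_eq by (rule imageE)
    obtain k' where k2: "k' \<in> {1..n}" "b = closed_segment (right_start k') (right_start k' + e k')"
      using ab(2) unfolding right_sides_eq by (rule imageE)
    have k: "k \<in> {1..n}" "k' \<in> {1..n}" "k \<noteq> k'"
      "closed_segment (right_start k) (right_start k + e k) \<subseteq> rhomb e q 1 n"
      "closed_segment (right_start k') (right_start k' + e k') \<subseteq> rhomb e q 1 n"
      using ab k1 k2 by auto
    have "depth (right_start n) = depth q" "depth (right_start 1) = depth q + depth (e n)"
      using right_side_in_rhomb[OF assms(2) _ _ _ k(1,4)] right_side_in_rhomb[OF assms(2) _ _ _ k(2,5)] k(3) assms(1)
      by auto
    moreover have "depth (right_start (n - 1)) < depth (right_start 1)"
      using assms(1) by (intro depth_right_start_less) auto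
    moreover have "right_start (n - 1) = right_start n + e n" using right_start_pred[of n] assms(1) by simp
    ultimately show False by simp
  qed
qed

end

section \<open>Counting perimeter tiles\<close>

lemma before_prefix: "distinct (l1 @ k # l2) \<Longrightarrow> before (l1 @ k # l2) m k \<longleftrightarrow> m \<in> set l1"
  by (auto dest: before_in_set)

context downward_sides
begin

lemma partial_tilingD:
  assumes "partial_tiling ids T"
  shows "finite T" "pairwise (\<lambda>t t'. interior t \<inter> interior t' = {}) T" "t \<in> T \<Longrightarrow> t \<subseteq> reg ids"
  using assms unfolding partial_tiling_def by blast+

lemma tiling_labels:
  assumes "partial_tiling ids T"
  shows "\<exists>Q. T = (\<lambda>(i, j). rhomb e (Q i j) i j) ` {(i, j). 1 \<le> i \<and> i < j \<and> j \<le> n}"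
  using partial_tiling_unique_labels[OF assms perm_ids(1)] unfolding noninv_ids .

text \<open>For n = 2 the pair \<open>(1, n)\<close> is already one of the consecutive pairs, so the
  cardinality is then 1 instead of n.\<close>

definition perim_labels :: "(nat \<times> nat) set" where
  "perim_labels = insert (1, n) ((\<lambda>k. (k, Suc k)) ` {1..<n})"

lemma card_consecutive_labels: "card ((\<lambda>k. (k, Suc k)) ` {1..<n}) = n - 1"
  by (subst card_image) (auto simp: inj_on_def)

lemma card_perim_labels: "n \<ge> 2 \<Longrightarrow> card perim_labels \<le> n"
  unfolding perim_labels_def
  using card_insert_le_m1[of n "(\<lambda>k. (k, Suc k)) ` {1..<n}" "(1, n)"] card_consecutive_labels by simp

lemma perimeter_tiles_subset:
  assumes "partial_tiling ids T" "T = (\<lambda>(i, j). rhomb e (Q i j) i j) ` {(i, j). 1 \<le> i \<and> i < j \<and> j \<le> n}"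
  shows "{t \<in> T. perimeter_tile n p e (longest_perm n) t} \<subseteq> (\<lambda>(i, j). rhomb e (Q i j) i j) ` perim_labels"
proof
  fix t assume "t \<in> {t \<in> T. perimeter_tile n p e (longest_perm n) t}"
  then have t: "t \<in> T" "perimeter_tile n p e (longest_perm n) t" by auto
  obtain i j where ij: "1 \<le> i" "i < j" "j \<le> n" "t = rhomb e (Q i j) i j"
    using t(1) unfolding assms(2) by auto
  have "j = Suc i \<or> i = 1 \<and> j = n"
    using perimeter_tile_cases[of "Q i j" i j] partial_tilingD(3)[OF assms(1) t(1)] t(2) ij by auto
  then have "(i, j) \<in> perim_labels" using ij unfolding perim_labels_def by auto
  then show "t \<in> (\<lambda>(i, j). rhomb e (Q i j) i j) ` perim_labels" using ij(4) by force
qed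

lemma not_all_labels_perimeter:
  assumes T: "partial_tiling ids T" "T = (\<lambda>(i, j). rhomb e (Q i j) i j) ` {(i, j). 1 \<le> i \<and> i < j \<and> j \<le> n}"
    and n: "even n" "n \<ge> 4"
    and all: "\<And>i j. (i, j) \<in> perim_labels \<Longrightarrow> perimeter_tile n p e (longest_perm n) (rhomb e (Q i j) i j)"
  shows False
proof -
  have inT: "rhomb e (Q i j) i j \<in> T" if "1 \<le> i" "i < j" "j \<le> n" for i j
    unfolding T(2) using that by force
  note disj = partial_tilingD(2)[OF T(1)] and inreg = partial_tilingD(3)[OF T(1)]
  \<comment> \<open>\<open>A k\<close> places the tile \<open>(k, k + 1)\<close> at a left vertex;
    its negation will place it at a right vertex.\<close>
  define A where "A k \<longleftrightarrow> covers_left (Q k (Suc k)) k (Suc k) k \<and> covers_left (Q k (Suc k)) k (Suc k) (Suc k)" for k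
  have right: "covers_right (Q k (Suc k)) k (Suc k) k \<and> covers_right (Q k (Suc k)) k (Suc k) (Suc k)"
    if "\<not> A k" "1 \<le> k" "k < n" for k
  proof -
    have "perimeter_tile n p e (longest_perm n) (rhomb e (Q k (Suc k)) k (Suc k))"
      using that by (intro all) (auto simp: perim_labels_def)
    from perimeter_tile_cases[OF inreg[OF inT] _ _ _ this] show ?thesis
      using that n unfolding A_def by auto
  qed
  have top: "covers_left (Q 1 n) 1 n 1 \<and> covers_right (Q 1 n) 1 n n \<or>
    covers_left (Q 1 n) 1 n n \<and> covers_right (Q 1 n) 1 n 1"
  proof -
    have "perimeter_tile n p e (longest_perm n) (rhomb e (Q 1 n) 1 n)"
      by (intro all) (auto simp: perim_labels_def)
    from perimeter_tile_cases[OF inreg[OF inT] _ _ _ this] show ?thesis using n by auto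
  qed
  have alternate: "A (Suc k) \<longleftrightarrow> \<not> A k" if k: "1 \<le> k" "Suc k < n" for k
  proof (rule ccontr)
    assume "\<not> (A (Suc k) \<longleftrightarrow> \<not> A k)"
    then consider "A k" "A (Suc k)" | "\<not> A k" "\<not> A (Suc k)" by blast
    then show False
    proof cases
      case 1
      then have c: "covers_left (Q k (Suc k)) k (Suc k) (Suc k)"
        "covers_left (Q (Suc k) (Suc (Suc k))) (Suc k) (Suc (Suc k)) (Suc k)"
        unfolding A_def by blast+
      have "k = Suc k \<and> Suc k = Suc (Suc k)"
        by (rule covers_left_unique[OF disj _ _ _ inT c(1) _ _ _ inT c(2)]) (use k in auto)
      then show False by simp
    next
      case 2
      then have c: "covers_right (Q k (Suc k)) k (Suc k) (Suc k)"
        "covers_right (Q (Suc k) (Suc (Suc k))) (Suc k) (Suc (Suc k)) (Suc k)"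
        using right[of k] right[of "Suc k"] k by auto
      have "k = Suc k \<and> Suc k = Suc (Suc k)"
        by (rule covers_right_unique[OF disj _ _ _ inT c(1) _ _ _ inT c(2)]) (use k in auto)
      then show False by simp
    qed
  qed
  have alt: "A k \<longleftrightarrow> (odd k \<longleftrightarrow> A 1)" if "1 \<le> k" "k < n" for k
    using that
  proof (induction k rule: dec_induct)
    case (step m)
    then show ?case using alternate[of m] by auto
  qed simp
  \<comment> \<open>Here evenness of n enters: n - 1 is odd, so the alternation puts the first and
    the last consecutive tile on the same side.\<close>
  have last: "A (n - 1) \<longleftrightarrow> A 1" using alt[of "n - 1"] n by simp
  have Suc_n: "Suc (n - 1) = n" using n by simp
  \<comment> \<open>On that side, label 1 belongs to \<open>(1, 2)\<close> and label n to
    \<open>(n - 1, n)\<close>, while the tile \<open>(1, n)\<close> takes one of these two sides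
    wherever it sits.\<close>
  show False
  proof (cases "A 1")
    case True
    then have 1: "covers_left (Q 1 2) 1 2 1" and 2: "covers_left (Q (n - 1) n) (n - 1) n n"
      using last unfolding A_def Suc_n Suc_1 by blast+
    from top show False
    proof (elim disjE conjE)
      assume c: "covers_left (Q 1 n) 1 n 1"
      have "(1::nat) = 1 \<and> n = 2"
        by (rule covers_left_unique[OF disj _ _ _ inT c _ _ _ inT 1]) (use n in auto)
      then show False using n by simp
    next
      assume c: "covers_left (Q 1 n) 1 n n"
      have "1 = n - 1 \<and> n = n"
        by (rule covers_left_unique[OF disj _ _ _ inT c _ _ _ inT 2]) (use n in auto)
      then show False using n by simp
    qed
  next
    case False
    then have 1: "covers_right (Q 1 2) 1 2 1" and 2: "covers_right (Q (n - 1) n) (n - 1) n n"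
      using last right[of 1, unfolded Suc_1] right[of "n - 1", unfolded Suc_n] n by auto
    from top show False
    proof (elim disjE conjE)
      assume c: "covers_right (Q 1 n) 1 n n"
      have "1 = n - 1 \<and> n = n"
        by (rule covers_right_unique[OF disj _ _ _ inT c _ _ _ inT 2]) (use n in auto)
      then show False using n by simp
    next
      assume c: "covers_right (Q 1 n) 1 n 1"
      have "(1::nat) = 1 \<and> n = 2"
        by (rule covers_right_unique[OF disj _ _ _ inT c _ _ _ inT 1]) (use n in auto)
      then show False using n by simp
    qed
  qed
qed

lemma perim_le:
  assumes T: "partial_tiling ids T" and n: "n \<ge> 2"
  shows "perim n p e (longest_perm n) T \<le> 2 * ((n - 1) div 2) + 1"
proof -
  obtain Q where Q: "T = (\<lambda>(i, j). rhomb e (Q i j) i j) ` {(i, j). 1 \<le> i \<and> i < j \<and> j \<le> n}"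
    using tiling_labels[OF T] by blast
  let ?f = "\<lambda>(i, j). rhomb e (Q i j) i j" and ?P = "{t \<in> T. perimeter_tile n p e (longest_perm n) t}"
  note sub = perimeter_tiles_subset[OF T Q]
  have fin: "finite (?f ` perim_labels)" unfolding perim_labels_def by simp
  have "card (?f ` perim_labels) \<le> card perim_labels"
    by (intro card_image_le) (simp add: perim_labels_def)
  then have le: "card (?f ` perim_labels) \<le> n" using card_perim_labels[OF n] by simp
  have Ple: "card ?P \<le> card (?f ` perim_labels)" by (rule card_mono[OF fin sub])
  show ?thesis
  proof (cases "even n")
    case False
    then have "2 * ((n - 1) div 2) + 1 = n" using n by (auto elim!: oddE)
    then show ?thesis using Ple le unfolding perim_def by linarith
  next
    case True
    then have eq: "2 * ((n - 1) div 2) + 1 = n - 1" using n by (auto elim!: evenE)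
    have "card ?P \<le> n - 1"
    proof (cases "n = 2")
      case True
      then have "perim_labels = {(1, 2)}"
        unfolding perim_labels_def by (auto simp: numeral_2_eq_2)
      then show ?thesis using Ple True by simp
    next
      case False
      then have n4: "n \<ge> 4" using n True by (auto elim!: evenE)
      have "card ?P \<noteq> n"
      proof
        assume "card ?P = n"
        \<comment> \<open>At most n candidate tiles are available, so n perimeter tiles would
          exhaust them.\<close>
        then have "?P = ?f ` perim_labels" using le by (intro card_seteq[OF fin sub]) simp
        then have "perimeter_tile n p e (longest_perm n) (rhomb e (Q i j) i j)" if "(i, j) \<in> perim_labels" for i j
          using that by force
        then show False using not_all_labels_perimeter[OF T Q True n4] by blast
      qed
      then show ?thesis using Ple le by linarith
    qed
    then show ?thesis unfolding eq perim_def .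
  qed
qed

lemma card_side_perimeter_le:
  assumes T: "partial_tiling ids T" and n: "n \<ge> 2"
  shows "card {t \<in> T. side_perimeter_tile n p e (longest_perm n) t} \<le> n - 1" (is "card ?S \<le> _")
proof -
  let ?P = "{t \<in> T. perimeter_tile n p e (longest_perm n) t}"
  have SP: "?S \<subseteq> ?P"
    unfolding side_perimeter_tile_def left_perimeter_tile_def right_perimeter_tile_def by blast
  show ?thesis
  proof (cases "n = 2")
    \<comment> \<open>For n = 2 the only tile has the labels \<open>(1, n)\<close> and may be a side
      tile; the general bound already gives one perimeter tile at most.\<close>
    case True
    have "card ?S \<le> card ?P" using partial_tilingD(1)[OF T] SP by (intro card_mono) auto
    then show ?thesis using perim_le[OF T n] True by (simp add: perim_def)
  next
    case False
    then have n3: "n \<ge> 3" using n by simp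
    obtain Q where Q: "T = (\<lambda>(i, j). rhomb e (Q i j) i j) ` {(i, j). 1 \<le> i \<and> i < j \<and> j \<le> n}"
      using tiling_labels[OF T] by blast
    let ?f = "\<lambda>(i, j). rhomb e (Q i j) i j"
    have "?S \<subseteq> ?f ` ((\<lambda>k. (k, Suc k)) ` {1..<n})"
    proof
      fix t assume t: "t \<in> ?S"
      then have "t \<in> ?f ` perim_labels" using SP perimeter_tiles_subset[OF T Q] by blast
      then consider "t = rhomb e (Q 1 n) 1 n" | "t \<in> ?f ` ((\<lambda>k. (k, Suc k)) ` {1..<n})"
        unfolding perim_labels_def image_insert by auto
      then show "t \<in> ?f ` ((\<lambda>k. (k, Suc k)) ` {1..<n})"
      proof cases
        case 1
        then have "t \<subseteq> reg ids" using partial_tilingD(3)[OF T] t by blast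
        then show ?thesis using extreme_labels_not_side_perimeter[OF n3] t 1 by blast
      qed
    qed
    then have "card ?S \<le> card (?f ` ((\<lambda>k. (k, Suc k)) ` {1..<n}))" by (intro card_mono) auto
    also have "\<dots> \<le> card ((\<lambda>k. (k, Suc k)) ` {1..<n})" by (rule card_image_le) simp
    finally show ?thesis unfolding card_consecutive_labels .
  qed
qed

section \<open>Corner tiles and a tiling that attains the bound\<close>

lemma rhomb_commute: "rhomb e q i j = rhomb e q j i"
proof -
  have "{q, q + e i, q + e i + e j, q + e j} = {q, q + e j, q + e j + e i, q + e i}"
    by (auto simp: add_ac)
  then show ?thesis by (simp add: rhomb_def)
qed

lemma edge_of_rhomb:
  assumes "i \<in> {1..n}" "j \<in> {1..n}" "i \<noteq> j"
  shows "closed_segment q (q + e i) edge_of rhomb e q i j"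
    "closed_segment (q + e i) (q + e i + e j) edge_of rhomb e q i j"
proof -
  note np = rhomb_nonparallel[OF assms]
  show "closed_segment q (q + e i) edge_of rhomb e q i j"
    unfolding rhomb_def by (rule edge_of_parallelogram[OF np])
  \<comment> \<open>The lower edge is the first edge of the same parallelogram when it is read from
    the vertex \<open>q + e i\<close> with spanning vectors \<open>e j\<close> and
    \<open>- e i\<close>.\<close>
  have "closed_segment (q + e i) (q + e i + e j) edge_of
    convex hull {q + e i, q + e i + e j, q + e i + e j + - e i, q + e i + - e i}"
    by (rule edge_of_parallelogram) (use np in \<open>auto simp: mult.commute\<close>)
  moreover have "{q + e i, q + e i + e j, q + e i + e j + - e i, q + e i + - e i} =
    {q, q + e i, q + e i + e j, q + e j}" by auto
  ultimately show "closed_segment (q + e i) (q + e i + e j) edge_of rhomb e q i j"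
    by (simp add: rhomb_def)
qed

lemma side_subset_boundary:
  assumes "k \<in> {1..n}"
  shows "closed_segment (left_start k) (left_start k + e k) \<subseteq> elnitsky_boundary n p e (longest_perm n)"
    "closed_segment (right_start k) (right_start k + e k) \<subseteq> elnitsky_boundary n p e (longest_perm n)"
  unfolding elnitsky_boundary_def left_sides_eq right_sides_eq using assms by blast+

lemma consecutive_edges_distinct:
  assumes "i \<in> {1..n}" "j \<in> {1..n}"
  shows "closed_segment q (q + e i) \<noteq> closed_segment (q + e i) (q + e i + e j)"
proof
  assume "closed_segment q (q + e i) = closed_segment (q + e i) (q + e i + e j)"
  then have "q \<in> closed_segment (q + e i) (q + e i + e j)" by (metis ends_in_segment(1))
  then show False using depth_pos[OF assms(1)] depth_pos[OF assms(2)] by (simp add: closed_segment_graph)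
qed

lemma left_corner_perimeter:
  assumes "1 \<le> k" "k < n"
  shows "perimeter_tile n p e (longest_perm n) (rhomb e (left_start k) k (Suc k))"
  unfolding perimeter_tile_def
proof (intro exI conjI)
  have k: "k \<in> {1..n}" "Suc k \<in> {1..n}" "k \<noteq> Suc k" using assms by auto
  show "closed_segment (left_start k) (left_start k + e k) edge_of rhomb e (left_start k) k (Suc k)"
    "closed_segment (left_start k + e k) (left_start k + e k + e (Suc k)) edge_of rhomb e (left_start k) k (Suc k)"
    by (rule edge_of_rhomb[OF k])+
  show "closed_segment (left_start k) (left_start k + e k) \<noteq>
    closed_segment (left_start k + e k) (left_start k + e k + e (Suc k))"
    by (rule consecutive_edges_distinct[OF k(1,2)])
  show "closed_segment (left_start k) (left_start k + e k) \<inter>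
    closed_segment (left_start k + e k) (left_start k + e k + e (Suc k)) \<noteq> {}"
    by (metis disjoint_iff ends_in_segment)
  show "closed_segment (left_start k) (left_start k + e k) \<union>
    closed_segment (left_start k + e k) (left_start k + e k + e (Suc k)) \<subseteq> elnitsky_boundary n p e (longest_perm n)"
    using side_subset_boundary(1)[OF k(1)] side_subset_boundary(1)[OF k(2)] left_start_Suc[OF assms(1)] by simp
qed

lemma right_corner_perimeter:
  assumes "1 \<le> k" "k < n"
  shows "perimeter_tile n p e (longest_perm n) (rhomb e (right_start (Suc k)) k (Suc k))"
  unfolding perimeter_tile_def rhomb_commute[of _ k]
proof (intro exI conjI)
  let ?q = "right_start (Suc k)"
  have k: "k \<in> {1..n}" "Suc k \<in> {1..n}" "Suc k \<noteq> k" using assms by auto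
  show "closed_segment ?q (?q + e (Suc k)) edge_of rhomb e ?q (Suc k) k"
    "closed_segment (?q + e (Suc k)) (?q + e (Suc k) + e k) edge_of rhomb e ?q (Suc k) k"
    by (rule edge_of_rhomb[OF k(2,1,3)])+
  show "closed_segment ?q (?q + e (Suc k)) \<noteq> closed_segment (?q + e (Suc k)) (?q + e (Suc k) + e k)"
    by (rule consecutive_edges_distinct[OF k(2,1)])
  show "closed_segment ?q (?q + e (Suc k)) \<inter> closed_segment (?q + e (Suc k)) (?q + e (Suc k) + e k) \<noteq> {}"
    by (metis disjoint_iff ends_in_segment)
  show "closed_segment ?q (?q + e (Suc k)) \<union> closed_segment (?q + e (Suc k)) (?q + e (Suc k) + e k)
    \<subseteq> elnitsky_boundary n p e (longest_perm n)"
    using side_subset_boundary(2)[OF k(1)] side_subset_boundary(2)[OF k(2)] right_start_pred[OF k(2)] by simp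
qed

lemma top_corner_perimeter:
  assumes "n \<ge> 2"
  shows "perimeter_tile n p e (longest_perm n) (rhomb e p 1 n)"
  unfolding perimeter_tile_def
proof (intro exI conjI)
  have k: "1 \<in> {1..n}" "n \<in> {1..n}" "1 \<noteq> n" using assms by auto
  have start: "left_start 1 = p" "right_start n = p" by (auto simp: left_start_def right_start_def)
  show "closed_segment p (p + e 1) edge_of rhomb e p 1 n"
    by (rule edge_of_rhomb[OF k])
  show "closed_segment p (p + e n) edge_of rhomb e p 1 n"
    unfolding rhomb_commute[of p 1 n] by (rule edge_of_rhomb[OF k(2,1) k(3)[symmetric]])
  show "closed_segment p (p + e 1) \<noteq> closed_segment p (p + e n)"
  proof
    assume "closed_segment p (p + e 1) = closed_segment p (p + e n)"
    then have "p + e n \<in> closed_segment p (p + e 1)" by (metis ends_in_segment(2))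
    then have "Re (e n) = slope e 1 * depth (e n)"
      using depth_pos[OF k(1)] by (simp add: closed_segment_graph slope_def)
    then have "slope e n = slope e 1" using depth_pos[OF k(2)] by (simp add: Re_eq_slope)
    then show False using slope_less[OF k(1,2)] assms by simp
  qed
  show "closed_segment p (p + e 1) \<inter> closed_segment p (p + e n) \<noteq> {}"
    by (metis disjoint_iff ends_in_segment(1))
  show "closed_segment p (p + e 1) \<union> closed_segment p (p + e n) \<subseteq> elnitsky_boundary n p e (longest_perm n)"
    using side_subset_boundary(1)[OF k(1)] side_subset_boundary(2)[OF k(2)] start by simp
qed

text \<open>Since \<open>I\<close> has no two consecutive elements, the adjacent transpositions at
  its elements are disjoint, and their product inverts just these pairs. It is obtained by sorting
  with a perturbed key.\<close>

lemma exists_perm_noninv: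
  assumes "\<forall>k\<in>I. Suc k \<notin> I"
  shows "\<exists>u. perm u \<and> noninv u = {(i, j). 1 \<le> i \<and> i < j \<and> j \<le> n \<and> \<not> (i \<in> I \<and> j = Suc i)}"
proof -
  \<comment> \<open>the offset 3 moves \<open>k \<in> I\<close> just past \<open>k + 1\<close>\<close>
  define key where "key i = 2 * i + (if i \<in> I then 3 else 0)" for i :: nat
  define u where "u = sort_key key ids"
  have u: "perm u" using perm_ids(1) by (simp add: perm_def u_def)
  have srt: "sorted_wrt (\<lambda>x y. key x \<le> key y) u"
    using sorted_sort_key[of key ids] by (simp add: u_def sorted_map)
  have less: "key i < key j \<longleftrightarrow> \<not> (i \<in> I \<and> j = Suc i)" if "i < j" for i j
    using that assms by (cases "j = Suc i") (auto simp: key_def)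
  have neq: "key i \<noteq> key j" if "i < j" for i j
    using that assms by (cases "j = Suc i") (auto simp: key_def)
  have "before u i j \<longleftrightarrow> \<not> (i \<in> I \<and> j = Suc i)" if "1 \<le> i" "i < j" "j \<le> n" for i j
  proof -
    have "i \<in> set u" "j \<in> set u" using u that by (auto simp: perm_def)
    then have "before u i j \<or> before u j i" using before_total that by force
    then show ?thesis
      using sorted_wrt_beforeD[OF srt, of i j] sorted_wrt_beforeD[OF srt, of j i] less[OF that(2)] neq[OF that(2)]
      by auto
  qed
  moreover have "1 \<le> i \<and> j \<le> n" if "before u i j" for i j
    using before_in_set[OF that] u by (auto simp: perm_def)
  ultimately have "noninv u = {(i, j). 1 \<le> i \<and> i < j \<and> j \<le> n \<and> \<not> (i \<in> I \<and> j = Suc i)}"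
    unfolding noninv_def by auto
  then show ?thesis using u by blast
qed

lemma noninv_rev:
  assumes "perm u"
  shows "noninv (rev u) = {(i, j). 1 \<le> i \<and> i < j \<and> j \<le> n} - noninv u"
proof -
  have u: "distinct u" "set u = {1..n}" using assms by (auto simp: perm_def)
  have flip: "before u j i \<longleftrightarrow> \<not> before u i j" if "1 \<le> i" "i < j" "j \<le> n" for i j
    using before_total[of i u j] before_asym[OF u(1), of i j] that u(2) by auto
  show ?thesis
  proof (rule set_eqI)
    fix x :: "nat \<times> nat"
    obtain i j where x: "x = (i, j)" by (cases x)
    show "x \<in> noninv (rev u) \<longleftrightarrow> x \<in> {(i, j). 1 \<le> i \<and> i < j \<and> j \<le> n} - noninv u"
    proof (cases "1 \<le> i \<and> i < j \<and> j \<le> n")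
      case True
      then show ?thesis using flip[of i j] by (simp add: x noninv_def)
    next
      case False
      then show ?thesis using before_in_set[of u j i] u(2) by (auto simp: x noninv_def)
    qed
  qed
qed

lemma set_prefix:
  assumes "perm (l1 @ k # l2)"
  shows "set l1 = {m \<in> {1..n}. before (l1 @ k # l2) m k}"
proof -
  have l: "distinct (l1 @ k # l2)" "set (l1 @ k # l2) = {1..n}" using assms by (auto simp: perm_def)
  then show ?thesis using before_prefix[OF l(1)] by auto
qed

lemma disp_prefix:
  assumes "perm (l1 @ k # l2)" "set l1 = A"
  shows "disp e l1 = (\<Sum>i\<in>A. e i)"
  using assms by (auto simp: disp_def perm_def sum_list_distinct_conv_sum_set)

lemma partial_tiling_rev_ids: "partial_tiling (rev ids) {}"
  by (simp add: partial_tiling_def interior_reg[OF perm_ids(2)])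

text \<open>The tiling is swept through \<open>u1\<close>, whose inversions are the \<open>(k, k + 1)\<close> with \<open>k + n\<close> odd, and \<open>u2\<close>,
  whose non-inversions are the \<open>(k, k + 1)\<close> with \<open>k + n\<close> even. The sweep up to \<open>u1\<close> cuts off left corners,
  the sweep after \<open>u2\<close> right corners. For odd \<open>n\<close> it passes in between through
  \<open>1, n, \<dots>\<close> and \<open>n, 1, \<dots>\<close>, which puts the tile \<open>(1, n)\<close> at the top vertex.\<close>

lemma exists_corner_tiling:
  assumes n: "n \<ge> 2"
  shows "\<exists>T. partial_tiling ids T \<and>
    (\<forall>k. 1 \<le> k \<and> k < n \<and> odd (k + n) \<longrightarrow> rhomb e (left_start k) k (Suc k) \<in> T) \<and>
    (\<forall>k. 1 \<le> k \<and> k < n \<and> even (k + n) \<longrightarrow> rhomb e (right_start (Suc k)) k (Suc k) \<in> T) \<and>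
    (odd n \<longrightarrow> rhomb e p 1 n \<in> T)"
proof -
  obtain u1 where u1: "perm u1"
    "noninv u1 = {(i, j). 1 \<le> i \<and> i < j \<and> j \<le> n \<and> \<not> (i \<in> {k. odd (k + n)} \<and> j = Suc i)}"
    using exists_perm_noninv[of "{k. odd (k + n)}"] by auto
  obtain u' where u': "perm u'"
    "noninv u' = {(i, j). 1 \<le> i \<and> i < j \<and> j \<le> n \<and> \<not> (i \<in> {k. even (k + n)} \<and> j = Suc i)}"
    using exists_perm_noninv[of "{k. even (k + n)}"] by auto
  define u2 where "u2 = rev u'"
  have u2: "perm u2" "noninv u2 = {(i, j). 1 \<le> i \<and> i < n \<and> even (i + n) \<and> j = Suc i}"
    using u'(1) noninv_rev[OF u'(1)] unfolding u2_def u'(2) by (auto simp: perm_def)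
  have "noninv (rev ids) \<subseteq> noninv u2" by simp
  from partial_tiling_extend[OF u2(1) perm_ids(2) this partial_tiling_rev_ids]
  obtain S1 where S1: "partial_tiling u2 S1" "\<And>i j. (i, j) \<in> noninv u2 \<Longrightarrow>
    \<exists>l1 l2. perm (l1 @ i # j # l2) \<and> noninv (l1 @ i # j # l2) \<subseteq> noninv u2 \<and> rhomb e (p + disp e l1) i j \<in> S1"
    unfolding noninv_rev_ids Diff_empty by blast
  have right: "rhomb e (right_start (Suc k)) k (Suc k) \<in> S1" if k: "1 \<le> k" "k < n" "even (k + n)" for k
  proof -
    have "(k, Suc k) \<in> noninv u2" using k by (simp add: u2(2))
    then obtain l1 l2 where l: "perm (l1 @ k # Suc k # l2)" "noninv (l1 @ k # Suc k # l2) \<subseteq> noninv u2"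
      "rhomb e (p + disp e l1) k (Suc k) \<in> S1" using S1(2) by blast
    let ?l = "l1 @ k # Suc k # l2"
    have d: "distinct ?l" "set ?l = {1..n}" using l(1) by (auto simp: perm_def)
    \<comment> \<open>The path to which \<open>(k, k + 1)\<close> was attached keeps in order only
      pairs \<open>(m, m + 1)\<close> with the parity of \<open>k\<close>. It inverts
      \<open>(k - 1, k)\<close> and all non-consecutive pairs, so exactly the labels above
      \<open>k + 1\<close> precede \<open>k\<close>, and the tile starts at
      \<open>right_start (Suc k)\<close>.\<close>
    have char: "before ?l m k \<longleftrightarrow> Suc k < m" if m: "m \<in> {1..n}" for m
    proof
      assume b: "before ?l m k"
      have "m \<noteq> k" "m \<noteq> Suc k" using b before_prefix[OF d(1)] d(1) by auto
      moreover have "\<not> m < k"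
      proof
        assume "m < k"
        then have "(m, k) \<in> noninv u2" using b l(2) by (auto simp: noninv_def)
        then show False using k by (auto simp: u2(2))
      qed
      ultimately show "Suc k < m" by simp
    next
      assume "Suc k < m"
      then have "(k, m) \<notin> noninv ?l" using l(2) by (auto simp: u2(2))
      then have "\<not> before ?l k m" using \<open>Suc k < m\<close> by (simp add: noninv_def)
      moreover have "k \<in> set ?l" "m \<in> set ?l" using m k d(2) by auto
      ultimately show "before ?l m k" using before_total \<open>Suc k < m\<close> by (metis Suc_lessD less_irrefl)
    qed
    have "set l1 = {m \<in> {1..n}. Suc k < m}" unfolding set_prefix[OF l(1)] using char by blast
    also have "\<dots> = {Suc k<..n}" by auto
    finally show ?thesis using l(3) disp_prefix[OF l(1)] by (simp add: right_start_def)
  qed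
  have "\<exists>S2. S1 \<subseteq> S2 \<and> partial_tiling u1 S2 \<and> (odd n \<longrightarrow> rhomb e p 1 n \<in> S2)"
  proof (cases "even n")
    case True
    have "noninv u2 \<subseteq> noninv u1" unfolding u1(2) u2(2) by auto
    then show ?thesis using partial_tiling_extend[OF u1(1) u2(1) _ S1(1)] True by blast
  next
    case False
    then have "n \<noteq> 2" by auto
    with n have n3: "n \<ge> 3" by simp
    \<comment> \<open>The other labels keep their order from \<open>u1\<close>, which makes
      \<open>1, n, w\<close> and \<open>n, 1, w\<close> two neighbouring paths between
      \<open>u1\<close> and \<open>u2\<close>. Only labels 1 and n move, and the tile between the
      two paths starts at \<open>p\<close>.\<close>
    define w where "w = filter (\<lambda>x. x \<noteq> 1 \<and> x \<noteq> n) u1"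
    have u: "distinct u1" "set u1 = {1..n}" using u1(1) by (simp_all add: perm_def)
    have "distinct w" using u(1) by (simp add: w_def)
    moreover have "set w = {1..n} - {1, n}" unfolding w_def set_filter u(2) by blast
    ultimately have w: "distinct w" "set w = {1..n} - {1, n}" by blast+
    have "{1..n} = insert 1 (insert n ({1..n} - {1, n}))" using n3 by auto
    then have pm: "perm ([] @ 1 # n # w)" "perm (n # 1 # w)"
      using w n3 by (simp_all add: perm_def insert_commute)
    have sub1: "noninv u2 \<subseteq> noninv (n # 1 # w)"
    proof
      fix x assume "x \<in> noninv u2"
      then obtain k where k: "x = (k, Suc k)" "1 \<le> k" "k < n" "even (k + n)" by (auto simp: u2(2))
      have kn: "Suc k < n"
      proof (rule ccontr)
        assume "\<not> Suc k < n"
        then have "n = Suc k" using k by simp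
        then show False using k(4) by simp
      qed
      have "before (n # 1 # w) k (Suc k)"
      proof (cases "k = 1")
        case True
        then show ?thesis using w kn by simp
      next
        case False
        have "(k, Suc k) \<in> noninv u1" using k by (simp add: u1(2))
        then have "before w k (Suc k)"
          unfolding w_def using False k kn by (intro before_filter) (auto simp: noninv_def)
        then show ?thesis by simp
      qed
      then show "x \<in> noninv (n # 1 # w)" using k by (simp add: noninv_def)
    qed
    have sub2: "noninv (1 # n # w) \<subseteq> noninv u1"
    proof
      fix x assume "x \<in> noninv (1 # n # w)"
      then obtain i j where x: "x = (i, j)" "i < j" "before (1 # n # w) i j" by (auto simp: noninv_def)
      have "set (1 # n # w) = {1..n}" using pm(1) by (simp add: perm_def)
      then have "i \<in> {1..n}" "j \<in> {1..n}" using before_in_set[OF x(3)] by blast+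
      then have jn: "j \<le> n" "1 \<le> i" by simp_all
      have "i = 1 \<or> i = n \<or> before w i j" using x(3) unfolding before.simps by blast
      moreover have "i \<noteq> n" using x(2) jn by simp
      ultimately consider "i = 1" | "before w i j" by blast
      then show "x \<in> noninv u1"
      proof cases
        case 1
        \<comment> \<open>For odd n the number 1 + n is even, so \<open>(1, 2)\<close> is not
          inverted in \<open>u1\<close> and every pair \<open>(1, j)\<close> with 1 < j \<le> n is a
          non-inversion of it.\<close>
        then show ?thesis using x jn False by (auto simp: u1(2))
      next
        case 2
        then have "before u1 i j" unfolding w_def by (rule before_filterD)
        then show ?thesis using x by (simp add: noninv_def)
      qed
    qed
    obtain S where S: "S1 \<subseteq> S" "partial_tiling (n # 1 # w) S"
      using partial_tiling_extend[OF pm(2) u2(1) sub1 S1(1)] by blast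
    have "partial_tiling ([] @ 1 # n # w) (insert (rhomb e (p + disp e []) 1 n) S)"
      by (rule partial_tiling_insert) (use S(2) pm n in auto)
    then have "partial_tiling (1 # n # w) (insert (rhomb e p 1 n) S)" by simp
    from partial_tiling_extend[OF u1(1) _ sub2 this] pm(1) show ?thesis using S(1) by auto
  qed
  then obtain S2 where S2: "S1 \<subseteq> S2" "partial_tiling u1 S2" "odd n \<longrightarrow> rhomb e p 1 n \<in> S2" by blast
  have "noninv u1 \<subseteq> noninv ids" unfolding noninv_ids u1(2) by auto
  from partial_tiling_extend[OF perm_ids(1) u1(1) this S2(2)]
  obtain T where T: "S2 \<subseteq> T" "partial_tiling ids T" "\<forall>i j. (i, j) \<in> noninv ids - noninv u1 \<longrightarrow>
    (\<exists>l1 l2. perm (l1 @ i # j # l2) \<and> noninv u1 \<subseteq> noninv (l1 @ i # j # l2) \<and>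
      noninv (l1 @ i # j # l2) \<subseteq> noninv ids \<and> rhomb e (p + disp e l1) i j \<in> T)"
    by (elim exE conjE) (rule that)
  have left: "rhomb e (left_start k) k (Suc k) \<in> T" if k: "1 \<le> k" "k < n" "odd (k + n)" for k
  proof -
    have "(k, Suc k) \<in> noninv ids - noninv u1" using k by (simp add: noninv_ids u1(2))
    then obtain l1 l2 where l: "perm (l1 @ k # Suc k # l2)" "noninv u1 \<subseteq> noninv (l1 @ k # Suc k # l2)"
      "rhomb e (p + disp e l1) k (Suc k) \<in> T" using T(3) by blast
    let ?l = "l1 @ k # Suc k # l2"
    have d: "distinct ?l" "set ?l = {1..n}" using l(1) by (auto simp: perm_def)
    \<comment> \<open>The path at this moment still has every pair of \<open>noninv u1\<close> in
      order. This includes \<open>(k - 1, k)\<close>, because of the parity, and all non-consecutive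
      pairs, so exactly the labels below \<open>k\<close> precede \<open>k\<close>.\<close>
    have char: "before ?l m k \<longleftrightarrow> m < k" if m: "m \<in> {1..n}" for m
    proof
      assume b: "before ?l m k"
      show "m < k"
      proof (rule ccontr)
        assume "\<not> m < k"
        moreover have "m \<noteq> k" "m \<noteq> Suc k" using b before_prefix[OF d(1)] d(1) by auto
        ultimately have "(k, m) \<in> noninv u1" using m k by (auto simp: u1(2))
        then have "before ?l k m" using l(2) by (auto simp: noninv_def)
        then show False using before_asym[OF d(1)] b by blast
      qed
    next
      assume "m < k"
      then have "(m, k) \<in> noninv u1" using m k by (auto simp: u1(2))
      then show "before ?l m k" using l(2) by (auto simp: noninv_def)
    qed
    have "set l1 = {m \<in> {1..n}. m < k}" unfolding set_prefix[OF l(1)] using char by blast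
    also have "\<dots> = {1..<k}" using k by auto
    finally show ?thesis using l(3) disp_prefix[OF l(1)] by (simp add: left_start_def)
  qed
  show ?thesis
    using T(1,2) S2 left right by blast
qed

lemma exists_tiling_perim:
  assumes n: "n \<ge> 2"
  shows "\<exists>T. partial_tiling ids T \<and> 2 * ((n - 1) div 2) + 1 \<le> perim n p e (longest_perm n) T"
proof -
  obtain T where T: "partial_tiling ids T"
    "\<And>k. 1 \<le> k \<Longrightarrow> k < n \<Longrightarrow> odd (k + n) \<Longrightarrow> rhomb e (left_start k) k (Suc k) \<in> T"
    "\<And>k. 1 \<le> k \<Longrightarrow> k < n \<Longrightarrow> even (k + n) \<Longrightarrow> rhomb e (right_start (Suc k)) k (Suc k) \<in> T"
    "odd n \<Longrightarrow> rhomb e p 1 n \<in> T"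
    using exists_corner_tiling[OF n] by blast
  let ?P = "{t \<in> T. perimeter_tile n p e (longest_perm n) t}"
  define q where "q k = (if odd (k + n) then left_start k else right_start (Suc k))" for k
  define g where "g k = rhomb e (q k) k (Suc k)" for k
  have gP: "g ` {1..<n} \<subseteq> ?P"
    using T(2,3) left_corner_perimeter right_corner_perimeter by (auto simp: g_def q_def)
  have "inj_on g {1..<n}"
  proof (rule inj_onI)
    fix k k' assume "k \<in> {1..<n}" "k' \<in> {1..<n}" "g k = g k'"
    then show "k = k'" using rhomb_label_unique[of k "Suc k" k' "Suc k'" "q k" "q k'"] by (auto simp: g_def)
  qed
  then have card_g: "card (g ` {1..<n}) = n - 1" by (simp add: card_image)
  have fin: "finite ?P" using partial_tilingD(1)[OF T(1)] by simp
  have "2 * ((n - 1) div 2) + 1 \<le> card ?P"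
  proof (cases "even n")
    case True
    then have "2 * ((n - 1) div 2) + 1 = n - 1" using n by (auto elim!: evenE)
    then show ?thesis using card_mono[OF fin gP] card_g by simp
  next
    case False
    then have "n \<noteq> 2" by auto
    with n have n3: "n \<ge> 3" by simp
    have top: "rhomb e p 1 n \<in> ?P" using T(4) False top_corner_perimeter[OF n] by simp
    have "rhomb e p 1 n \<notin> g ` {1..<n}"
    proof
      assume "rhomb e p 1 n \<in> g ` {1..<n}"
      then obtain k where k: "k \<in> {1..<n}" "rhomb e p 1 n = rhomb e (q k) k (Suc k)"
        by (auto simp: g_def)
      then show False using rhomb_label_unique[of 1 n k "Suc k" p "q k"] n3 by auto
    qed
    then have "card (insert (rhomb e p 1 n) (g ` {1..<n})) = n" using card_g n by simp
    moreover have "card (insert (rhomb e p 1 n) (g ` {1..<n})) \<le> card ?P"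
      using gP top by (intro card_mono fin) simp
    moreover have "2 * ((n - 1) div 2) + 1 = n" using False by (auto elim!: oddE)
    ultimately show ?thesis by simp
  qed
  then show ?thesis using T(1) unfolding perim_def by blast
qed

end

text \<open>The slope of a side at angle \<theta> is the negative cotangent of \<theta>, which
  increases strictly between pi and 2 pi; the sine of a difference of two angles shows this without
  derivatives.\<close>

lemma elnitsky_sides_downward:
  assumes "elnitsky_sides n e"
  shows "downward_sides n e"
proof -
  obtain s \<theta> where s: "s > 0" "strict_mono_on {1..n} \<theta>" "\<theta> ` {1..n} \<subseteq> {pi<..<2 * pi}"
    "\<forall>i\<in>{1..n}. e i = rcis s (\<theta> i)"
    using assms by (auto simp: elnitsky_sides_def)
  have sin_neg: "sin (\<theta> i) < 0" if "i \<in> {1..n}" for i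
    using subsetD[OF s(3) imageI[OF that]] by (intro sin_lt_zero) auto
  have dep: "depth (e i) = - s * sin (\<theta> i)" and re: "Re (e i) = s * cos (\<theta> i)" if "i \<in> {1..n}" for i
    using s(4) that by (auto simp: depth_def)
  show ?thesis
  proof
    show "0 < depth (e i)" if "i \<in> {1..n}" for i
      using sin_neg[OF that] s(1) by (simp add: dep[OF that] mult_pos_neg)
    show "slope e i < slope e j" if i: "i \<in> {1..n}" and j: "j \<in> {1..n}" and "i < j" for i j
    proof -
      have "\<theta> i < \<theta> j" using s(2) that by (auto simp: strict_mono_on_def)
      moreover have "pi < \<theta> i" "\<theta> j < 2 * pi"
        using subsetD[OF s(3) imageI[OF i]] subsetD[OF s(3) imageI[OF j]] by auto
      ultimately have "sin (\<theta> j - \<theta> i) > 0" by (intro sin_gt_zero) auto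
      then have "cos (\<theta> i) * (- sin (\<theta> j)) < cos (\<theta> j) * (- sin (\<theta> i))"
        by (simp add: sin_diff algebra_simps)
      then have "cos (\<theta> i) / - sin (\<theta> i) < cos (\<theta> j) / - sin (\<theta> j)"
        using sin_neg[OF i] sin_neg[OF j] by (simp add: divide_simps algebra_simps)
      moreover have "slope e k = cos (\<theta> k) / - sin (\<theta> k)" if "k \<in> {1..n}" for k
        using s(1) by (simp add: slope_def dep[OF that] re[OF that])
      ultimately show ?thesis using i j by simp
    qed
  qed
qed

theorem theorem3p6:
  fixes n :: nat and p :: complex and e :: "nat \<Rightarrow> complex"
  assumes "n \<ge> 2" and "elnitsky_sides n e"
  shows "rhombic_tilings n p e (longest_perm n) \<noteq> {} \<and>
    finite (perim n p e (longest_perm n) ` rhombic_tilings n p e (longest_perm n)) \<and>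
    Max (perim n p e (longest_perm n) ` rhombic_tilings n p e (longest_perm n))
      = 2 * ((n - 1) div 2) + 1 \<and>
    2 * ((n - 1) div 2) + 1 = (if odd n then n else n - 1) \<and>
    (\<forall>T \<in> rhombic_tilings n p e (longest_perm n).
      card {t \<in> T. side_perimeter_tile n p e (longest_perm n) t} \<le> n - 1)"
proof -
  interpret downward_sides n e p by (rule elnitsky_sides_downward[OF assms(2)])
  let ?T = "rhombic_tilings n p e (longest_perm n)" and ?m = "2 * ((n - 1) div 2) + 1"
  note iff = rhombic_tilings_iff[OF assms(1)]
  have le: "perim n p e (longest_perm n) T \<le> ?m" if "T \<in> ?T" for T
    using perim_le assms(1) that iff by blast
  obtain T where T: "T \<in> ?T" "?m \<le> perim n p e (longest_perm n) T"
    using exists_tiling_perim[OF assms(1)] iff by blast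
  have fin: "finite (perim n p e (longest_perm n) ` ?T)"
    by (rule finite_subset[of _ "{..?m}"]) (use le in auto)
  have "Max (perim n p e (longest_perm n) ` ?T) = ?m"
    using fin le T by (intro Max_eqI) (auto intro: rev_image_eqI[OF T(1)] order_antisym)
  moreover have "?m = (if odd n then n else n - 1)"
    using assms(1) by (cases "even n") (auto elim!: evenE oddE)
  moreover have "\<forall>T\<in>?T. card {t \<in> T. side_perimeter_tile n p e (longest_perm n) t} \<le> n - 1"
    using card_side_perimeter_le assms(1) iff by blast
  ultimately show ?thesis using T(1) fin by blast
qed

end
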